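(* Let $V$ be a finite-dimensional graded vector space over a field of characteristic $0$. Suppose $(V,b,q)$ is a quadratic pre-Lie algebra or, more generally, $(\mathcal P(V),\{\ ,\ \},\Omega_Q)$ is a Pinczon pre-Lie algebra, with $Q$ the corresponding coderivation. Then the operator $d:\mathcal P(V)\to\mathcal P(V)$ defined by $d\Omega=\{\Omega_Q,\Omega\}$ is a coboundary operator, and the corresponding cohomology coincides with the $(V,Q)$-cohomology.
   Context: Degrees and signs. $|x|$ is the degree of $x$ in $V$; $V[1]$ is $V$ with shifted degree $\deg(x)=|x|-1$; scalars have degree $0$. All formulas use Koszul's sign rule: in any relation between homogeneous objects, the first term has sign $+$ and every other term is implicitly multiplied by the sign of the permutation of the odd letters relating it to the first term. $b$ is a symmetric non-degenerate bilinear form of degree $0$ on $V$; $B(x,y)=(-1)^{\deg x}b(x,y)$ on $V[1]$. Pre-Lie algebras. A left pre-Lie algebra is $(V,q)$ with $q(x,q(y,z))-q(q(x,y),z)=q(y,q(x,z))-q(q(y,x),z)$. It is quadratic, $(V,b,q)$, if $b(q(x,y),z)+b(y,q(x,z))=0$. The associated map is $Q(x\otimes y)=(-1)^{\deg x}q(x,y)$, $P^1\to P^0$ (notation below); it gives a degree $1$ coderivation with $[Q,Q]=0$. Coderivations. $P^k=S^k(V[1])\otimes V[1]$, $P=\sum_{k\ge0}P^k$, $x_{[1,k]}\otimes y=x_1\cdot\ldots\cdot x_k\otimes y$, with coproduct $\Delta(1\otimes y)=0$, $\Delta(x_{[1,k]}\otimes y)=\sum_{1\le j\le k,\ I\sqcup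 J=[1,k]\setminus\{j\}}(x_I\otimes x_j)\bigotimes(x_J\otimes y)$. A linear $Q:P^k\to P^0$ extends to a coderivation by $Q(x_{[1,n]}\otimes y)=\sum_{I\sqcup J=[1,n],\,\#J=k}x_I\otimes Q(x_J\otimes y)+\sum_{1\le j\le n,\ I\sqcup J=[1,n]\setminus\{j\},\ \#J=k}x_I\cdot Q(x_J\otimes x_j)\otimes y$; $[Q,Q']$ is the commutator of coderivations. A degree $1$ coderivation $Q$ of $(P,\Delta)$ with $[Q,Q]=0$ is a pre-$L_\infty$ structure on $V$; then the operator $C\mapsto[Q,C]$ is a coboundary operator, and the corresponding cohomology is called the $(V,Q)$-cohomology. A coderivation $Q=\sum_kQ_k$ is $B$-quadratic if $B(Q_k(x_{[1,k]}\otimes y_1),y_2)=B(Q_k(x_{[1,k]}\otimes y_2),y_1)$ for all $k$. One puts $\Omega_Q(x_{[1,k]}\otimes y_1\cdot y_2)=B(Q(x_{[1,k]}\otimes y_1),y_2)+B(Q(x_{[1,k]}\otimes y_2),y_1)$. Bi-symmetric forms and bracket. $\mathcal C^2$ is the space of bilinear cyclic (symmetric) forms on $V[1]$; $\mathcal S(V)$ is the commutative algebra of symmetric forms on $V[1]$ with product $(\beta\cdot\beta')(x_1,\dots,x_{k+k'})=\sum_{I\sqcup J=[1,k+k'],\,\#I=k}\beta(x_I)\beta'(x_J)$; $\mathcal P_k$ is the space of $(k+2)$-linear forms separately symmetric in their first $k$ and last two variables; $\mathcal P(V)=\sum_{k\ge0}\mathcal P_k=\mathcal S(V)\otimes\mathcal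 C^2$, whose elements are called bi-symmetric forms. The Pinczon bracket associated to $b$ on cyclic forms is $\{\Omega,\Omega'\}=\sum_i(\iota_{e_i}\Omega\otimes\iota_{e'_i}\Omega')^{Cycl}$, where $(e_i),(e'_i)$ are bases of $V$ with $b(e_i,e'_j)=\delta_{ij}$, $\iota_x\Omega=\Omega(x,\cdot,\dots,\cdot)$ and $Cycl$ means the sum over cyclic permutations of the variables; it extends to $\mathcal P(V)$ by $\{\beta\otimes\alpha,\beta'\otimes\alpha'\}=\beta\cdot\{\alpha,\beta'\}\otimes\alpha'+\beta'\cdot\{\beta,\alpha'\}\otimes\alpha+\beta\cdot\beta'\otimes\{\alpha,\alpha'\}$. A Pinczon pre-Lie algebra is such a bracket together with a degree $3$ form $\Omega\in\mathcal P(V)$ with $\{\Omega,\Omega\}=0$; one writes $\Omega=\Omega_Q$, where $Q=\sum_kQ_k$ is a pre-$L_\infty$ structure with each $Q_k$ $B$-quadratic.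
   Formalization: The (V,Q)-cohomology is taken on B-quadratic coderivations C only; on all coderivations the claim fails, e.g. for V one-dimensional in degree 0 with q=0, where P(V)=0 but nonzero coderivations exist. "Coincides" means isomorphic via C ↦ Ω_C, with degree n matched to degree n+2. *)

theory Defs
  imports Complex_Main "HOL-Library.Multiset" "HOL-Library.Function_Algebras"
begin

section \<open>Graded spaces and Koszul signs\<close>

definition sg :: "int \<Rightarrow> 'a::ab_group_add \<Rightarrow> 'a" where
  "sg n a = (if even n then a else - a)"

definition fscale :: "'k::field_char_0 \<Rightarrow> ('x \<Rightarrow> 'k) \<Rightarrow> 'x \<Rightarrow> 'k" where
  "fscale c f = (\<lambda>x. c * f x)"

text \<open>A finite-dimensional space \<open>\<Oplus>n. V n\<close>, with \<open>V n\<close> the vectors \<open>x\<close> with \<open>|x| = n\<close>.\<close>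

definition graded_space ::
  "('k::field_char_0 \<Rightarrow> 'v::ab_group_add \<Rightarrow> 'v) \<Rightarrow> (int \<Rightarrow> 'v set) \<Rightarrow> bool" where
  "graded_space s V \<longleftrightarrow>
     vector_space s \<and> (\<exists>B. finite B \<and> module.span s B = UNIV) \<and>
     (\<forall>n. module.subspace s (V n)) \<and>
     (\<forall>x. \<exists>!f. (\<forall>n. f n \<in> V n) \<and> finite {n. f n \<noteq> 0} \<and> x = (\<Sum>n | f n \<noteq> 0. f n))"

text \<open>
  Signs are only attached to homogeneous vectors. \<open>deg\<close> is the degree in \<open>V[1]\<close>. It is meaningful
  for nonzero homogeneous vectors only; every signed expression below vanishes on the zero vector.
\<close>

definition homog :: "(int \<Rightarrow> 'v set) \<Rightarrow> 'v \<Rightarrow> bool" where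
  "homog V x \<longleftrightarrow> (\<exists>n. x \<in> V n)"

definition deg :: "(int \<Rightarrow> 'v set) \<Rightarrow> 'v \<Rightarrow> int" where
  "deg V x = (THE n. x \<in> V n) - 1"

definition ldeg :: "(int \<Rightarrow> 'v set) \<Rightarrow> 'v list \<Rightarrow> int" where
  "ldeg V xs = sum_list (map (deg V) xs)"

text \<open>
  \<open>unshuffle V F x\<^sub>1\<dots>x\<^sub>k\<close> is the sum over \<open>I \<squnion> J = [1,k]\<close> of \<open>\<epsilon> F(x\<^sub>I, x\<^sub>J)\<close>, and
  \<open>unshuffle1 V F x\<^sub>1\<dots>x\<^sub>k\<close> the sum over \<open>1 \<le> j \<le> k\<close>, \<open>I \<squnion> J = [1,k] \ {j}\<close> of
  \<open>\<epsilon> F(x\<^sub>I, x\<^sub>j, x\<^sub>J)\<close>, where \<open>\<epsilon>\<close> is the sign of the permutation of odd letters that carries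
  \<open>x\<^sub>1\<dots>x\<^sub>k\<close> to \<open>x\<^sub>I x\<^sub>J\<close>, respectively to \<open>x\<^sub>I x\<^sub>j x\<^sub>J\<close>.
\<close>

fun unshuffle ::
  "(int \<Rightarrow> 'v set) \<Rightarrow> ('v list \<Rightarrow> 'v list \<Rightarrow> 'a::ab_group_add) \<Rightarrow> 'v list \<Rightarrow> 'a" where
  "unshuffle V F [] = F [] []"
| "unshuffle V F (x # xs) =
     unshuffle V (\<lambda>I J. F (x # I) J) xs +
     unshuffle V (\<lambda>I J. sg (deg V x * ldeg V I) (F I (x # J))) xs"

definition unshuffle1 ::
  "(int \<Rightarrow> 'v set) \<Rightarrow> ('v list \<Rightarrow> 'v \<Rightarrow> 'v list \<Rightarrow> 'a::ab_group_add) \<Rightarrow> 'v list \<Rightarrow> 'a" where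
  "unshuffle1 V F =
     unshuffle V (\<lambda>I K. unshuffle V (\<lambda>M J. if length M = 1 then F I (hd M) J else 0) K)"

section \<open>Quadratic spaces and quadratic pre-Lie algebras\<close>

definition bilin ::
  "('k::field_char_0 \<Rightarrow> 'v::ab_group_add \<Rightarrow> 'v) \<Rightarrow>
   ('k \<Rightarrow> 'w::ab_group_add \<Rightarrow> 'w) \<Rightarrow> ('v \<Rightarrow> 'v \<Rightarrow> 'w) \<Rightarrow> bool" where
  "bilin s t m \<longleftrightarrow>
     (\<forall>x. Vector_Spaces.linear s t (m x)) \<and> (\<forall>y. Vector_Spaces.linear s t (\<lambda>x. m x y))"

definition quadratic_form ::
  "('k::field_char_0 \<Rightarrow> 'v::ab_group_add \<Rightarrow> 'v) \<Rightarrow> (int \<Rightarrow> 'v set) \<Rightarrow> ('v \<Rightarrow> 'v \<Rightarrow> 'k) \<Rightarrow> bool" where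
  "quadratic_form s V b \<longleftrightarrow>
     bilin s (*) b \<and>
     (\<forall>m n. \<forall>x\<in>V m. \<forall>y\<in>V n. b x y = sg (m * n) (b y x)) \<and>
     (\<forall>m n. \<forall>x\<in>V m. \<forall>y\<in>V n. m + n \<noteq> 0 \<longrightarrow> b x y = 0) \<and>
     (\<forall>x. (\<forall>y. b x y = 0) \<longrightarrow> x = 0)"

definition Bform :: "(int \<Rightarrow> 'v set) \<Rightarrow> ('v \<Rightarrow> 'v \<Rightarrow> 'k::field_char_0) \<Rightarrow> 'v \<Rightarrow> 'v \<Rightarrow> 'k" where
  "Bform V b x y = sg (deg V x) (b x y)"

text \<open>The list \<open>(e\<^sub>1,e'\<^sub>1), (e\<^sub>2,e'\<^sub>2), \<dots>\<close> of a pair of dual homogeneous bases; linear independence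
  follows from duality.\<close>

definition dual_bases ::
  "('k::field_char_0 \<Rightarrow> 'v::ab_group_add \<Rightarrow> 'v) \<Rightarrow> (int \<Rightarrow> 'v set) \<Rightarrow> ('v \<Rightarrow> 'v \<Rightarrow> 'k) \<Rightarrow>
   ('v \<times> 'v) list \<Rightarrow> bool" where
  "dual_bases s V b E \<longleftrightarrow>
     (\<forall>(e, e') \<in> set E. homog V e \<and> homog V e') \<and>
     (\<forall>i<length E. \<forall>j<length E. b (fst (E ! i)) (snd (E ! j)) = (if i = j then 1 else 0)) \<and>
     module.span s (fst ` set E) = UNIV \<and> module.span s (snd ` set E) = UNIV"

definition quadratic_prelie ::
  "('k::field_char_0 \<Rightarrow> 'v::ab_group_add \<Rightarrow> 'v) \<Rightarrow> (int \<Rightarrow> 'v set) \<Rightarrow> ('v \<Rightarrow> 'v \<Rightarrow> 'k) \<Rightarrow>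
   ('v \<Rightarrow> 'v \<Rightarrow> 'v) \<Rightarrow> bool" where
  "quadratic_prelie s V b q \<longleftrightarrow>
     bilin s s q \<and>
     (\<forall>l m. \<forall>x\<in>V l. \<forall>y\<in>V m. q x y \<in> V (l + m)) \<and>
     (\<forall>l m n. \<forall>x\<in>V l. \<forall>y\<in>V m. \<forall>z\<in>V n.
        q x (q y z) - q (q x y) z = sg (l * m) (q y (q x z) - q (q y x) z)) \<and>
     (\<forall>l m n. \<forall>x\<in>V l. \<forall>y\<in>V m. \<forall>z\<in>V n.
        b (q x y) z + sg (l * m) (b y (q x z)) = 0)"

section \<open>Forms on V[1]\<close>

text \<open>
  A form is recorded by its values on lists of homogeneous vectors, of all lengths at once: the
  restriction of \<open>f\<close> to lists of length \<open>k\<close> is its \<open>k\<close>-linear component. A multilinear form is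
  determined by these values, and they are subject only to linearity on each \<open>V n\<close>.
  So \<open>mforms\<close> consists of formal sums; \<open>finitary\<close> singles out the finite ones.
\<close>

definition mforms ::
  "('k::field_char_0 \<Rightarrow> 'v::ab_group_add \<Rightarrow> 'v) \<Rightarrow> (int \<Rightarrow> 'v set) \<Rightarrow> ('v list \<Rightarrow> 'k) set" where
  "mforms s V = {f.
     (\<forall>zs. (\<exists>z\<in>set zs. \<not> homog V z) \<longrightarrow> f zs = 0) \<and>
     (\<forall>us ws n. \<forall>x\<in>V n. \<forall>y\<in>V n. f (us @ (x + y) # ws) = f (us @ x # ws) + f (us @ y # ws)) \<and>
     (\<forall>us ws n. \<forall>x\<in>V n. \<forall>c. f (us @ s c x # ws) = c * f (us @ x # ws))}"

definition finitary :: "('v list \<Rightarrow> 'a::zero) \<Rightarrow> bool" where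
  "finitary f \<longleftrightarrow> (\<exists>N. \<forall>zs. length zs > N \<longrightarrow> f zs = 0)"

text \<open>Scalars have degree 0, so a form of degree \<open>n\<close> lives on arguments of total degree \<open>-n\<close>.\<close>

definition has_degree :: "(int \<Rightarrow> 'v set) \<Rightarrow> int \<Rightarrow> ('v list \<Rightarrow> 'k::field_char_0) \<Rightarrow> bool" where
  "has_degree V n f \<longleftrightarrow> (\<forall>zs. f zs \<noteq> 0 \<longrightarrow> ldeg V zs = - n)"

definition sym_forms ::
  "('k::field_char_0 \<Rightarrow> 'v::ab_group_add \<Rightarrow> 'v) \<Rightarrow> (int \<Rightarrow> 'v set) \<Rightarrow> ('v list \<Rightarrow> 'k) set" where
  "sym_forms s V = {f \<in> mforms s V.
     \<forall>us x y ws. f (us @ x # y # ws) = sg (deg V x * deg V y) (f (us @ y # x # ws))}"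

definition sym2_forms ::
  "('k::field_char_0 \<Rightarrow> 'v::ab_group_add \<Rightarrow> 'v) \<Rightarrow> (int \<Rightarrow> 'v set) \<Rightarrow> ('v list \<Rightarrow> 'k) set" where
  "sym2_forms s V = {f \<in> sym_forms s V. \<forall>zs. length zs \<noteq> 2 \<longrightarrow> f zs = 0}"

text \<open>
  The space of bi-symmetric forms: \<open>bisym True\<close> is the direct sum of the spaces of \<open>(k+2)\<close>-linear
  bi-symmetric forms, \<open>bisym False\<close> its completion by formal sums over \<open>k\<close>.
  The condition on \<open>ws\<close> leaves out the exchange of the last of the first \<open>k\<close> variables with the
  first of the last two.
\<close>

definition bisym ::
  "bool \<Rightarrow> ('k::field_char_0 \<Rightarrow> 'v::ab_group_add \<Rightarrow> 'v) \<Rightarrow> (int \<Rightarrow> 'v set) \<Rightarrow> ('v list \<Rightarrow> 'k) set" where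
  "bisym fin s V = {f \<in> mforms s V.
     (\<forall>zs. length zs < 2 \<longrightarrow> f zs = 0) \<and>
     (\<forall>us x y ws. length ws \<noteq> 1 \<longrightarrow>
        f (us @ x # y # ws) = sg (deg V x * deg V y) (f (us @ y # x # ws))) \<and>
     (fin \<longrightarrow> finitary f)}"

definition bisym_deg ::
  "bool \<Rightarrow> ('k::field_char_0 \<Rightarrow> 'v::ab_group_add \<Rightarrow> 'v) \<Rightarrow> (int \<Rightarrow> 'v set) \<Rightarrow> int \<Rightarrow>
   ('v list \<Rightarrow> 'k) set" where
  "bisym_deg fin s V n = {f \<in> bisym fin s V. has_degree V n f}"

text \<open>
  The forms are letters of the sign rule as well. A form that does not vanish on its
  arguments has the parity of their total degree, so the resulting signs can be read off from the
  arguments alone; this makes all the operations below bilinear without decomposing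
  forms into homogeneous components. The sign in \<open>sym_prod\<close>, for instance, comes from moving \<open>\<beta>'\<close>
  over \<open>x\<^sub>I\<close>.
\<close>

definition sym_prod ::
  "(int \<Rightarrow> 'v set) \<Rightarrow> ('v list \<Rightarrow> 'k::field_char_0) \<Rightarrow> ('v list \<Rightarrow> 'k) \<Rightarrow> 'v list \<Rightarrow> 'k" where
  "sym_prod V \<beta> \<beta>' = unshuffle V (\<lambda>I J. sg (ldeg V J * ldeg V I) (\<beta> I * \<beta>' J))"

definition tensor ::
  "(int \<Rightarrow> 'v set) \<Rightarrow> ('v list \<Rightarrow> 'k::field_char_0) \<Rightarrow> ('v list \<Rightarrow> 'k) \<Rightarrow> 'v list \<Rightarrow> 'k" where
  "tensor V \<beta> \<alpha> zs =
     (if length zs < 2 then 0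
      else let xs = take (length zs - 2) zs; ys = drop (length zs - 2) zs
           in sg (ldeg V ys * ldeg V xs) (\<beta> xs * \<alpha> ys))"

section \<open>The Pinczon bracket\<close>

text \<open>
  \<open>contract V E \<Omega> \<Omega>' A C A' C'\<close> is the sum over \<open>i\<close> of \<open>\<Omega>(A,e\<^sub>i,C) \<Omega>'(A',e'\<^sub>i,C')\<close> with the sign of
  the permutation of letters from \<open>\<Omega> \<Omega>' e\<^sub>i e'\<^sub>i A C A' C'\<close> to \<open>\<Omega> A e\<^sub>i C \<Omega>' A' e'\<^sub>i C'\<close>. Here \<open>e\<^sub>i\<close> and
  \<open>e'\<^sub>i\<close> have the same parity because \<open>b\<close> has degree 0.
\<close>

definition contract ::
  "(int \<Rightarrow> 'v set) \<Rightarrow> ('v \<times> 'v) list \<Rightarrow> ('v list \<Rightarrow> 'k::field_char_0) \<Rightarrow> ('v list \<Rightarrow> 'k) \<Rightarrow>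
   'v list \<Rightarrow> 'v list \<Rightarrow> 'v list \<Rightarrow> 'v list \<Rightarrow> 'k" where
  "contract V E \<Omega> \<Omega>' A C A' C' =
     (\<Sum>(e, e')\<leftarrow>E.
        sg ((ldeg V A' + deg V e + ldeg V C') * (ldeg V A + deg V e + ldeg V C)
            + deg V e * (ldeg V C + ldeg V A'))
          (\<Omega> (A @ e # C) * \<Omega>' (A' @ e' # C')))"

text \<open>The bracket of cyclic forms; \<open>r\<close> runs over the cyclic permutations of the variables, \<open>m\<close> over
  the ways to distribute them, of which one is relevant when \<open>\<Omega>\<close> and \<open>\<Omega>'\<close> have fixed arities.\<close>

definition cyc_bracket ::
  "(int \<Rightarrow> 'v set) \<Rightarrow> ('v \<times> 'v) list \<Rightarrow> ('v list \<Rightarrow> 'k::field_char_0) \<Rightarrow> ('v list \<Rightarrow> 'k) \<Rightarrow>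
   'v list \<Rightarrow> 'k" where
  "cyc_bracket V E \<Omega> \<Omega>' zs =
     (\<Sum>r<max 1 (length zs). sg (ldeg V (take r zs) * ldeg V (drop r zs))
        (let w = drop r zs @ take r zs
         in \<Sum>m\<le>length zs. contract V E \<Omega> \<Omega>' [] (take m w) [] (drop m w)))"

text \<open>
  The bracket of bi-symmetric forms, evaluated on \<open>x\<^sub>1\<dots>x\<^sub>k y\<^sub>1 y\<^sub>2\<close>. It is the bilinear extension of
  \<open>{\<beta>\<otimes>\<alpha>, \<beta>'\<otimes>\<alpha>'} = \<beta>\<cdot>{\<alpha>,\<beta>'}\<otimes>\<alpha>' + \<beta>'\<cdot>{\<beta>,\<alpha>'}\<otimes>\<alpha> + \<beta>\<cdot>\<beta>'\<otimes>{\<alpha>,\<alpha>'}\<close>, see \<open>bracket_tensor\<close> below; the three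
  summands correspond to the three on the right-hand side.
\<close>

definition bracket ::
  "(int \<Rightarrow> 'v set) \<Rightarrow> ('v \<times> 'v) list \<Rightarrow> ('v list \<Rightarrow> 'k::field_char_0) \<Rightarrow> ('v list \<Rightarrow> 'k) \<Rightarrow>
   'v list \<Rightarrow> 'k" where
  "bracket V E \<Omega> \<Omega>' zs =
     (if length zs < 2 then 0
      else let k = length zs - 2; xs = take k zs; y1 = zs ! k; y2 = zs ! (k + 1) in
        unshuffle1 V (\<lambda>I x J. contract V E \<Omega> \<Omega>' I [x] [] (J @ [y1, y2])) xs
        + unshuffle1 V (\<lambda>I x J.
            sg (deg V x * ldeg V J + (deg V y1 + deg V y2) * (ldeg V J + deg V x))
              (contract V E \<Omega> \<Omega>' [] (I @ [y1, y2]) J [x])) xs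
        + unshuffle V (\<lambda>I J.
            sg (deg V y1 * ldeg V J) (contract V E \<Omega> \<Omega>' I [y1] J [y2])
            + sg (deg V y2 * ldeg V J + deg V y1 * deg V y2) (contract V E \<Omega> \<Omega>' I [y2] J [y1])) xs)"

definition pinczon_prelie ::
  "bool \<Rightarrow> ('k::field_char_0 \<Rightarrow> 'v::ab_group_add \<Rightarrow> 'v) \<Rightarrow> (int \<Rightarrow> 'v set) \<Rightarrow> ('v \<times> 'v) list \<Rightarrow>
   ('v list \<Rightarrow> 'k) \<Rightarrow> bool" where
  "pinczon_prelie fin s V E \<Omega> \<longleftrightarrow> \<Omega> \<in> bisym_deg fin s V 3 \<and> bracket V E \<Omega> \<Omega> = 0"

section \<open>The coalgebra P and its coderivations\<close>

text \<open>
  \<open>pforms\<close> is the dual of \<open>P = S(V[1]) \<otimes> V[1]\<close>, and \<open>P\<close> itself is realized as a space of functionals on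
  it: the element \<open>x\<^sub>1\<cdot>\<dots>\<cdot>x\<^sub>k \<otimes> y\<close> is evaluation at the list \<open>[x\<^sub>1,\<dots>,x\<^sub>k,y]\<close>. Over a field,
  forms separate the elements of this tensor product, so that no further relations are imposed.
\<close>

type_synonym ('v, 'k) pelem = "('v list \<Rightarrow> 'k) \<Rightarrow> 'k"

definition pforms ::
  "('k::field_char_0 \<Rightarrow> 'v::ab_group_add \<Rightarrow> 'v) \<Rightarrow> (int \<Rightarrow> 'v set) \<Rightarrow> ('v list \<Rightarrow> 'k) set" where
  "pforms s V = {f \<in> mforms s V. f [] = 0 \<and>
     (\<forall>us x y ws. ws \<noteq> [] \<longrightarrow>
        f (us @ x # y # ws) = sg (deg V x * deg V y) (f (us @ y # x # ws)))}"

definition mon ::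
  "('k::field_char_0 \<Rightarrow> 'v::ab_group_add \<Rightarrow> 'v) \<Rightarrow> (int \<Rightarrow> 'v set) \<Rightarrow> 'v list \<Rightarrow> ('v, 'k) pelem" where
  "mon s V zs = (\<lambda>f. if f \<in> pforms s V then f zs else 0)"

definition P_space ::
  "('k::field_char_0 \<Rightarrow> 'v::ab_group_add \<Rightarrow> 'v) \<Rightarrow> (int \<Rightarrow> 'v set) \<Rightarrow> ('v, 'k) pelem set" where
  "P_space s V = module.span fscale (range (mon s V))"

definition P_deg ::
  "('k::field_char_0 \<Rightarrow> 'v::ab_group_add \<Rightarrow> 'v) \<Rightarrow> (int \<Rightarrow> 'v set) \<Rightarrow> int \<Rightarrow> ('v, 'k) pelem set" where
  "P_deg s V n = module.span fscale {mon s V zs | zs. ldeg V zs = n}"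

text \<open>The linear map on \<open>P\<close> whose transpose is the operation \<open>T\<close> on forms.\<close>

definition ptrans ::
  "('k::field_char_0 \<Rightarrow> 'v::ab_group_add \<Rightarrow> 'v) \<Rightarrow> (int \<Rightarrow> 'v set) \<Rightarrow>
   (('v list \<Rightarrow> 'k) \<Rightarrow> 'v list \<Rightarrow> 'k) \<Rightarrow> ('v, 'k) pelem \<Rightarrow> ('v, 'k) pelem" where
  "ptrans s V T p = (\<lambda>f. if f \<in> pforms s V then p (T f) else 0)"

definition P_parity ::
  "('k::field_char_0 \<Rightarrow> 'v::ab_group_add \<Rightarrow> 'v) \<Rightarrow> (int \<Rightarrow> 'v set) \<Rightarrow> ('v, 'k) pelem \<Rightarrow> ('v, 'k) pelem" where
  "P_parity s V = ptrans s V (\<lambda>f zs. sg (ldeg V zs) (f zs))"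

definition P_proj0 ::
  "('k::field_char_0 \<Rightarrow> 'v::ab_group_add \<Rightarrow> 'v) \<Rightarrow> (int \<Rightarrow> 'v set) \<Rightarrow> ('v, 'k) pelem \<Rightarrow> ('v, 'k) pelem" where
  "P_proj0 s V = ptrans s V (\<lambda>f zs. if length zs = 1 then f zs else 0)"

text \<open>In the same way \<open>P \<otimes> P\<close> is realized in the dual of the space of bilinear forms on \<open>P\<close>.\<close>

definition P_bilforms ::
  "('k::field_char_0 \<Rightarrow> 'v::ab_group_add \<Rightarrow> 'v) \<Rightarrow> (int \<Rightarrow> 'v set) \<Rightarrow>
   (('v, 'k) pelem \<Rightarrow> ('v, 'k) pelem \<Rightarrow> 'k) set" where
  "P_bilforms s V = {g. \<forall>p\<in>P_space s V. \<forall>p'\<in>P_space s V. \<forall>r\<in>P_space s V. \<forall>c.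
     g (p + p') r = g p r + g p' r \<and> g (fscale c p) r = c * g p r \<and>
     g r (p + p') = g r p + g r p' \<and> g r (fscale c p) = c * g r p}"

type_synonym ('v, 'k) ppelem = "(('v, 'k) pelem \<Rightarrow> ('v, 'k) pelem \<Rightarrow> 'k) \<Rightarrow> 'k"

definition P_tensor ::
  "('k::field_char_0 \<Rightarrow> 'v::ab_group_add \<Rightarrow> 'v) \<Rightarrow> (int \<Rightarrow> 'v set) \<Rightarrow>
   ('v, 'k) pelem \<Rightarrow> ('v, 'k) pelem \<Rightarrow> ('v, 'k) ppelem" where
  "P_tensor s V p r = (\<lambda>g. if g \<in> P_bilforms s V then g p r else 0)"

text \<open>\<open>PP_map s V F G\<close> maps \<open>p \<otimes> r\<close> to \<open>F p \<otimes> G r\<close>, without a sign.\<close>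

definition PP_map ::
  "('k::field_char_0 \<Rightarrow> 'v::ab_group_add \<Rightarrow> 'v) \<Rightarrow> (int \<Rightarrow> 'v set) \<Rightarrow>
   (('v, 'k) pelem \<Rightarrow> ('v, 'k) pelem) \<Rightarrow> (('v, 'k) pelem \<Rightarrow> ('v, 'k) pelem) \<Rightarrow>
   ('v, 'k) ppelem \<Rightarrow> ('v, 'k) ppelem" where
  "PP_map s V F G t = (\<lambda>g. if g \<in> P_bilforms s V then t (\<lambda>p r. g (F p) (G r)) else 0)"

text \<open>The coproduct, defined through its transpose; see \<open>Delta_mon\<close> below for its values on
  \<open>x\<^sub>1\<cdot>\<dots>\<cdot>x\<^sub>k \<otimes> y\<close>.\<close>

definition Delta ::
  "('k::field_char_0 \<Rightarrow> 'v::ab_group_add \<Rightarrow> 'v) \<Rightarrow> (int \<Rightarrow> 'v set) \<Rightarrow>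
   ('v, 'k) pelem \<Rightarrow> ('v, 'k) ppelem" where
  "Delta s V p = (\<lambda>g. if g \<in> P_bilforms s V
     then p (\<lambda>zs. if zs = [] then 0
       else unshuffle1 V (\<lambda>I x J. g (mon s V (I @ [x])) (mon s V (J @ [last zs]))) (butlast zs))
     else 0)"

text \<open>
  Coderivations of degree \<open>n\<close>. In \<open>\<Delta>D = (D \<otimes> 1 + 1 \<otimes> D)\<Delta>\<close> the second summand maps \<open>p \<otimes> r\<close> to
  \<open>(-1)\<^bsup>n deg p\<^esup> p \<otimes> D r\<close>. Operators on \<open>P\<close> are set to 0 outside of \<open>P\<close>, so that equality of
  functions is equality of operators.
\<close>

definition coders ::
  "('k::field_char_0 \<Rightarrow> 'v::ab_group_add \<Rightarrow> 'v) \<Rightarrow> (int \<Rightarrow> 'v set) \<Rightarrow> int \<Rightarrow>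
   (('v, 'k) pelem \<Rightarrow> ('v, 'k) pelem) set" where
  "coders s V n = {D.
     (\<forall>p. p \<notin> P_space s V \<longrightarrow> D p = 0) \<and>
     (\<forall>p\<in>P_space s V. \<forall>p'\<in>P_space s V. \<forall>c.
        D p \<in> P_space s V \<and> D (p + p') = D p + D p' \<and> D (fscale c p) = fscale c (D p)) \<and>
     (\<forall>m. \<forall>p\<in>P_deg s V m. D p \<in> P_deg s V (m + n)) \<and>
     (\<forall>p\<in>P_space s V.
        Delta s V (D p) = PP_map s V D id (Delta s V p)
          + PP_map s V (if even n then id else P_parity s V) D (Delta s V p))}"

text \<open>The commutator of operators \<open>D\<close>, \<open>D'\<close> of degrees \<open>m\<close>, \<open>n\<close>.\<close>

definition commutator ::
  "int \<Rightarrow> ('p \<Rightarrow> 'p::ab_group_add) \<Rightarrow> int \<Rightarrow> ('p \<Rightarrow> 'p) \<Rightarrow> 'p \<Rightarrow> 'p" where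
  "commutator m D n D' = (\<lambda>p. D (D' p) - sg (m * n) (D' (D p)))"

definition pre_Linf ::
  "('k::field_char_0 \<Rightarrow> 'v::ab_group_add \<Rightarrow> 'v) \<Rightarrow> (int \<Rightarrow> 'v set) \<Rightarrow>
   (('v, 'k) pelem \<Rightarrow> ('v, 'k) pelem) \<Rightarrow> bool" where
  "pre_Linf s V Q \<longleftrightarrow> Q \<in> coders s V 1 \<and> commutator 1 Q 1 Q = 0"

text \<open>\<open>component s V D\<close> collects the maps \<open>D\<^sub>k : P\<^sup>k \<longrightarrow> P\<^sup>0 = V[1]\<close>.\<close>

definition component ::
  "('k::field_char_0 \<Rightarrow> 'v::ab_group_add \<Rightarrow> 'v) \<Rightarrow> (int \<Rightarrow> 'v set) \<Rightarrow>
   (('v, 'k) pelem \<Rightarrow> ('v, 'k) pelem) \<Rightarrow> 'v list \<Rightarrow> 'v" where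
  "component s V D zs = (THE v. homog V v \<and> P_proj0 s V (D (mon s V zs)) = mon s V [v])"

text \<open>\<open>B\<close>-quadratic coderivations of degree \<open>n\<close>, if \<open>fin\<close> only those with finitely many nonzero
  components.\<close>

definition bcoders ::
  "bool \<Rightarrow> ('k::field_char_0 \<Rightarrow> 'v::ab_group_add \<Rightarrow> 'v) \<Rightarrow> (int \<Rightarrow> 'v set) \<Rightarrow> ('v \<Rightarrow> 'v \<Rightarrow> 'k) \<Rightarrow>
   int \<Rightarrow> (('v, 'k) pelem \<Rightarrow> ('v, 'k) pelem) set" where
  "bcoders fin s V b n = {D \<in> coders s V n.
     (\<forall>xs y1 y2. (\<forall>z\<in>set (xs @ [y1, y2]). homog V z) \<longrightarrow>
        Bform V b (component s V D (xs @ [y1])) y2 =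
        sg (deg V y1 * deg V y2) (Bform V b (component s V D (xs @ [y2])) y1)) \<and>
     (fin \<longrightarrow> finitary (component s V D))}"

definition Omega ::
  "('k::field_char_0 \<Rightarrow> 'v::ab_group_add \<Rightarrow> 'v) \<Rightarrow> (int \<Rightarrow> 'v set) \<Rightarrow> ('v \<Rightarrow> 'v \<Rightarrow> 'k) \<Rightarrow>
   (('v, 'k) pelem \<Rightarrow> ('v, 'k) pelem) \<Rightarrow> 'v list \<Rightarrow> 'k" where
  "Omega s V b D zs =
     (if length zs < 2 \<or> (\<exists>z\<in>set zs. \<not> homog V z) then 0
      else let k = length zs - 2; xs = take k zs; y1 = zs ! k; y2 = zs ! (k + 1) in
        Bform V b (component s V D (xs @ [y1])) y2
        + sg (deg V y1 * deg V y2) (Bform V b (component s V D (xs @ [y2])) y1))"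

text \<open>Linear maps \<open>P \<longrightarrow> P\<^sup>0 = V[1]\<close> of degree \<open>d\<close>, as multilinear maps.\<close>

definition sym_map ::
  "('k::field_char_0 \<Rightarrow> 'v::ab_group_add \<Rightarrow> 'v) \<Rightarrow> (int \<Rightarrow> 'v set) \<Rightarrow> int \<Rightarrow> ('v list \<Rightarrow> 'v) \<Rightarrow> bool" where
  "sym_map s V d Q \<longleftrightarrow>
     (\<forall>zs. (\<exists>z\<in>set zs. \<not> homog V z) \<longrightarrow> Q zs = 0) \<and>
     (\<forall>zs. (\<forall>z\<in>set zs. homog V z) \<longrightarrow> Q zs \<in> V (ldeg V zs + d + 1)) \<and>
     (\<forall>us ws n. \<forall>x\<in>V n. \<forall>y\<in>V n. Q (us @ (x + y) # ws) = Q (us @ x # ws) + Q (us @ y # ws)) \<and>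
     (\<forall>us ws n. \<forall>x\<in>V n. \<forall>c. Q (us @ s c x # ws) = s c (Q (us @ x # ws))) \<and>
     (\<forall>us x y ws. ws \<noteq> [] \<longrightarrow>
        Q (us @ x # y # ws) = sg (deg V x * deg V y) (Q (us @ y # x # ws)))"

text \<open>The extension to \<open>P\<close> of a map \<open>Q : P \<longrightarrow> P\<^sup>0\<close> of degree \<open>d\<close>, again through its transpose; see
  \<open>coder_ext_mon\<close> below for its values on \<open>x\<^sub>1\<cdot>\<dots>\<cdot>x\<^sub>k \<otimes> y\<close>.\<close>

definition coder_ext ::
  "('k::field_char_0 \<Rightarrow> 'v::ab_group_add \<Rightarrow> 'v) \<Rightarrow> (int \<Rightarrow> 'v set) \<Rightarrow> int \<Rightarrow> ('v list \<Rightarrow> 'v) \<Rightarrow>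
   ('v, 'k) pelem \<Rightarrow> ('v, 'k) pelem" where
  "coder_ext s V d Q p =
     (if p \<in> P_space s V
      then ptrans s V (\<lambda>f zs. if zs = [] then 0 else
        unshuffle V (\<lambda>I J. sg (d * ldeg V I) (f (I @ [Q (J @ [last zs])]))) (butlast zs)
        + unshuffle1 V (\<lambda>I x J. sg (deg V x * ldeg V J + d * ldeg V I)
            (f (I @ [Q (J @ [x]), last zs]))) (butlast zs)) p
      else 0)"

definition prelie_map ::
  "(int \<Rightarrow> 'v::ab_group_add set) \<Rightarrow> ('v \<Rightarrow> 'v \<Rightarrow> 'v) \<Rightarrow> 'v list \<Rightarrow> 'v" where
  "prelie_map V q zs =
     (if length zs = 2 \<and> (\<forall>z\<in>set zs. homog V z) then sg (deg V (zs ! 0)) (q (zs ! 0) (zs ! 1))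
      else 0)"

section \<open>Cohomology\<close>

text \<open>Cochains of degree \<open>n\<close> form the space \<open>X n\<close>, on which the differential is \<open>\<delta> n\<close>.\<close>

definition coboundary ::
  "('k::field_char_0 \<Rightarrow> 'a::ab_group_add \<Rightarrow> 'a) \<Rightarrow> (int \<Rightarrow> 'a set) \<Rightarrow> (int \<Rightarrow> 'a \<Rightarrow> 'a) \<Rightarrow> bool" where
  "coboundary s X \<delta> \<longleftrightarrow> (\<forall>n. \<forall>x\<in>X n. \<forall>y\<in>X n. \<forall>c.
     \<delta> n (x + y) = \<delta> n x + \<delta> n y \<and> \<delta> n (s c x) = s c (\<delta> n x) \<and>
     \<delta> n x \<in> X (n + 1) \<and> \<delta> (n + 1) (\<delta> n x) = 0)"

definition cohomology ::
  "(int \<Rightarrow> 'a::ab_group_add set) \<Rightarrow> (int \<Rightarrow> 'a \<Rightarrow> 'a) \<Rightarrow> int \<Rightarrow> 'a set set" where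
  "cohomology X \<delta> n = {{z + \<delta> (n - 1) w | w. w \<in> X (n - 1)} | z. z \<in> X n \<and> \<delta> n z = 0}"

section \<open>Values on generators\<close>

lemma sg_0 [simp]: "sg 0 a = a" and sg_zero [simp]: "sg n 0 = 0"
  and sg_sg: "sg m (sg n a) = sg (m + n) a"
  and sg_plus: "sg n (a + b) = sg n a + sg n b"
  and sg_sum: "sg n (sum f S) = (\<Sum>i\<in>S. sg n (f i))"
  and sg_sum_list: "sg n (sum_list (map h xs)) = (\<Sum>x\<leftarrow>xs. sg n (h x))"
proof -
  show "sg n (sum_list (map h xs)) = (\<Sum>x\<leftarrow>xs. sg n (h x))" by (induct xs) (auto simp: sg_def)
qed (auto simp: sg_def sum_negf)

lemma sg_mult:
  fixes a :: "'k::field_char_0"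
  shows "sg m a * c = sg m (a * c)" "c * sg m a = sg m (c * a)"
  by (auto simp: sg_def)

lemma sg_cong: "even m = even n \<Longrightarrow> a = c \<Longrightarrow> sg m a = sg n c"
  by (auto simp: sg_def)

lemma ldeg_simps [simp]:
  "ldeg V [] = 0" "ldeg V (x # xs) = deg V x + ldeg V xs" "ldeg V (xs @ ys) = ldeg V xs + ldeg V ys"
  by (auto simp: ldeg_def)

lemma ldeg_mset: "mset xs = mset ys \<Longrightarrow> ldeg V xs = ldeg V ys"
  unfolding ldeg_def by (metis mset_map sum_mset_sum_list)

lemma unshuffle_cong:
  "(\<And>I J. mset I + mset J = mset xs \<Longrightarrow> F I J = G I J) \<Longrightarrow> unshuffle V F xs = unshuffle V G xs"
proof (induct xs arbitrary: F G)
  case (Cons x xs)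
  have "unshuffle V (\<lambda>I J. F (x # I) J) xs = unshuffle V (\<lambda>I J. G (x # I) J) xs"
    by (rule Cons.hyps) (simp add: Cons.prems)
  moreover have "unshuffle V (\<lambda>I J. sg (deg V x * ldeg V I) (F I (x # J))) xs
      = unshuffle V (\<lambda>I J. sg (deg V x * ldeg V I) (G I (x # J))) xs"
    by (rule Cons.hyps) (simp add: Cons.prems)
  ultimately show ?case by simp
qed auto

lemma unshuffle_add:
  "unshuffle V (\<lambda>I J. F I J + G I J) xs = unshuffle V F xs + unshuffle V G xs"
proof (induct xs arbitrary: F G)
  case (Cons x xs)
  show ?case by (simp add: Cons.hyps sg_plus)
qed auto

lemma unshuffle_hom:
  assumes "\<And>a c. h (a + c) = h a + h c" "\<And>n a. h (sg n a) = sg n (h a)"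
  shows "h (unshuffle V F xs) = unshuffle V (\<lambda>I J. h (F I J)) xs"
proof (induct xs arbitrary: F)
  case (Cons x xs)
  show ?case by (simp add: Cons.hyps assms)
qed auto

lemma unshuffle_sg: "sg n (unshuffle V F xs) = unshuffle V (\<lambda>I J. sg n (F I J)) xs"
  by (rule unshuffle_hom) (auto simp: sg_plus sg_sg add.commute)

lemma unshuffle_mult:
  fixes c :: "'k::field_char_0"
  shows "c * unshuffle V F xs = unshuffle V (\<lambda>I J. c * F I J) xs"
    "unshuffle V F xs * c = unshuffle V (\<lambda>I J. F I J * c) xs"
  by (rule unshuffle_hom; simp add: algebra_simps sg_mult)+

lemma unshuffle_comm:
  "unshuffle V (\<lambda>I J. F J I) xs = unshuffle V (\<lambda>I J. sg (ldeg V I * ldeg V J) (F I J)) xs"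
proof (induct xs arbitrary: F)
  case (Cons x xs)
  have "unshuffle V (\<lambda>I J. F J (x # I)) xs
      = unshuffle V (\<lambda>I J. sg (ldeg V I * ldeg V J) (F I (x # J))) xs"
    using Cons.hyps[of "\<lambda>I J. F I (x # J)"] .
  moreover have "unshuffle V (\<lambda>I J. sg (deg V x * ldeg V I) (F (x # J) I)) xs
      = unshuffle V (\<lambda>I J. sg (ldeg V I * ldeg V J) (sg (deg V x * ldeg V J) (F (x # I) J))) xs"
    using Cons.hyps[of "\<lambda>J I. sg (deg V x * ldeg V I) (F (x # J) I)"] by simp
  moreover have "unshuffle V (\<lambda>I J. sg (ldeg V I * ldeg V J) (F I (x # J))) xs
      = unshuffle V (\<lambda>I J. sg (deg V x * ldeg V I) (sg (ldeg V I * ldeg V (x # J)) (F I (x # J)))) xs"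
    by (rule unshuffle_cong) (simp add: sg_sg, rule sg_cong, auto)
  moreover have "unshuffle V (\<lambda>I J. sg (ldeg V I * ldeg V J) (sg (deg V x * ldeg V J) (F (x # I) J))) xs
     = unshuffle V (\<lambda>I J. sg (ldeg V (x # I) * ldeg V J) (F (x # I) J)) xs"
    by (rule unshuffle_cong) (simp add: sg_sg, rule sg_cong, auto)
  ultimately show ?case by (simp add: add.commute)
qed auto

lemma unshuffle_assoc:
  fixes V :: "int \<Rightarrow> 'v set" and F :: "'v list \<Rightarrow> 'v list \<Rightarrow> 'v list \<Rightarrow> 'a::ab_group_add"
  shows "unshuffle V (\<lambda>I K. unshuffle V (\<lambda>M J. F I M J) K) xs
   = unshuffle V (\<lambda>K J. unshuffle V (\<lambda>I M. F I M J) K) xs"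
proof (induct xs arbitrary: F)
  case (Cons x xs)
  let ?d = "deg V x"
  have 1: "unshuffle V (\<lambda>I K. unshuffle V (\<lambda>M J. F (x # I) M J) K) xs
      = unshuffle V (\<lambda>K J. unshuffle V (\<lambda>I M. F (x # I) M J) K) xs"
    by (rule Cons.hyps)
  have 2: "unshuffle V (\<lambda>I K. sg (?d * ldeg V I) (unshuffle V (\<lambda>M J. F I (x # M) J) K)) xs
      = unshuffle V (\<lambda>K J. unshuffle V (\<lambda>I M. sg (?d * ldeg V I) (F I (x # M) J)) K) xs"
    unfolding unshuffle_sg by (rule Cons.hyps)
  have 3: "unshuffle V (\<lambda>I K. sg (?d * ldeg V I)
        (unshuffle V (\<lambda>M J. sg (?d * ldeg V M) (F I M (x # J))) K)) xs
      = unshuffle V (\<lambda>K J. sg (?d * ldeg V K) (unshuffle V (\<lambda>I M. F I M (x # J)) K)) xs"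
  proof -
    have "unshuffle V (\<lambda>I K. sg (?d * ldeg V I)
        (unshuffle V (\<lambda>M J. sg (?d * ldeg V M) (F I M (x # J))) K)) xs
      = unshuffle V (\<lambda>K J. unshuffle V (\<lambda>I M. sg (?d * ldeg V I) (sg (?d * ldeg V M) (F I M (x # J)))) K) xs"
      unfolding unshuffle_sg by (rule Cons.hyps)
    also have "\<dots> = unshuffle V (\<lambda>K J. sg (?d * ldeg V K) (unshuffle V (\<lambda>I M. F I M (x # J)) K)) xs"
      unfolding unshuffle_sg
    proof (intro unshuffle_cong)
      fix K J I M :: "'v list" assume "mset I + mset M = mset K"
      then have "ldeg V K = ldeg V I + ldeg V M"
        using ldeg_mset[of K "I @ M" V] by simp
      then show "sg (?d * ldeg V I) (sg (?d * ldeg V M) (F I M (x # J))) = sg (?d * ldeg V K) (F I M (x # J))"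
        by (simp add: sg_sg algebra_simps)
    qed
    finally show ?thesis .
  qed
  show ?case
    by (simp add: unshuffle_add sg_plus 1 2 3)
qed auto

lemma unshuffle_zero [simp]: "unshuffle V (\<lambda>I J. 0) xs = 0"
  by (induct xs) auto

lemma unshuffle_Nil_left: "unshuffle V (\<lambda>M J. if M = [] then G J else 0) xs = G xs"
proof (induct xs arbitrary: G)
  case (Cons x xs)
  have "unshuffle V (\<lambda>I J. sg (deg V x * ldeg V I) (if I = [] then G (x # J) else 0)) xs
     = unshuffle V (\<lambda>I J. if I = [] then G (x # J) else 0) xs"
    by (rule unshuffle_cong) auto
  then show ?case using Cons[of "\<lambda>J. G (x # J)"] by simp
qed auto

lemma unshuffle_single:
  "unshuffle V (\<lambda>M J. if length M = 1 then C (hd M) J else 0) K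
   = (\<Sum>r<length K. sg (ldeg V (take r K) * deg V (K ! r)) (C (K ! r) (take r K @ drop (Suc r) K)))"
proof (induct K arbitrary: C)
  case (Cons x K)
  have "unshuffle V (\<lambda>I J. if length (x # I) = 1 then C (hd (x # I)) J else 0) K = C x K"
    by (subst unshuffle_Nil_left[of V "C x" K, symmetric], rule unshuffle_cong) auto
  moreover have "unshuffle V (\<lambda>I J. sg (deg V x * ldeg V I) (if length I = 1 then C (hd I) (x # J) else 0)) K
     = unshuffle V (\<lambda>I J. if length I = 1 then sg (deg V x * deg V (hd I)) (C (hd I) (x # J)) else 0) K"
    by (rule unshuffle_cong) (auto simp: length_Suc_conv)
  moreover have "\<dots> = (\<Sum>r<length K. sg (ldeg V (take r K) * deg V (K ! r))
      (sg (deg V x * deg V (K ! r)) (C (K ! r) (x # take r K @ drop (Suc r) K))))"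
    by (rule Cons)
  moreover have "\<dots> = (\<Sum>r<length K. sg (ldeg V (take (Suc r) (x # K)) * deg V ((x # K) ! Suc r))
      (C ((x # K) ! Suc r) (take (Suc r) (x # K) @ drop (Suc (Suc r)) (x # K))))"
    by (simp add: sg_sg algebra_simps)
  ultimately show ?case
    by (simp add: sum.lessThan_Suc_shift del: sum.lessThan_Suc)
qed auto


lemma sym_forms_move:
  assumes f: "f \<in> sym_forms s V"
  shows "f (us @ B @ x # ws) = sg (deg V x * ldeg V B) (f (us @ x # B @ ws))"
proof (induct B arbitrary: us)
  case (Cons y B)
  have "f (us @ (y # B) @ x # ws) = sg (deg V x * ldeg V B) (f (us @ y # x # B @ ws))"
    using Cons[of "us @ [y]"] by simp
  also have "f (us @ y # x # B @ ws) = sg (deg V y * deg V x) (f (us @ x # y # B @ ws))"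
    using f unfolding sym_forms_def by blast
  finally show ?case by (simp add: sg_sg algebra_simps)
qed auto

lemma sym_forms_swap:
  assumes f: "f \<in> sym_forms s V"
  shows "f (us @ B @ A @ ws) = sg (ldeg V A * ldeg V B) (f (us @ A @ B @ ws))"
proof (induct A arbitrary: us)
  case (Cons x A)
  have "f (us @ B @ (x # A) @ ws) = sg (deg V x * ldeg V B) (f ((us @ [x]) @ B @ A @ ws))"
    using sym_forms_move[OF f, of us B x "A @ ws"] by simp
  also have "f ((us @ [x]) @ B @ A @ ws) = sg (ldeg V A * ldeg V B) (f ((us @ [x]) @ A @ B @ ws))"
    by (rule Cons)
  finally show ?case by (simp add: sg_sg algebra_simps)
qed auto

lemma contract_arity_left:
  assumes "\<alpha> \<in> sym2_forms s V" "length A + length C \<noteq> 1"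
  shows "contract V E \<alpha> \<Omega> A C A' C' = 0"
proof -
  have "\<alpha> (A @ e # C) = 0" for e
    using assms by (simp add: sym2_forms_def)
  then show ?thesis by (simp add: contract_def case_prod_unfold)
qed

lemma contract_arity_right:
  assumes "\<alpha> \<in> sym2_forms s V" "length A' + length C' \<noteq> 1"
  shows "contract V E \<Omega> \<alpha> A C A' C' = 0"
proof -
  have "\<alpha> (A' @ e # C') = 0" for e
    using assms by (simp add: sym2_forms_def)
  then show ?thesis by (simp add: contract_def case_prod_unfold)
qed

lemma contract_cong:
  assumes "\<And>e e'. (e, e') \<in> set E \<Longrightarrow>
     sg ((ldeg V A' + deg V e + ldeg V C') * (ldeg V A + deg V e + ldeg V C)
            + deg V e * (ldeg V C + ldeg V A')) (\<Omega> (A @ e # C) * \<Omega>' (A' @ e' # C'))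
     = sg n (sg ((ldeg V B' + deg V e + ldeg V D') * (ldeg V B + deg V e + ldeg V D)
            + deg V e * (ldeg V D + ldeg V B')) (\<Phi> (B @ e # D) * \<Phi>' (B' @ e' # D')))"
  shows "contract V E \<Omega> \<Omega>' A C A' C' = sg n (contract V E \<Phi> \<Phi>' B D B' D')"
  unfolding contract_def sg_sum_list
  by (rule arg_cong[where f = sum_list], rule map_cong[OF refl]) (use assms in auto)

lemma contract_swap_right:
  assumes "\<beta> \<in> sym_forms s V"
  shows "contract V E \<Omega> \<beta> A C [] (X @ Y) = sg (ldeg V X * ldeg V Y) (contract V E \<Omega> \<beta> A C [] (Y @ X))"
proof -
  have "\<beta> (e' # X @ Y) = sg (ldeg V X * ldeg V Y) (\<beta> (e' # Y @ X))" for e'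
    using sym_forms_swap[OF assms, of "[e']" X Y "[]"] by (simp add: mult.commute)
  then show ?thesis
    by (intro contract_cong) (simp add: sg_mult sg_sg algebra_simps)
qed

lemma contract_swap_left:
  assumes "\<beta> \<in> sym_forms s V"
  shows "contract V E \<beta> \<Omega> [] (X @ Y) A' C' = sg (ldeg V X * ldeg V Y) (contract V E \<beta> \<Omega> [] (Y @ X) A' C')"
proof -
  have "\<beta> (e' # X @ Y) = sg (ldeg V X * ldeg V Y) (\<beta> (e' # Y @ X))" for e'
    using sym_forms_swap[OF assms, of "[e']" X Y "[]"] by (simp add: mult.commute)
  then show ?thesis
    by (intro contract_cong) (simp add: sg_mult sg_sg algebra_simps)
qed

lemma cyc_bracket_left:
  assumes \<alpha>: "\<alpha> \<in> sym2_forms s V" and \<beta>: "\<beta> \<in> sym_forms s V"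
  shows "cyc_bracket V E \<alpha> \<beta> K =
    unshuffle V (\<lambda>M J. if length M = 1 then contract V E \<alpha> \<beta> [] [hd M] [] J else 0) K"
proof (cases "K = []")
  case True
  then show ?thesis using contract_arity_left[OF \<alpha>, of "[]" "[]"] by (simp add: cyc_bracket_def)
next
  case False
  have "sg (ldeg V (take r K) * ldeg V (drop r K))
      (let w = drop r K @ take r K
       in \<Sum>m\<le>length K. contract V E \<alpha> \<beta> [] (take m w) [] (drop m w))
    = sg (ldeg V (take r K) * deg V (K ! r))
       (contract V E \<alpha> \<beta> [] [K ! r] [] (take r K @ drop (Suc r) K))" if r: "r \<in> {..<length K}" for r
  proof -
    define w where "w = drop r K @ take r K"
    have r: "r < length K" using r by simp
    have w: "w = K ! r # drop (Suc r) K @ take r K"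
      using r by (simp add: w_def Cons_nth_drop_Suc[symmetric])
    have "length w = length K" by (simp add: w_def)
    then have "(\<Sum>m\<le>length K. contract V E \<alpha> \<beta> [] (take m w) [] (drop m w))
        = (\<Sum>m\<in>{1}. contract V E \<alpha> \<beta> [] (take m w) [] (drop m w))"
      using r by (intro sum.mono_neutral_right) (auto intro!: contract_arity_left[OF \<alpha>])
    also have "\<dots> = contract V E \<alpha> \<beta> [] [K ! r] [] (drop (Suc r) K @ take r K)"
      by (simp add: w)
    also have "\<dots> = sg (ldeg V (drop (Suc r) K) * ldeg V (take r K))
        (contract V E \<alpha> \<beta> [] [K ! r] [] (take r K @ drop (Suc r) K))"
      by (rule contract_swap_right[OF \<beta>])
    finally show ?thesis
      unfolding w_def[symmetric] Let_def
      using r by (simp add: sg_sg Cons_nth_drop_Suc[symmetric] algebra_simps)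
        (rule sg_cong, auto)
  qed
  note * = this
  have mx: "max 1 (length K) = length K" using False by (cases K) auto
  have "cyc_bracket V E \<alpha> \<beta> K = (\<Sum>r<length K. sg (ldeg V (take r K) * deg V (K ! r))
       (contract V E \<alpha> \<beta> [] [K ! r] [] (take r K @ drop (Suc r) K)))"
    unfolding cyc_bracket_def mx by (rule sum.cong[OF refl], rule *)
  then show ?thesis
    by (rule trans[OF _ unshuffle_single[of V "\<lambda>x J. contract V E \<alpha> \<beta> [] [x] [] J" K, symmetric]])
qed

lemma sum_rotate1:
  fixes f :: "nat \<Rightarrow> 'a::comm_monoid_add"
  assumes "n > 0"
  shows "(\<Sum>r<n. f (if r = 0 then n - 1 else r - 1)) = (\<Sum>r<n. f r)"
  by (rule sum.reindex_bij_witness[where i = "\<lambda>r. if r = n - 1 then 0 else Suc r"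
        and j = "\<lambda>r. if r = 0 then n - 1 else r - 1"]) (use assms in auto)

lemma cyc_bracket_right:
  assumes \<alpha>: "\<alpha> \<in> sym2_forms s V" and \<beta>: "\<beta> \<in> sym_forms s V"
  shows "cyc_bracket V E \<beta> \<alpha> K =
    unshuffle V (\<lambda>I M. if length M = 1 then contract V E \<beta> \<alpha> [] I [] [hd M] else 0) K"
proof (cases "K = []")
  case True
  then show ?thesis using contract_arity_right[OF \<alpha>, of "[]" "[]"] by (simp add: cyc_bracket_def)
next
  case False
  define n where "n = length K"
  have n: "n > 0" "max 1 n = n" using False by (auto simp: n_def Suc_le_eq)
  define t where "t r = sg (deg V (K ! r) * ldeg V (drop (Suc r) K))
       (contract V E \<beta> \<alpha> [] (take r K @ drop (Suc r) K) [] [K ! r])" for r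
  have *: "sg (ldeg V (take r K) * ldeg V (drop r K))
      (let w = drop r K @ take r K
       in \<Sum>m\<le>length K. contract V E \<beta> \<alpha> [] (take m w) [] (drop m w))
    = t (if r = 0 then n - 1 else r - 1)" if r: "r \<in> {..<n}" for r
  proof -
    have r: "r < n" using r by simp
    define w where "w = drop r K @ take r K"
    have lw: "length w = n" by (simp add: w_def n_def)
    then have "(\<Sum>m\<le>length K. contract V E \<beta> \<alpha> [] (take m w) [] (drop m w))
        = (\<Sum>m\<in>{n-1}. contract V E \<beta> \<alpha> [] (take m w) [] (drop m w))"
      using n by (intro sum.mono_neutral_right) (auto intro!: contract_arity_right[OF \<alpha>] simp: n_def)
    also have "\<dots> = contract V E \<beta> \<alpha> [] (butlast w) [] [last w]"
    proof -
      have "w = butlast w @ [last w]" using lw n by (metis append_butlast_last_id length_greater_0_conv)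
      moreover have "length (butlast w) = n - 1" using lw by simp
      ultimately have "take (n - 1) w = butlast w" "drop (n - 1) w = [last w]"
        by (metis append_eq_conv_conj)+
      then show ?thesis by simp
    qed
    finally have 1: "(\<Sum>m\<le>length K. contract V E \<beta> \<alpha> [] (take m w) [] (drop m w))
        = contract V E \<beta> \<alpha> [] (butlast w) [] [last w]" .
    show ?thesis
    proof (cases r)
      case 0
      have "K = take (n - 1) K @ [K ! (n - 1)]"
        using n take_Suc_conv_app_nth[of "n - 1" K] by (simp add: n_def)
      moreover have "w = K" using 0 by (simp add: w_def)
      ultimately have "butlast w = take (n-1) K" "last w = K ! (n-1)"
        by (metis butlast_snoc, metis last_snoc)
      then show ?thesis using 1 0 n by (simp add: w_def t_def Let_def n_def)
    next
      case (Suc j)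
      then have j: "j < length K" using r by (simp add: n_def)
      have tk: "take r K = take j K @ [K ! j]" using Suc j by (simp add: take_Suc_conv_app_nth)
      have "butlast w = drop (Suc j) K @ take j K" "last w = K ! j"
        using tk Suc by (simp_all add: w_def butlast_append)
      then have "(\<Sum>m\<le>length K. contract V E \<beta> \<alpha> [] (take m w) [] (drop m w))
        = sg (ldeg V (drop (Suc j) K) * ldeg V (take j K))
            (contract V E \<beta> \<alpha> [] (take j K @ drop (Suc j) K) [] [K ! j])"
        using 1 contract_swap_left[OF \<beta>, of E \<alpha> "drop (Suc j) K" "take j K" "[]" "[K ! j]"] by simp
      then show ?thesis
        unfolding w_def[symmetric] Let_def using Suc tk
        by (simp add: sg_sg t_def) (rule sg_cong, auto)
    qed
  qed
  have "cyc_bracket V E \<beta> \<alpha> K = (\<Sum>r<n. t (if r = 0 then n - 1 else r - 1))"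
    unfolding cyc_bracket_def n_def[symmetric] n(2)
    by (rule sum.cong[OF refl], rule *[folded n_def])
  also have "\<dots> = (\<Sum>r<n. t r)" by (rule sum_rotate1[OF n(1)])
  also have "\<dots> = (\<Sum>r<n. sg (ldeg V (take r K) * deg V (K ! r))
      (sg (deg V (K ! r) * ldeg V (take r K @ drop (Suc r) K))
       (contract V E \<beta> \<alpha> [] (take r K @ drop (Suc r) K) [] [K ! r])))"
    unfolding t_def by (intro sum.cong refl) (simp add: sg_sg, rule sg_cong, auto)
  also have "\<dots> = unshuffle V (\<lambda>M I. if length M = 1
      then sg (deg V (hd M) * ldeg V I) (contract V E \<beta> \<alpha> [] I [] [hd M]) else 0) K"
    unfolding unshuffle_single[of V "\<lambda>x I. sg (deg V x * ldeg V I) (contract V E \<beta> \<alpha> [] I [] [x])"]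
    by (simp add: n_def)
  also have "\<dots> = unshuffle V (\<lambda>M I. sg (ldeg V M * ldeg V I)
      (if length M = 1 then contract V E \<beta> \<alpha> [] I [] [hd M] else 0)) K"
    by (rule unshuffle_cong) (auto simp: length_Suc_conv)
  also have "\<dots> = unshuffle V (\<lambda>I M. if length M = 1 then contract V E \<beta> \<alpha> [] I [] [hd M] else 0) K"
    by (rule unshuffle_comm[symmetric])
  finally show ?thesis .
qed

lemma graded_space_unique:
  assumes g: "graded_space s V" and x: "x \<in> V m" "x \<in> V n" "x \<noteq> 0"
  shows "m = n"
proof (rule ccontr)
  assume ne: "m \<noteq> n"
  interpret vector_space s using g by (simp add: graded_space_def)
  have z: "0 \<in> V k" for k using g subspace_0 by (auto simp: graded_space_def)
  define h where "h k = (\<lambda>i. if i = k then x else 0)" for k :: int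
  have s: "{i. h k i \<noteq> 0} = {k}" for k using x by (auto simp: h_def)
  have "(\<forall>i. h k i \<in> V i) \<and> finite {i. h k i \<noteq> 0} \<and> x = (\<Sum>i | h k i \<noteq> 0. h k i)"
    if "k = m \<or> k = n" for k
    unfolding s using x z that by (auto simp: h_def)
  moreover have "\<exists>!f. (\<forall>i. f i \<in> V i) \<and> finite {i. f i \<noteq> 0} \<and> x = (\<Sum>i | f i \<noteq> 0. f i)"
    using g unfolding graded_space_def by blast
  ultimately have "h m = h n" by blast
  then have "h m m = h n m" by simp
  then show False using ne x by (simp add: h_def)
qed

lemma deg_eq: "graded_space s V \<Longrightarrow> x \<in> V n \<Longrightarrow> x \<noteq> 0 \<Longrightarrow> deg V x = n - 1"
  unfolding deg_def by (metis (mono_tags, lifting) graded_space_unique the_equality)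

lemma dual_bases_parity:
  assumes g: "graded_space s V" and q: "quadratic_form s V b" and d: "dual_bases s V b E"
    and e: "(e, e') \<in> set E"
  shows "even (deg V e') = even (deg V e)"
proof -
  obtain i where i: "i < length E" "E ! i = (e, e')" using e by (metis in_set_conv_nth)
  then have b: "b e e' = 1" using d unfolding dual_bases_def by fastforce
  interpret vector_space s using g by (simp add: graded_space_def)
  obtain m n where mn: "e \<in> V m" "e' \<in> V n" using d e unfolding dual_bases_def homog_def by fast
  have "\<forall>m n. \<forall>x\<in>V m. \<forall>y\<in>V n. m + n \<noteq> 0 \<longrightarrow> b x y = 0"
    using q unfolding quadratic_form_def by blast
  then have "m + n = 0" using b mn by (metis zero_neq_one)
  have l: "Vector_Spaces.linear s (*) (b e)" "Vector_Spaces.linear s (*) (\<lambda>x. b x e')"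
    using q unfolding quadratic_form_def bilin_def by auto
  have "e' \<noteq> 0" "e \<noteq> 0"
    using b Vector_Spaces.linear.axioms(3)[OF l(1)] Vector_Spaces.linear.axioms(3)[OF l(2)]
    by (auto dest: module_hom.zero)
  then have "deg V e = m - 1" "deg V e' = n - 1" using deg_eq[OF g] mn by auto
  then show ?thesis using \<open>m + n = 0\<close> by presburger
qed

lemma tensor_snoc2:
  "tensor V \<beta> \<alpha> (xs @ [y1, y2]) = sg ((deg V y1 + deg V y2) * ldeg V xs) (\<beta> xs * \<alpha> [y1, y2])"
  by (simp add: tensor_def)

lemma has_degree_parity: "has_degree V n f \<Longrightarrow> f zs \<noteq> 0 \<Longrightarrow> even n = even (ldeg V zs)"
  by (auto simp: has_degree_def)

lemma bracket_tensor_aux1: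
  assumes E: "\<forall>(e, e')\<in>set E. even (deg V e') = even (deg V e)"
  shows "contract V E (tensor V \<beta> \<alpha>) (tensor V \<beta>' \<alpha>') I [x] [] (J @ [y1, y2])
    = sg ((deg V y1 + deg V y2) * (ldeg V I + deg V x + ldeg V J) + (deg V x + ldeg V J) * ldeg V I)
        (\<beta> I * contract V E \<alpha> \<beta>' [] [x] [] J * \<alpha>' [y1, y2])"
proof -
  have 1: "tensor V \<beta> \<alpha> (I @ e # [x]) = sg ((deg V e + deg V x) * ldeg V I) (\<beta> I * \<alpha> [e, x])"
    "tensor V \<beta>' \<alpha>' ([] @ e # J @ [y1, y2])
      = sg ((deg V y1 + deg V y2) * (deg V e + ldeg V J)) (\<beta>' (e # J) * \<alpha>' [y1, y2])" for e
    using tensor_snoc2[of V \<beta> \<alpha> I e x] tensor_snoc2[of V \<beta>' \<alpha>' "e # J" y1 y2] by simp_all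
  show ?thesis
    unfolding contract_def sum_list_const_mult[symmetric] sum_list_mult_const[symmetric] sg_sum_list 1
    apply (rule arg_cong[where f = sum_list], rule map_cong[OF refl])
    apply (clarsimp simp: sg_mult sg_sg mult.assoc mult.left_commute)
    subgoal for e e'
      using E[THEN bspec, of "(e, e')"] by (intro sg_cong; ((simp; argo) | simp add: ac_simps))
    done
qed

lemma bracket_tensor_aux2:
  assumes E: "\<forall>(e, e')\<in>set E. even (deg V e') = even (deg V e)"
    and d: "has_degree V p \<beta>" "has_degree V a \<alpha>" "has_degree V p' \<beta>'" "has_degree V a' \<alpha>'"
  shows "sg (deg V x * ldeg V J + (deg V y1 + deg V y2) * (ldeg V J + deg V x))
      (contract V E (tensor V \<beta> \<alpha>) (tensor V \<beta>' \<alpha>') [] (I @ [y1, y2]) J [x])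
    = sg (p' * (p + a) + a * a' + (deg V y1 + deg V y2) * (ldeg V I + deg V x + ldeg V J))
        (\<beta>' J * contract V E \<beta> \<alpha>' [] I [] [x] * \<alpha> [y1, y2])"
proof -
  have 1: "tensor V \<beta>' \<alpha>' (J @ e # [x]) = sg ((deg V e + deg V x) * ldeg V J) (\<beta>' J * \<alpha>' [e, x])"
    "tensor V \<beta> \<alpha> ([] @ e # I @ [y1, y2])
      = sg ((deg V y1 + deg V y2) * (deg V e + ldeg V I)) (\<beta> (e # I) * \<alpha> [y1, y2])" for e
    using tensor_snoc2[of V \<beta>' \<alpha>' J e x] tensor_snoc2[of V \<beta> \<alpha> "e # I" y1 y2] by simp_all
  show ?thesis
    unfolding contract_def sum_list_const_mult[symmetric] sum_list_mult_const[symmetric] sg_sum_list 1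
    apply (rule arg_cong[where f = sum_list], rule map_cong[OF refl])
    apply (clarsimp simp: sg_mult sg_sg mult.assoc mult.left_commute)
    subgoal for e e'
    proof (cases "\<beta>' J * (\<alpha>' [e', x] * (\<beta> (e # I) * \<alpha> [y1, y2])) = 0")
      case True
      then show ?thesis by (auto simp: ac_simps)
    next
      case False
      assume e: "(e, e') \<in> set E"
      have "even p = (even (deg V e) = even (ldeg V I))" "even p' = even (ldeg V J)"
        "even a = (even (deg V y1) = even (deg V y2))" "even a' = (even (deg V e) = even (deg V x))"
        using False has_degree_parity[OF d(1), of "e # I"] has_degree_parity[OF d(2), of "[y1,y2]"]
          has_degree_parity[OF d(3), of J] has_degree_parity[OF d(4), of "[e',x]"] E[THEN bspec, OF e]
        by simp_all
      then show ?thesis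
        using E[THEN bspec, OF e] by (intro sg_cong; ((simp; argo) | simp add: ac_simps))
    qed
    done
qed

lemma bracket_tensor_aux3:
  assumes E: "\<forall>(e, e')\<in>set E. even (deg V e') = even (deg V e)"
    and d: "has_degree V a \<alpha>" "has_degree V p' \<beta>'"
  shows "sg (deg V y1 * ldeg V J) (contract V E (tensor V \<beta> \<alpha>) (tensor V \<beta>' \<alpha>') I [y1] J [y2])
    = sg (a * p' + (deg V y1 + deg V y2) * (ldeg V I + ldeg V J) + ldeg V J * ldeg V I)
        (\<beta> I * \<beta>' J * contract V E \<alpha> \<alpha>' [] [y1] [] [y2])"
proof -
  have 1: "tensor V \<beta> \<alpha> (I @ e # [x]) = sg ((deg V e + deg V x) * ldeg V I) (\<beta> I * \<alpha> [e, x])"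
    "tensor V \<beta>' \<alpha>' (J @ e # [x]) = sg ((deg V e + deg V x) * ldeg V J) (\<beta>' J * \<alpha>' [e, x])" for e x
    using tensor_snoc2[of V \<beta>' \<alpha>' J e x] tensor_snoc2[of V \<beta> \<alpha> I e x] by simp_all
  show ?thesis
    unfolding contract_def sum_list_const_mult[symmetric] sum_list_mult_const[symmetric] sg_sum_list 1
    apply (rule arg_cong[where f = sum_list], rule map_cong[OF refl])
    apply (clarsimp simp: sg_mult sg_sg mult.assoc mult.left_commute)
    subgoal for e e'
    proof (cases "\<beta>' J * \<alpha> [e, y1] = 0")
      case True
      then show ?thesis by (auto simp: ac_simps)
    next
      case False
      assume e: "(e, e') \<in> set E"
      have "even p' = even (ldeg V J)" "even a = (even (deg V e) = even (deg V y1))"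
        using False has_degree_parity[OF d(1), of "[e,y1]"] has_degree_parity[OF d(2), of J]
        by simp_all
      then show ?thesis
        using E[THEN bspec, OF e] by (intro sg_cong; ((simp; argo) | simp add: ac_simps))
    qed
    done
qed

lemma sg_fun: "sg n f x = sg n (f x)"
  by (simp add: sg_def)

lemma cyc_bracket_two:
  assumes "\<alpha> \<in> sym2_forms s V" "\<alpha>' \<in> sym2_forms s V"
  shows "cyc_bracket V E \<alpha> \<alpha>' [y1, y2] = contract V E \<alpha> \<alpha>' [] [y1] [] [y2]
    + sg (deg V y1 * deg V y2) (contract V E \<alpha> \<alpha>' [] [y2] [] [y1])"
proof -
  have "\<alpha>' \<in> sym_forms s V" using assms(2) by (simp add: sym2_forms_def)
  from cyc_bracket_left[OF assms(1) this] show ?thesis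
    by (simp add: mult.commute)
qed

text \<open>The coefficients are the signs of the permutations from \<open>\<beta> \<alpha> \<beta>' \<alpha>'\<close> to \<open>\<beta>' \<beta> \<alpha>' \<alpha>\<close> and to
  \<open>\<beta> \<beta>' \<alpha> \<alpha>'\<close>; \<open>p\<close>, \<open>a\<close>, \<open>p'\<close>, \<open>a'\<close> are the degrees.\<close>

lemma bracket_tensor:
  fixes s :: "'k::field_char_0 \<Rightarrow> 'v::ab_group_add \<Rightarrow> 'v"
  assumes V: "graded_space s V" "quadratic_form s V b" "dual_bases s V b E"
    and \<beta>: "\<beta> \<in> sym_forms s V" "has_degree V p \<beta>" and \<alpha>: "\<alpha> \<in> sym2_forms s V" "has_degree V a \<alpha>"
    and \<beta>': "\<beta>' \<in> sym_forms s V" "has_degree V p' \<beta>'" and \<alpha>': "\<alpha>' \<in> sym2_forms s V" "has_degree V a' \<alpha>'"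
  shows "bracket V E (tensor V \<beta> \<alpha>) (tensor V \<beta>' \<alpha>') =
    tensor V (sym_prod V \<beta> (cyc_bracket V E \<alpha> \<beta>')) \<alpha>'
    + sg (p' * (p + a) + a * a') (tensor V (sym_prod V \<beta>' (cyc_bracket V E \<beta> \<alpha>')) \<alpha>)
    + sg (a * p') (tensor V (sym_prod V \<beta> \<beta>') (cyc_bracket V E \<alpha> \<alpha>'))"
proof
  fix zs :: "'v list"
  have E: "\<forall>(e, e')\<in>set E. even (deg V e') = even (deg V e)"
    using dual_bases_parity[OF V] by blast
  let ?c = "contract V E (tensor V \<beta> \<alpha>) (tensor V \<beta>' \<alpha>')"
  show "bracket V E (tensor V \<beta> \<alpha>) (tensor V \<beta>' \<alpha>') zs =
    (tensor V (sym_prod V \<beta> (cyc_bracket V E \<alpha> \<beta>')) \<alpha>'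
    + sg (p' * (p + a) + a * a') (tensor V (sym_prod V \<beta>' (cyc_bracket V E \<beta> \<alpha>')) \<alpha>)
    + sg (a * p') (tensor V (sym_prod V \<beta> \<beta>') (cyc_bracket V E \<alpha> \<alpha>'))) zs"
  proof (cases "length zs < 2")
    case True
    then show ?thesis by (simp add: bracket_def tensor_def sg_fun)
  next
    case False
    define xs where "xs = take (length zs - 2) zs"
    define y1 where "y1 = zs ! (length zs - 2)"
    define y2 where "y2 = zs ! (length zs - 2 + 1)"
    define Y where "Y = deg V y1 + deg V y2"
    have "drop (length zs - 2) zs = [y1, y2]"
      using False unfolding y1_def y2_def
      by (simp add: Cons_nth_drop_Suc[symmetric] numeral_2_eq_2)
    then have zs: "zs = xs @ [y1, y2]"
      unfolding xs_def by (metis append_take_drop_id)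
    have ld: "ldeg V xs = ldeg V I + ldeg V K" if "mset I + mset K = mset xs" for I K xs :: "'v list"
      using ldeg_mset[of xs "I @ K" V] that by simp
    have 1: "unshuffle1 V (\<lambda>I x J. ?c I [x] [] (J @ [y1, y2])) xs
        = tensor V (sym_prod V \<beta> (cyc_bracket V E \<alpha> \<beta>')) \<alpha>' zs"
      unfolding zs tensor_snoc2 unshuffle1_def sym_prod_def cyc_bracket_left[OF \<alpha>(1) \<beta>'(1)]
        unshuffle_mult unshuffle_sg
    proof (intro unshuffle_cong)
      fix I K M J assume m: "mset I + mset K = mset xs" "mset M + mset J = mset K"
      show "(if length M = 1 then ?c I [hd M] [] (J @ [y1, y2]) else 0)
          = sg ((deg V y1 + deg V y2) * ldeg V xs) (sg (ldeg V K * ldeg V I)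
              (\<beta> I * (if length M = 1 then contract V E \<alpha> \<beta>' [] [hd M] [] J else 0)) * \<alpha>' [y1, y2])"
      proof (cases "length M = 1")
        case True
        then obtain x where x: "M = [x]" by (auto simp: length_Suc_conv)
        show ?thesis
          using ld[OF m(1)] ld[OF m(2)] bracket_tensor_aux1[OF E, of \<beta> \<alpha> \<beta>' \<alpha>' I x J y1 y2]
          by (simp add: x sg_mult sg_sg add.assoc)
      qed simp
    qed
    have 2: "unshuffle1 V (\<lambda>I x J. sg (deg V x * ldeg V J + Y * (ldeg V J + deg V x))
          (?c [] (I @ [y1, y2]) J [x])) xs
        = sg (p' * (p + a) + a * a') (tensor V (sym_prod V \<beta>' (cyc_bracket V E \<beta> \<alpha>')) \<alpha>) zs"
    proof -
      have *: "sym_prod V \<beta>' (cyc_bracket V E \<beta> \<alpha>') xs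
          = unshuffle V (\<lambda>K J. \<beta>' J * cyc_bracket V E \<beta> \<alpha>' K) xs"
        unfolding sym_prod_def
        using unshuffle_comm[of V "\<lambda>J K. \<beta>' J * cyc_bracket V E \<beta> \<alpha>' K" xs] by (simp add: mult.commute)
      show ?thesis
        unfolding sg_fun zs tensor_snoc2 * unfolding unshuffle1_def cyc_bracket_right[OF \<alpha>'(1) \<beta>(1)]
          unshuffle_mult unshuffle_sg unshuffle_assoc
      proof (intro unshuffle_cong)
        fix K J I M assume m: "mset K + mset J = mset xs" "mset I + mset M = mset K"
        show "(if length M = 1 then sg (deg V (hd M) * ldeg V J + Y * (ldeg V J + deg V (hd M)))
              (?c [] (I @ [y1, y2]) J [hd M]) else 0)
            = sg (p' * (p + a) + a * a') (sg ((deg V y1 + deg V y2) * ldeg V xs)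
              (\<beta>' J * (if length M = 1 then contract V E \<beta> \<alpha>' [] I [] [hd M] else 0) * \<alpha> [y1, y2]))"
        proof (cases "length M = 1")
          case True
          then obtain x where x: "M = [x]" by (auto simp: length_Suc_conv)
          show ?thesis
            using ld[OF m(1)] ld[OF m(2)]
              bracket_tensor_aux2[OF E \<beta>(2) \<alpha>(2) \<beta>'(2) \<alpha>'(2), of x J y1 y2 I]
            by (simp add: x sg_sg Y_def)
        qed simp
      qed
    qed
    have 3: "unshuffle V (\<lambda>I J. sg (deg V y1 * ldeg V J) (?c I [y1] J [y2])
            + sg (deg V y2 * ldeg V J + deg V y1 * deg V y2) (?c I [y2] J [y1])) xs
        = sg (a * p') (tensor V (sym_prod V \<beta> \<beta>') (cyc_bracket V E \<alpha> \<alpha>')) zs"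
      unfolding sg_fun zs tensor_snoc2 sym_prod_def cyc_bracket_two[OF \<alpha>(1) \<alpha>'(1)]
        unshuffle_mult unshuffle_sg
    proof (intro unshuffle_cong)
      fix I J assume m: "mset I + mset J = mset xs"
      note aux = bracket_tensor_aux3[OF E \<alpha>(2) \<beta>'(2), of _ J \<beta> \<alpha>' I]
      have "sg (deg V y2 * ldeg V J + deg V y1 * deg V y2) (?c I [y2] J [y1])
         = sg (deg V y1 * deg V y2) (sg (deg V y2 * ldeg V J) (?c I [y2] J [y1]))"
        by (simp add: sg_sg add.commute)
      also have "\<dots> = sg (deg V y1 * deg V y2)
          (sg (a * p' + (deg V y1 + deg V y2) * (ldeg V I + ldeg V J) + ldeg V J * ldeg V I)
            (\<beta> I * \<beta>' J * contract V E \<alpha> \<alpha>' [] [y2] [] [y1]))"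
        using aux[of y2 y1] by (simp add: add.commute)
      finally show "sg (deg V y1 * ldeg V J) (?c I [y1] J [y2])
            + sg (deg V y2 * ldeg V J + deg V y1 * deg V y2) (?c I [y2] J [y1])
        = sg (a * p') (sg ((deg V y1 + deg V y2) * ldeg V xs) (sg (ldeg V J * ldeg V I) (\<beta> I * \<beta>' J)
            * (contract V E \<alpha> \<alpha>' [] [y1] [] [y2]
               + sg (deg V y1 * deg V y2) (contract V E \<alpha> \<alpha>' [] [y2] [] [y1]))))"
        using aux[of y1 y2] ld[OF m]
        by (simp add: sg_mult sg_sg distrib_left sg_plus ac_simps)
    qed
    have "bracket V E (tensor V \<beta> \<alpha>) (tensor V \<beta>' \<alpha>') zs =
        unshuffle1 V (\<lambda>I x J. ?c I [x] [] (J @ [y1, y2])) xs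
        + unshuffle1 V (\<lambda>I x J. sg (deg V x * ldeg V J + Y * (ldeg V J + deg V x))
            (?c [] (I @ [y1, y2]) J [x])) xs
        + unshuffle V (\<lambda>I J. sg (deg V y1 * ldeg V J) (?c I [y1] J [y2])
            + sg (deg V y2 * ldeg V J + deg V y1 * deg V y2) (?c I [y2] J [y1])) xs"
      using False unfolding bracket_def Let_def xs_def y1_def y2_def Y_def by simp
    then show ?thesis unfolding 1 2 3 by simp
  qed
qed

lemma unshuffle_eq_0:
  "(\<And>I J. mset I + mset J = mset xs \<Longrightarrow> F I J = 0) \<Longrightarrow> unshuffle V F xs = 0"
  using unshuffle_cong[of xs F "\<lambda>_ _. 0" V] by simp

lemma unshuffle1_eq_0:
  assumes "\<And>I x J. mset I + {#x#} + mset J = mset xs \<Longrightarrow> F I x J = 0"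
  shows "unshuffle1 V F xs = 0"
  unfolding unshuffle1_def
proof (intro unshuffle_eq_0)
  fix I K M J assume m: "mset I + mset K = mset xs" "mset M + mset J = mset K"
  show "(if length M = 1 then F I (hd M) J else 0) = 0"
  proof (cases "length M = 1")
    case True
    then obtain x where x: "M = [x]" by (auto simp: length_Suc_conv)
    have "mset I + {#x#} + mset J = mset xs"
      unfolding m(1)[symmetric] m(2)[symmetric] x by simp
    then show ?thesis using assms by (simp add: x)
  qed simp
qed

lemma unshuffle_swap:
  assumes "\<And>A x y C J. F (A @ x # y # C) J = sg (deg V x * deg V y) (F (A @ y # x # C) J)"
    and "\<And>A x y C I. F I (A @ x # y # C) = sg (deg V x * deg V y) (F I (A @ y # x # C))"
  shows "unshuffle V F (us @ x # y # ws) = sg (deg V x * deg V y) (unshuffle V F (us @ y # x # ws))"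
  using assms
proof (induct us arbitrary: F)
  case Nil
  have 1: "unshuffle V (\<lambda>I J. F (x # y # I) J) ws
      = sg (deg V x * deg V y) (unshuffle V (\<lambda>I J. F (y # x # I) J) ws)"
    unfolding unshuffle_sg by (rule unshuffle_cong) (metis Nil(1) append_Nil)
  have 2: "unshuffle V (\<lambda>I J. sg (deg V x * ldeg V (y # I)) (F (y # I) (x # J))) ws
      = sg (deg V x * deg V y) (unshuffle V (\<lambda>I J. sg (deg V x * ldeg V I) (F (y # I) (x # J))) ws)"
    unfolding unshuffle_sg by (rule unshuffle_cong) (simp add: sg_sg distrib_left)
  have 3: "unshuffle V (\<lambda>I J. sg (deg V y * ldeg V I) (F (x # I) (y # J))) ws
      = sg (deg V x * deg V y) (unshuffle V (\<lambda>I J. sg (deg V y * ldeg V (x # I)) (F (x # I) (y # J))) ws)"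
    unfolding unshuffle_sg
    by (rule unshuffle_cong) (simp add: sg_sg; rule sg_cong; (simp; argo))
  have 4: "unshuffle V (\<lambda>I J. sg (deg V y * ldeg V I) (sg (deg V x * ldeg V I) (F I (x # y # J)))) ws
      = sg (deg V x * deg V y)
        (unshuffle V (\<lambda>I J. sg (deg V x * ldeg V I) (sg (deg V y * ldeg V I) (F I (y # x # J)))) ws)"
    unfolding unshuffle_sg
  proof (rule unshuffle_cong)
    fix I J
    have "F I (x # y # J) = sg (deg V x * deg V y) (F I (y # x # J))"
      using Nil(2)[of I "[]" x y J] by simp
    then show "sg (deg V y * ldeg V I) (sg (deg V x * ldeg V I) (F I (x # y # J)))
      = sg (deg V x * deg V y) (sg (deg V x * ldeg V I) (sg (deg V y * ldeg V I) (F I (y # x # J))))"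
      by (simp add: sg_sg add.commute add.left_commute)
  qed
  show ?case
    using 1 2 3 4 by (simp add: sg_plus)
next
  case (Cons u us)
  have "unshuffle V (\<lambda>I J. F (u # I) J) (us @ x # y # ws)
      = sg (deg V x * deg V y) (unshuffle V (\<lambda>I J. F (u # I) J) (us @ y # x # ws))"
  proof (rule Cons(1))
    fix A x y C J
    show "F (u # A @ x # y # C) J = sg (deg V x * deg V y) (F (u # A @ y # x # C) J)"
      using Cons(2)[of "u # A" x y C J] by simp
    show "F (u # J) (A @ x # y # C) = sg (deg V x * deg V y) (F (u # J) (A @ y # x # C))"
      by (rule Cons(3))
  qed
  moreover have "unshuffle V (\<lambda>I J. sg (deg V u * ldeg V I) (F I (u # J))) (us @ x # y # ws)
      = sg (deg V x * deg V y)
         (unshuffle V (\<lambda>I J. sg (deg V u * ldeg V I) (F I (u # J))) (us @ y # x # ws))"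
  proof (rule Cons(1))
    fix A x y C J
    show "sg (deg V u * ldeg V (A @ x # y # C)) (F (A @ x # y # C) (u # J))
      = sg (deg V x * deg V y) (sg (deg V u * ldeg V (A @ y # x # C)) (F (A @ y # x # C) (u # J)))"
      unfolding Cons(2)[of A x y C] by (simp add: sg_sg add.commute add.left_commute)
    show "sg (deg V u * ldeg V J) (F J (u # A @ x # y # C))
      = sg (deg V x * deg V y) (sg (deg V u * ldeg V J) (F J (u # A @ y # x # C)))"
      using Cons(3)[of J "u # A" x y C] by (simp add: sg_sg add.commute)
  qed
  ultimately show ?case by (simp add: sg_plus)
qed

lemma unshuffle1_swap:
  assumes 1: "\<And>A x y C z J. F (A @ x # y # C) z J = sg (deg V x * deg V y) (F (A @ y # x # C) z J)"
    and 2: "\<And>A x y C z I. F I z (A @ x # y # C) = sg (deg V x * deg V y) (F I z (A @ y # x # C))"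
  shows "unshuffle1 V F (us @ x # y # ws) = sg (deg V x * deg V y) (unshuffle1 V F (us @ y # x # ws))"
  unfolding unshuffle1_def
proof (rule unshuffle_swap)
  fix A x y C J
  show "unshuffle V (\<lambda>M J. if length M = 1 then F (A @ x # y # C) (hd M) J else 0) J
    = sg (deg V x * deg V y)
       (unshuffle V (\<lambda>M J. if length M = 1 then F (A @ y # x # C) (hd M) J else 0) J)"
    unfolding unshuffle_sg by (rule unshuffle_cong) (simp add: 1[of A x y C, symmetric])
  show "unshuffle V (\<lambda>M K. if length M = 1 then F J (hd M) K else 0) (A @ x # y # C)
    = sg (deg V x * deg V y)
       (unshuffle V (\<lambda>M K. if length M = 1 then F J (hd M) K else 0) (A @ y # x # C))"
  proof (rule unshuffle_swap)
    fix A x y C K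
    show "(if length (A @ x # y # C) = 1 then F J (hd (A @ x # y # C)) K else 0)
      = sg (deg V x * deg V y) (if length (A @ y # x # C) = 1 then F J (hd (A @ y # x # C)) K else 0)"
      by simp
    show "(if length K = 1 then F J (hd K) (A @ x # y # C) else 0)
      = sg (deg V x * deg V y) (if length K = 1 then F J (hd K) (A @ y # x # C) else 0)"
      using 2[of J "hd K" A x y C] by simp
  qed
qed

definition slot_linear ::
  "('k::field_char_0 \<Rightarrow> 'v::ab_group_add \<Rightarrow> 'v) \<Rightarrow> (int \<Rightarrow> 'v set) \<Rightarrow> ('v \<Rightarrow> 'k) \<Rightarrow> bool" where
  "slot_linear s V h \<longleftrightarrow> (\<forall>n. \<forall>x\<in>V n. \<forall>y\<in>V n. h (x + y) = h x + h y) \<and>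
     (\<forall>n. \<forall>x\<in>V n. \<forall>c. h (s c x) = c * h x)"

lemma slot_linear_0: "graded_space s V \<Longrightarrow> slot_linear s V h \<Longrightarrow> h 0 = 0"
proof -
  assume g: "graded_space s V" and h: "slot_linear s V h"
  interpret vector_space s using g by (simp add: graded_space_def)
  have "0 \<in> V 0" using g subspace_0 by (auto simp: graded_space_def)
  then have "h (s 0 0) = 0 * h 0" using h unfolding slot_linear_def by blast
  then show "h 0 = 0" by simp
qed

lemma slot_linear_sg:
  assumes g: "graded_space s V" and h: "slot_linear s V h"
  shows "slot_linear s V (\<lambda>x. sg (\<phi> (deg V x)) (h x))"
proof -
  interpret vector_space s using g by (simp add: graded_space_def)
  have e: "sg (\<phi> (deg V x)) (h x) = sg (\<phi> (n - 1)) (h x)" if "x \<in> V n" for n x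
    using deg_eq[OF g that] slot_linear_0[OF g h] by (cases "x = 0") auto
  have cl: "x + y \<in> V n" "s c x \<in> V n" if "x \<in> V n" "y \<in> V n" for n x y c
    using that g subspace_add subspace_scale by (auto simp: graded_space_def)
  have l: "h (x + y) = h x + h y" "h (s c x) = c * h x" if "x \<in> V n" "y \<in> V n" for n x y c
    using h that unfolding slot_linear_def by blast+
  show ?thesis
    unfolding slot_linear_def
  proof (intro conjI allI ballI)
    fix n x y assume x: "x \<in> V n" and y: "y \<in> V n"
    show "sg (\<phi> (deg V (x + y))) (h (x + y)) = sg (\<phi> (deg V x)) (h x) + sg (\<phi> (deg V y)) (h y)"
      by (rule trans[OF e[OF cl(1)[OF x y]]]) (simp only: e[OF x] e[OF y] l(1)[OF x y] sg_plus)
  next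
    fix n x c assume x: "x \<in> V n"
    show "sg (\<phi> (deg V (s c x))) (h (s c x)) = c * sg (\<phi> (deg V x)) (h x)"
      by (rule trans[OF e[OF cl(2)[OF x x]]]) (simp only: e[OF x] l(2)[OF x x] sg_mult)
  qed
qed

lemma slot_linear_add:
  "slot_linear s V h \<Longrightarrow> slot_linear s V h' \<Longrightarrow> slot_linear s V (\<lambda>x. h x + h' x)"
  unfolding slot_linear_def by (simp add: algebra_simps)

lemma slot_linear_zero: "slot_linear s V (\<lambda>x. 0)"
  unfolding slot_linear_def by simp

lemma slot_linear_unshuffle:
  assumes "\<And>I J. slot_linear s V (\<lambda>x. F x I J)"
  shows "slot_linear s V (\<lambda>x. unshuffle V (F x) xs)"
  unfolding slot_linear_def unshuffle_add[symmetric] unshuffle_mult(1)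
  by (intro conjI allI ballI; rule unshuffle_cong) (use assms in \<open>auto simp: slot_linear_def\<close>)

lemma unshuffle_slot:
  assumes g: "graded_space s V"
    and "\<And>A C J. slot_linear s V (\<lambda>x. F (A @ x # C) J)"
    and "\<And>A C I. slot_linear s V (\<lambda>x. F I (A @ x # C))"
  shows "slot_linear s V (\<lambda>x. unshuffle V F (us @ x # ws))"
  using assms(2,3)
proof (induct us arbitrary: F)
  case Nil
  show ?case
    unfolding append_Nil unshuffle.simps
    using Nil(1)[of "[]"] Nil(2)[of _ "[]"]
    by (intro slot_linear_add slot_linear_unshuffle slot_linear_sg[OF g, of _ "\<lambda>n. n * _"]) simp_all
next
  case (Cons u us)
  show ?case
    unfolding append_Cons unshuffle.simps
  proof (intro slot_linear_add Cons(1))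
    fix A C J
    show "slot_linear s V (\<lambda>x. F (u # A @ x # C) J)" using Cons(2)[of "u # A"] by simp
    show "slot_linear s V (\<lambda>x. F (u # J) (A @ x # C))" by (rule Cons(3))
    show "slot_linear s V (\<lambda>x. sg (deg V u * ldeg V (A @ x # C)) (F (A @ x # C) (u # J)))"
      using slot_linear_sg[OF g Cons(2), of "\<lambda>n. deg V u * (ldeg V A + (n + ldeg V C))"] by simp
    show "slot_linear s V (\<lambda>x. sg (deg V u * ldeg V J) (F J (u # A @ x # C)))"
      using slot_linear_sg[OF g Cons(3), of "\<lambda>n. deg V u * ldeg V J" J "u # A"] by simp
  qed
qed

lemma unshuffle1_slot:
  assumes g: "graded_space s V"
    and 1: "\<And>A C z J. slot_linear s V (\<lambda>x. F (A @ x # C) z J)"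
    and 2: "\<And>I J. slot_linear s V (\<lambda>x. F I x J)"
    and 3: "\<And>A C z I. slot_linear s V (\<lambda>x. F I z (A @ x # C))"
  shows "slot_linear s V (\<lambda>x. unshuffle1 V F (us @ x # ws))"
  unfolding unshuffle1_def
proof (rule unshuffle_slot[OF g])
  fix A C J
  show "slot_linear s V (\<lambda>x. unshuffle V (\<lambda>M J. if length M = 1 then F (A @ x # C) (hd M) J else 0) J)"
  proof (rule slot_linear_unshuffle)
    fix M K
    show "slot_linear s V (\<lambda>x. if length M = 1 then F (A @ x # C) (hd M) K else 0)"
      using 1 slot_linear_zero by (cases "length M = 1") auto
  qed
  show "slot_linear s V (\<lambda>x. unshuffle V (\<lambda>M K. if length M = 1 then F J (hd M) K else 0) (A @ x # C))"
  proof (rule unshuffle_slot[OF g])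
    fix A C K
    show "slot_linear s V (\<lambda>x. if length (A @ x # C) = 1 then F J (hd (A @ x # C)) K else 0)"
      using 2 slot_linear_zero by (cases "A = [] \<and> C = []") auto
    show "slot_linear s V (\<lambda>x. if length K = 1 then F J (hd K) (A @ x # C) else 0)"
      using 3 slot_linear_zero by (cases "length K = 1") auto
  qed
qed

lemma mforms_slot:
  "f \<in> mforms s V \<longleftrightarrow> (\<forall>zs. (\<exists>z\<in>set zs. \<not> homog V z) \<longrightarrow> f zs = 0) \<and>
     (\<forall>us ws. slot_linear s V (\<lambda>x. f (us @ x # ws)))"
  unfolding mforms_def slot_linear_def by blast

lemma module_fscale: "module (fscale :: 'k::field_char_0 \<Rightarrow> ('x \<Rightarrow> 'k) \<Rightarrow> 'x \<Rightarrow> 'k)"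
  by standard (auto simp: fscale_def algebra_simps)

lemma mon_in_P: "mon s V zs \<in> P_space s V"
  unfolding P_space_def by (rule module.span_base[OF module_fscale]) simp

lemma mon_0: "\<exists>z\<in>set zs. \<not> homog V z \<Longrightarrow> mon s V zs = 0"
  unfolding mon_def pforms_def mforms_def zero_fun_def by (rule ext) auto

lemma mon_slot:
  assumes "x \<in> V n" "y \<in> V n"
  shows "mon s V (us @ (x + y) # ws) = mon s V (us @ x # ws) + mon s V (us @ y # ws)"
    "mon s V (us @ s c x # ws) = fscale c (mon s V (us @ x # ws))"
proof -
  have "f (us @ (x + y) # ws) = f (us @ x # ws) + f (us @ y # ws)"
    "f (us @ s c x # ws) = c * f (us @ x # ws)" if "f \<in> pforms s V" for f
    using that assms unfolding pforms_def mforms_def by blast+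
  then show "mon s V (us @ (x + y) # ws) = mon s V (us @ x # ws) + mon s V (us @ y # ws)"
    "mon s V (us @ s c x # ws) = fscale c (mon s V (us @ x # ws))"
    unfolding mon_def fscale_def by (auto simp: fun_eq_iff)
qed

lemma mon_swap:
  assumes "ws \<noteq> []"
  shows "mon s V (us @ x # y # ws) = sg (deg V x * deg V y) (mon s V (us @ y # x # ws))"
proof -
  have "f (us @ x # y # ws) = sg (deg V x * deg V y) (f (us @ y # x # ws))" if "f \<in> pforms s V" for f
    using that assms unfolding pforms_def by blast
  then show ?thesis unfolding mon_def by (auto simp: fun_eq_iff sg_fun)
qed

lemma P_bilforms_simps:
  assumes "g \<in> P_bilforms s V" "p \<in> P_space s V" "p' \<in> P_space s V" "r \<in> P_space s V"
  shows "g (p + p') r = g p r + g p' r" "g (fscale c p) r = c * g p r"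
    "g r (p + p') = g r p + g r p'" "g r (fscale c p) = c * g r p"
    "g 0 r = 0" "g r 0 = 0" "g (sg n p) r = sg n (g p r)" "g r (sg n p) = sg n (g r p)"
proof -
  show 1: "g (p + p') r = g p r + g p' r" "g r (p + p') = g r p + g r p'" 
    and 2: "g (fscale c p) r = c * g p r" "g r (fscale c p) = c * g r p" for c
    using assms unfolding P_bilforms_def by blast+
  have "fscale 0 p = 0" "fscale (-1) p = - p" by (auto simp: fscale_def fun_eq_iff)
  then show "g 0 r = 0" "g r 0 = 0" "g (sg n p) r = sg n (g p r)" "g r (sg n p) = sg n (g r p)"
    using 2[of 0] 2[of "-1"] by (auto simp: sg_def)
qed

lemma P_bilforms_slot:
  assumes g: "g \<in> P_bilforms s V" and r: "r \<in> P_space s V"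
  shows "slot_linear s V (\<lambda>x. g (mon s V (us @ x # ws)) r)"
    "slot_linear s V (\<lambda>x. g r (mon s V (us @ x # ws)))"
  unfolding slot_linear_def
  by (auto simp: mon_slot P_bilforms_simps[OF g mon_in_P mon_in_P r])

lemma Delta_transpose_pform:
  assumes V: "graded_space s V" and g: "g \<in> P_bilforms s V"
  shows "(\<lambda>zs. if zs = [] then 0
       else unshuffle1 V (\<lambda>I x J. g (mon s V (I @ [x])) (mon s V (J @ [last zs]))) (butlast zs))
     \<in> pforms s V"
proof -
  define f where "f zs = (if zs = [] then 0
       else unshuffle1 V (\<lambda>I x J. g (mon s V (I @ [x])) (mon s V (J @ [last zs]))) (butlast zs))" for zs
  note slot = P_bilforms_slot[OF g mon_in_P]
  note simps = P_bilforms_simps[OF g mon_in_P mon_in_P mon_in_P]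
  have snoc: "f (xs @ [y]) = unshuffle1 V (\<lambda>I x J. g (mon s V (I @ [x])) (mon s V (J @ [y]))) xs" for xs y
    by (simp add: f_def)
  have nil: "f [] = 0" by (simp add: f_def)
  have "f zs = 0" if z: "\<exists>z\<in>set zs. \<not> homog V z" for zs
  proof (cases zs rule: rev_cases)
    case zs: (snoc xs y)
    have "g (mon s V (I @ [x])) (mon s V (J @ [y])) = 0"
      if m: "mset I + {#x#} + mset J = mset xs" for I x J
    proof -
      have "set (I @ [x]) \<union> set (J @ [y]) = set zs"
        using arg_cong[OF m, of set_mset] by (auto simp: zs)
      then have "mon s V (I @ [x]) = 0 \<or> mon s V (J @ [y]) = 0"
        using z mon_0[of "I @ [x]" V s] mon_0[of "J @ [y]" V s] by blast
      then show ?thesis using simps(5,6) by metis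
    qed
    then have "unshuffle1 V (\<lambda>I x J. g (mon s V (I @ [x])) (mon s V (J @ [y]))) xs = 0"
      by (rule unshuffle1_eq_0)
    then show ?thesis by (simp add: snoc zs)
  qed (simp add: nil)
  moreover have "slot_linear s V (\<lambda>x. f (us @ x # ws))" for us ws
  proof (cases ws rule: rev_cases)
    case Nil
    have "slot_linear s V (\<lambda>y. unshuffle1 V (\<lambda>I x J. g (mon s V (I @ [x])) (mon s V (J @ [y]))) us)"
      unfolding unshuffle1_def
    proof (intro slot_linear_unshuffle)
      fix I M J :: "'b list"
      show "slot_linear s V (\<lambda>y. if length M = 1 then g (mon s V (I @ [hd M])) (mon s V (J @ [y])) else 0)"
        using slot(2)[of _ J "[]"] slot_linear_zero by (cases "length M = 1") simp_all
    qed
    then show ?thesis by (simp add: Nil snoc)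
  next
    case ws: (snoc ws' y)
    have "slot_linear s V (\<lambda>z. unshuffle1 V (\<lambda>I x J. g (mon s V (I @ [x])) (mon s V (J @ [y]))) (us @ z # ws'))"
      by (rule unshuffle1_slot[OF V]) (use slot slot(1)[of _ _ "[]"] in simp_all)
    moreover have "us @ z # ws = (us @ z # ws') @ [y]" for z by (simp add: ws)
    ultimately show ?thesis by (simp only: snoc)
  qed
  moreover have "f (us @ x # y # ws) = sg (deg V x * deg V y) (f (us @ y # x # ws))"
    if ne: "ws \<noteq> []" for us x y ws
  proof -
    obtain ws' l where ws: "ws = ws' @ [l]" using ne by (metis rev_exhaust)
    have "unshuffle1 V (\<lambda>I x J. g (mon s V (I @ [x])) (mon s V (J @ [l]))) (us @ x # y # ws')
      = sg (deg V x * deg V y)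
         (unshuffle1 V (\<lambda>I x J. g (mon s V (I @ [x])) (mon s V (J @ [l]))) (us @ y # x # ws'))"
    proof (rule unshuffle1_swap)
      fix A x y C z J
      show "g (mon s V ((A @ x # y # C) @ [z])) (mon s V (J @ [l]))
        = sg (deg V x * deg V y) (g (mon s V ((A @ y # x # C) @ [z])) (mon s V (J @ [l])))"
        using mon_swap[of "C @ [z]" s V A x y] by (simp add: simps(7))
      show "g (mon s V (J @ [z])) (mon s V ((A @ x # y # C) @ [l]))
        = sg (deg V x * deg V y) (g (mon s V (J @ [z])) (mon s V ((A @ y # x # C) @ [l])))"
        using mon_swap[of "C @ [l]" s V A x y] by (simp add: simps(8))
    qed
    moreover have "us @ x # y # ws = (us @ x # y # ws') @ [l]" "us @ y # x # ws = (us @ y # x # ws') @ [l]"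
      by (simp_all add: ws)
    ultimately show ?thesis by (simp only: snoc)
  qed
  ultimately have "f \<in> pforms s V"
    unfolding pforms_def mem_Collect_eq mforms_slot using nil by blast
  then show ?thesis unfolding f_def .
qed

lemma Delta_mon:
  assumes "graded_space s V"
  shows "Delta s V (mon s V (xs @ [y])) =
    unshuffle1 V (\<lambda>I x J. P_tensor s V (mon s V (I @ [x])) (mon s V (J @ [y]))) xs"
proof
  fix g
  have h: "(unshuffle V F zs) g = unshuffle V (\<lambda>I J. F I J g) zs" for F :: "'b list \<Rightarrow> 'b list \<Rightarrow> ('b, 'a) ppelem" and zs
    using unshuffle_hom[of "\<lambda>t. t g" V F zs] by (simp add: sg_fun)
  show "Delta s V (mon s V (xs @ [y])) g =
    unshuffle1 V (\<lambda>I x J. P_tensor s V (mon s V (I @ [x])) (mon s V (J @ [y]))) xs g"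
  proof (cases "g \<in> P_bilforms s V")
    case True
    then show ?thesis
      unfolding unshuffle1_def h if_distrib[of "\<lambda>t. t g"]
      using Delta_transpose_pform[OF assms True]
      by (simp add: Delta_def mon_def[of s V "xs @ [y]"] P_tensor_def unshuffle1_def cong: if_cong)
  next
    case False
    then show ?thesis
      unfolding unshuffle1_def h if_distrib[of "\<lambda>t. t g"]
      by (simp add: Delta_def P_tensor_def cong: if_cong)
  qed
qed

lemma sym_map_slot:
  assumes V: "graded_space s V" and Q: "sym_map s V d Q" and x: "x \<in> V n"
    and us: "\<forall>z\<in>set (us @ ws). homog V z"
  shows "Q (us @ x # ws) \<in> V (ldeg V us + n + ldeg V ws + d)"
proof -
  interpret vector_space s using V by (simp add: graded_space_def)
  have z: "0 \<in> V m" for m using V subspace_0 by (auto simp: graded_space_def)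
  show ?thesis
  proof (cases "x = 0")
    case True
    have "Q (us @ s 0 0 # ws) = s 0 (Q (us @ 0 # ws))" using Q z unfolding sym_map_def by blast
    then show ?thesis using z True by simp
  next
    case False
    have "\<forall>z\<in>set (us @ x # ws). homog V z" using us x by (auto simp: homog_def)
    then have "Q (us @ x # ws) \<in> V (ldeg V (us @ x # ws) + d + 1)" using Q unfolding sym_map_def by blast
    moreover have "ldeg V (us @ x # ws) + d + 1 = ldeg V us + n + ldeg V ws + d"
      using deg_eq[OF V x False] by simp
    ultimately show ?thesis by (rule subst[rotated])
  qed
qed

lemma sym_map_form_slot:
  assumes V: "graded_space s V" and Q: "sym_map s V d Q" and f: "f \<in> mforms s V"
  shows "slot_linear s V (\<lambda>x. f (I @ Q (us @ x # ws) # K))"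
proof (cases "\<forall>z\<in>set (us @ ws). homog V z")
  case True
  have f: "f (I @ (x + y) # K) = f (I @ x # K) + f (I @ y # K)" "f (I @ s c x # K) = c * f (I @ x # K)"
    if "x \<in> V n" "y \<in> V n" for x y n c
    using that f unfolding mforms_def by blast+
  have Qs: "Q (us @ (x + y) # ws) = Q (us @ x # ws) + Q (us @ y # ws)" "Q (us @ s c x # ws) = s c (Q (us @ x # ws))"
    if "x \<in> V n" "y \<in> V n" for x y n c
    using that Q unfolding sym_map_def by blast+
  note m = sym_map_slot[OF V Q _ True]
  show ?thesis
    unfolding slot_linear_def
  proof (intro conjI allI ballI)
    fix n x y assume x: "x \<in> V n" and y: "y \<in> V n"
    show "f (I @ Q (us @ (x + y) # ws) # K) = f (I @ Q (us @ x # ws) # K) + f (I @ Q (us @ y # ws) # K)"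
      unfolding Qs(1)[OF x y] by (rule f(1)[OF m[OF x] m[OF y]])
  next
    fix n x c assume x: "x \<in> V n"
    show "f (I @ Q (us @ s c x # ws) # K) = c * f (I @ Q (us @ x # ws) # K)"
      unfolding Qs(2)[OF x x] by (rule f(2)[OF m[OF x] m[OF x]])
  qed
next
  case False
  interpret vector_space s using V by (simp add: graded_space_def)
  have z: "0 \<in> V 0" using V subspace_0 by (auto simp: graded_space_def)
  have "Q (us @ x # ws) = 0" for x
  proof -
    have "\<exists>z\<in>set (us @ x # ws). \<not> homog V z" using False by auto
    then show ?thesis using Q unfolding sym_map_def by blast
  qed
  moreover have "f (I @ s 0 0 # K) = 0 * f (I @ 0 # K)" using f z unfolding mforms_def by blast
  ultimately show ?thesis using slot_linear_zero by simp
qed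

lemma sym_map_form_swap:
  assumes V: "graded_space s V" and Q: "sym_map s V d Q" and f: "f \<in> mforms s V" and ws: "ws \<noteq> []"
  shows "f (I @ Q (us @ x # y # ws) # K) = sg (deg V x * deg V y) (f (I @ Q (us @ y # x # ws) # K))"
proof -
  interpret vector_space s using V by (simp add: graded_space_def)
  let ?v = "Q (us @ y # x # ws)"
  have z: "0 \<in> V n" for n using V subspace_0 by (auto simp: graded_space_def)
  have "\<exists>n. ?v \<in> V n"
    using Q z unfolding sym_map_def by metis
  then have "f (I @ s (-1) ?v # K) = -1 * f (I @ ?v # K)"
    using f unfolding mforms_def by blast
  moreover have "Q (us @ x # y # ws) = sg (deg V x * deg V y) ?v"
    using Q ws unfolding sym_map_def by blast
  ultimately show ?thesis by (simp add: sg_def)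
qed

lemma coder_ext_transpose_pform:
  assumes V: "graded_space s V" and Q: "sym_map s V d Q" and h: "h \<in> pforms s V"
  shows "(\<lambda>zs. if zs = [] then 0 else
        unshuffle V (\<lambda>I J. sg (d * ldeg V I) (h (I @ [Q (J @ [last zs])]))) (butlast zs)
        + unshuffle1 V (\<lambda>I x J. sg (deg V x * ldeg V J + d * ldeg V I)
            (h (I @ [Q (J @ [x]), last zs]))) (butlast zs)) \<in> pforms s V"
proof -
  define F where "F y I J = sg (d * ldeg V I) (h (I @ [Q (J @ [y])]))" for y I J
  define G where "G y I x J = sg (deg V x * ldeg V J + d * ldeg V I) (h (I @ [Q (J @ [x]), y]))" for y I x J
  define f where "f zs = (if zs = [] then 0 else
     unshuffle V (F (last zs)) (butlast zs) + unshuffle1 V (G (last zs)) (butlast zs))" for zs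
  have hm: "h \<in> mforms s V" using h by (simp add: pforms_def)
  have h0: "h zs = 0" if "\<exists>z\<in>set zs. \<not> homog V z" for zs
    using hm that unfolding mforms_def by blast
  have hs: "slot_linear s V (\<lambda>x. h (us @ x # ws))" for us ws
    using hm unfolding mforms_slot by blast
  have hsw: "h (us @ x # y # ws) = sg (deg V x * deg V y) (h (us @ y # x # ws))" if "ws \<noteq> []" for us x y ws
    using h that unfolding pforms_def by blast
  note hQ = sym_map_form_slot[OF V Q hm] and hQsw = sym_map_form_swap[OF V Q hm]
  have hQ0: "h (us @ Q zs # ws) = 0" if z: "\<exists>z\<in>set us \<union> set zs \<union> set ws. \<not> homog V z" for us zs ws
  proof (cases "\<exists>z\<in>set zs. \<not> homog V z")
    case True
    interpret vector_space s using V by (simp add: graded_space_def)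
    have "Q zs = 0" using True Q unfolding sym_map_def by blast
    then show ?thesis using slot_linear_0[OF V hs] by simp
  next
    case False
    then show ?thesis using z by (intro h0) auto
  qed
  note sgs = slot_linear_sg[OF V]
  have FI: "slot_linear s V (\<lambda>z. F y (A @ z # C) J)" for y A C J
    using sgs[OF hs, of "\<lambda>n. d * (ldeg V A + (n + ldeg V C))" A "C @ [Q (J @ [y])]"] by (simp add: F_def)
  have FJ: "slot_linear s V (\<lambda>z. F y I (A @ z # C))" for y A C I
    using sgs[OF hQ, of "\<lambda>n. d * ldeg V I" I A "C @ [y]" "[]"] by (simp add: F_def)
  have Fy: "slot_linear s V (\<lambda>y. F y I J)" for I J
    using sgs[OF hQ, of "\<lambda>n. d * ldeg V I" I J "[]" "[]"] by (simp add: F_def)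
  have GI: "slot_linear s V (\<lambda>z. G y (A @ z # C) x J)" for y A C x J
    using sgs[OF hs, of "\<lambda>n. deg V x * ldeg V J + d * (ldeg V A + (n + ldeg V C))" A "C @ [Q (J @ [x]), y]"]
    by (simp add: G_def)
  have GJ: "slot_linear s V (\<lambda>z. G y I x (A @ z # C))" for y A C x I
    using sgs[OF hQ, of "\<lambda>n. deg V x * (ldeg V A + (n + ldeg V C)) + d * ldeg V I" I A "C @ [x]" "[y]"]
    by (simp add: G_def)
  have Gx: "slot_linear s V (\<lambda>x. G y I x J)" for y I J
    using sgs[OF hQ, of "\<lambda>n. n * ldeg V J + d * ldeg V I" I J "[]" "[y]"] by (simp add: G_def)
  have Gy: "slot_linear s V (\<lambda>y. G y I x J)" for x I J
    using sgs[OF hs, of "\<lambda>n. deg V x * ldeg V J + d * ldeg V I" "I @ [Q (J @ [x])]" "[]"] by (simp add: G_def)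
  have snoc: "f (xs @ [y]) = unshuffle V (F y) xs + unshuffle1 V (G y) xs" for xs y
    by (simp add: f_def)
  have nil: "f [] = 0" by (simp add: f_def)
  have "f zs = 0" if z: "\<exists>z\<in>set zs. \<not> homog V z" for zs
  proof (cases zs rule: rev_cases)
    case zs: (snoc xs y)
    have "unshuffle V (F y) xs = 0"
    proof (rule unshuffle_eq_0)
      fix I J assume m: "mset I + mset J = mset xs"
      have "set I \<union> set (J @ [y]) = set zs"
        using arg_cong[OF m, of set_mset] by (auto simp: zs)
      then show "F y I J = 0" unfolding F_def using z by (subst hQ0) auto
    qed
    moreover have "unshuffle1 V (G y) xs = 0"
    proof (rule unshuffle1_eq_0)
      fix I x J assume m: "mset I + {#x#} + mset J = mset xs"
      have "set I \<union> set (J @ [x]) \<union> set [y] = set zs"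
        using arg_cong[OF m, of set_mset] by (auto simp: zs)
      then show "G y I x J = 0" unfolding G_def using z by (subst hQ0) auto
    qed
    ultimately show ?thesis by (simp add: snoc zs)
  qed (simp add: nil)
  moreover have "slot_linear s V (\<lambda>x. f (us @ x # ws))" for us ws
  proof (cases ws rule: rev_cases)
    case Nil
    have "slot_linear s V (\<lambda>y. unshuffle V (F y) us + unshuffle1 V (G y) us)"
      unfolding unshuffle1_def
    proof (intro slot_linear_add slot_linear_unshuffle Fy)
      fix I M J
      show "slot_linear s V (\<lambda>y. if length M = 1 then G y I (hd M) J else 0)"
        using Gy slot_linear_zero by (cases "length M = 1") simp_all
    qed
    then show ?thesis by (simp add: Nil snoc)
  next
    case ws: (snoc ws' y)
    have "slot_linear s V (\<lambda>z. unshuffle V (F y) (us @ z # ws') + unshuffle1 V (G y) (us @ z # ws'))"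
      by (intro slot_linear_add unshuffle_slot[OF V] unshuffle1_slot[OF V] FI FJ GI GJ Gx)
    moreover have "us @ z # ws = (us @ z # ws') @ [y]" for z by (simp add: ws)
    ultimately show ?thesis by (simp only: snoc)
  qed
  moreover have "f (us @ x # y # ws) = sg (deg V x * deg V y) (f (us @ y # x # ws))"
    if ne: "ws \<noteq> []" for us x y ws
  proof -
    obtain ws' l where ws: "ws = ws' @ [l]" using ne by (metis rev_exhaust)
    have "unshuffle V (F l) (us @ x # y # ws') = sg (deg V x * deg V y) (unshuffle V (F l) (us @ y # x # ws'))"
    proof (rule unshuffle_swap)
      fix A x y C J
      show "F l (A @ x # y # C) J = sg (deg V x * deg V y) (F l (A @ y # x # C) J)"
        using hsw[of "C @ [Q (J @ [l])]" A x y] by (simp add: F_def sg_sg algebra_simps)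
      show "F l J (A @ x # y # C) = sg (deg V x * deg V y) (F l J (A @ y # x # C))"
        using hQsw[of "C @ [l]" J A x y "[]"] by (simp add: F_def sg_sg algebra_simps)
    qed
    moreover have "unshuffle1 V (G l) (us @ x # y # ws')
        = sg (deg V x * deg V y) (unshuffle1 V (G l) (us @ y # x # ws'))"
    proof (rule unshuffle1_swap)
      fix A x y C z J
      show "G l (A @ x # y # C) z J = sg (deg V x * deg V y) (G l (A @ y # x # C) z J)"
        using hsw[of "C @ [Q (J @ [z]), l]" A x y] by (simp add: G_def sg_sg algebra_simps)
      show "G l J z (A @ x # y # C) = sg (deg V x * deg V y) (G l J z (A @ y # x # C))"
        using hQsw[of "C @ [z]" J A x y "[l]"] by (simp add: G_def sg_sg algebra_simps)
    qed
    moreover have "us @ x # y # ws = (us @ x # y # ws') @ [l]" "us @ y # x # ws = (us @ y # x # ws') @ [l]"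
      by (simp_all add: ws)
    ultimately show ?thesis by (simp only: snoc sg_plus)
  qed
  ultimately have "f \<in> pforms s V"
    unfolding pforms_def mem_Collect_eq mforms_slot using nil by blast
  then show ?thesis unfolding f_def F_def G_def .
qed

lemma coder_ext_mon:
  assumes "graded_space s V" and "sym_map s V d Q"
  shows "coder_ext s V d Q (mon s V (xs @ [y])) =
    unshuffle V (\<lambda>I J. sg (d * ldeg V I) (mon s V (I @ [Q (J @ [y])]))) xs
    + unshuffle1 V (\<lambda>I x J. sg (deg V x * ldeg V J + d * ldeg V I) (mon s V (I @ [Q (J @ [x]), y]))) xs"
proof
  fix g
  have h: "(unshuffle V F zs) g = unshuffle V (\<lambda>I J. F I J g) zs" for F :: "'b list \<Rightarrow> 'b list \<Rightarrow> ('b, 'a) pelem" and zs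
    using unshuffle_hom[of "\<lambda>t. t g" V F zs] by (simp add: sg_fun)
  show "coder_ext s V d Q (mon s V (xs @ [y])) g =
    (unshuffle V (\<lambda>I J. sg (d * ldeg V I) (mon s V (I @ [Q (J @ [y])]))) xs
    + unshuffle1 V (\<lambda>I x J. sg (deg V x * ldeg V J + d * ldeg V I) (mon s V (I @ [Q (J @ [x]), y]))) xs) g"
  proof (cases "g \<in> pforms s V")
    case True
    then show ?thesis
      unfolding plus_fun_apply unshuffle1_def h if_distrib[of "\<lambda>t. t g"] sg_fun
      using coder_ext_transpose_pform[OF assms True] mon_in_P[of s V "xs @ [y]"]
      by (simp add: coder_ext_def ptrans_def mon_def[of s V] unshuffle1_def cong: if_cong)
  next
    case False
    then show ?thesis
      unfolding plus_fun_apply unshuffle1_def h if_distrib[of "\<lambda>t. t g"] sg_fun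
      using mon_in_P[of s V "xs @ [y]"]
      by (simp add: coder_ext_def ptrans_def mon_def[of s V] cong: if_cong)
  qed
qed

lemma sym_map_prelie_map:
  fixes s :: "'k::field_char_0 \<Rightarrow> 'v::ab_group_add \<Rightarrow> 'v"
  assumes V: "graded_space s V" and q: "quadratic_prelie s V b q"
  shows "sym_map s V 1 (prelie_map V q)"
proof -
  interpret vector_space s using V by (simp add: graded_space_def)
  have z: "0 \<in> V n" for n using V subspace_0 by (auto simp: graded_space_def)
  have cl: "x + y \<in> V n" "s c x \<in> V n" if "x \<in> V n" "y \<in> V n" for n x y c
    using that V subspace_add subspace_scale by (auto simp: graded_space_def)
  have sgV: "sg k x \<in> V n" if "x \<in> V n" for n x k
    using that V subspace_neg by (auto simp: graded_space_def sg_def)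
  have l: "Vector_Spaces.linear s s (q x)" "Vector_Spaces.linear s s (\<lambda>x. q x y)" for x y
    using q unfolding quadratic_prelie_def bilin_def by auto
  note mh = Vector_Spaces.linear.axioms(3)[OF l(1)] Vector_Spaces.linear.axioms(3)[OF l(2)]
  have qa: "q x (y + y') = q x y + q x y'" "q (x + x') y = q x y + q x' y"
    "q x (s c y) = s c (q x y)" "q (s c x) y = s c (q x y)" "q 0 y = 0" "q x 0 = 0" for x x' y y' c
    by (rule module_hom.add[OF mh(1)] module_hom.add[OF mh(2)] module_hom.scale[OF mh(1)]
        module_hom.scale[OF mh(2)] module_hom.zero[OF mh(1)] module_hom.zero[OF mh(2)])+
  have ss: "s c (sg n x) = sg n (s c x)" for c n x
    by (simp add: sg_def)
  have qV: "q x y \<in> V (m + n)" if "x \<in> V m" "y \<in> V n" for x y m n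
    using q that unfolding quadratic_prelie_def by blast
  have pm: "prelie_map V q [x, y] = sg (deg V x) (q x y)" if "homog V x" "homog V y" for x y
    using that by (simp add: prelie_map_def)
  have pm0: "prelie_map V q zs = 0" if "length zs \<noteq> 2 \<or> (\<exists>z\<in>set zs. \<not> homog V z)" for zs
    using that by (auto simp: prelie_map_def)
  have sg_deg: "sg (deg V x) (q x y) = sg (n - 1) (q x y)" if "x \<in> V n" for x y n
    using deg_eq[OF V that] by (cases "x = 0") (auto simp: qa)
  have two: "\<exists>x y. zs = [x, y]" if "length zs = 2" for zs :: "'v list"
    using that by (auto simp: length_Suc_conv numeral_2_eq_2)
  have 1: "prelie_map V q zs \<in> V (ldeg V zs + 1 + 1)" if h: "\<forall>z\<in>set zs. homog V z" for zs
  proof (cases "length zs = 2")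
    case True
    then obtain x y where zs: "zs = [x, y]" using two by blast
    obtain m n where mn: "x \<in> V m" "y \<in> V n" using h unfolding zs homog_def by auto
    show ?thesis
    proof (cases "x = 0 \<or> y = 0")
      case True
      then show ?thesis using h z by (auto simp: zs pm qa)
    next
      case False
      then have "ldeg V zs + 1 + 1 = m + n" using deg_eq[OF V mn(1)] deg_eq[OF V mn(2)] by (simp add: zs)
      moreover have "sg (deg V x) (q x y) \<in> V (m + n)" by (rule sgV[OF qV[OF mn]])
      ultimately show ?thesis using h by (simp add: zs pm)
    qed
  qed (simp add: pm0 z)
  have 2: "prelie_map V q (us @ (x + y) # ws) = prelie_map V q (us @ x # ws) + prelie_map V q (us @ y # ws) \<and>
      prelie_map V q (us @ s c x # ws) = s c (prelie_map V q (us @ x # ws))"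
    if xy: "x \<in> V n" "y \<in> V n" for us x y ws n c
  proof (cases "length us + length ws = 1 \<and> (\<forall>z\<in>set (us @ ws). homog V z)")
    case True
    have h: "homog V x" "homog V y" "homog V (x + y)" "homog V (s c x)"
      using xy cl[OF xy] by (auto simp: homog_def)
    consider u where "us = []" "ws = [u]" "homog V u" | u where "us = [u]" "ws = []" "homog V u"
      using True by (cases us; cases ws) auto
    then show ?thesis
    proof cases
      case 1
      then show ?thesis
        using h by (simp add: pm sg_deg[OF xy(1)] sg_deg[OF xy(2)] sg_deg[OF cl(1)[OF xy]]
            sg_deg[OF cl(2)[OF xy]]) (simp add: qa sg_plus ss)
    next
      case 2
      then show ?thesis using h by (simp add: pm qa sg_plus ss)
    qed
  next
    case False
    then have "prelie_map V q (us @ v # ws) = 0" for v by (intro pm0) auto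
    then show ?thesis by simp
  qed
  have 3: "prelie_map V q (us @ x # y # ws) = sg (deg V x * deg V y) (prelie_map V q (us @ y # x # ws))"
    if "ws \<noteq> []" for us x y ws
    using that by (simp add: pm0)
  show ?thesis
    unfolding sym_map_def using 1 2 3 pm0 by blast
qed

end

theory Submission
  imports Defs
begin

text \<open>
  A coderivation of \<open>P\<close> is determined by its component \<open>P \<longrightarrow> V[1]\<close>: the kernel of the coproduct is
  \<open>P\<^sup>0\<close>, because in characteristic 0 multiplying the two tensor factors of \<open>\<Delta> p\<close> back together gives
  a nonzero multiple of \<open>p\<close> in positive arity. Pairing the component with a further variable by
  \<open>B\<close> therefore identifies \<open>B\<close>-quadratic coderivations of degree \<open>n\<close> with bi-symmetric forms of degree
  \<open>n + 2\<close>. Contracting with dual bases composes components, whence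
  \<open>{\<Omega>(D), \<Omega>(D')} = 2 \<Omega>([D, D'])\<close>, the factor 2 coming from the two equal terms of \<open>\<Omega>(D)\<close>. All claims about \<open>d\<close>
  reduce to the graded Jacobi identity for commutators.
\<close>

section \<open>Iterated unshuffles\<close>

text \<open>The Jacobi identity of the bracket is never verified on forms: \<open>Omega\<close> is
  onto, so d^2 = 0 is inherited from Q Q = 0. The bracket of two values of \<open>Omega\<close> at
  x_1...x_k y z has four kinds of terms. In each, one form is a pairing of its component with a
  basis vector, and summing over dual bases substitutes this component into the other form; two
  kinds give D D', two give D' D. This comparison does not presuppose that the commutator is
  B-quadratic, which is read off afterwards from the symmetry of the bracket in y and z.

  Two obstacles shape the details. The degree of the zero vector is arbitrary, so signs are compared
  only where the terms they multiply are nonzero; there the degrees obey linear relations. And a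
  formal sum of forms need not be a finite sum of homogeneous ones, so the claims about
  \<open>bisym\<close> rest on a locality property: at a given list, the bracket with a homogeneous
  form sees a single homogeneous part.

  Because of the factor 2, \<open>Omega\<close> intertwines the differentials only up to a scalar;
  this rescales primitives but leaves the set of coboundaries unchanged.\<close>

definition pick ::
  "(int \<Rightarrow> 'v set) \<Rightarrow> ('v \<Rightarrow> 'v list \<Rightarrow> 'a::ab_group_add) \<Rightarrow> 'v list \<Rightarrow> 'a" where
  "pick V F = unshuffle V (\<lambda>M J. if length M = 1 then F (hd M) J else 0)"

text \<open>\<open>pick\<close> is the inner half of \<open>unshuffle1\<close>: one letter moves to
  the front with its Koszul sign. Unlike the nested sum, it obeys simple recursions at both ends of
  the list.\<close>

lemma unshuffle1_pick: "unshuffle1 V F = unshuffle V (\<lambda>I. pick V (F I))"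
  by (simp add: unshuffle1_def pick_def)

lemma ldeg_split: "mset I + mset J = mset K \<Longrightarrow> ldeg V K = ldeg V I + ldeg V J"
  using ldeg_mset[of K "I @ J" V] by simp

lemma ldeg_pick: "{#x#} + mset J = mset K \<Longrightarrow> ldeg V K = deg V x + ldeg V J"
  using ldeg_mset[of K "x # J" V] by simp

lemma pick_cong:
  assumes "\<And>x J. {#x#} + mset J = mset K \<Longrightarrow> F x J = G x J"
  shows "pick V F K = pick V G K"
  unfolding pick_def
proof (rule unshuffle_cong)
  fix M J :: "'a list" assume m: "mset M + mset J = mset K"
  show "(if length M = 1 then F (hd M) J else 0) = (if length M = 1 then G (hd M) J else 0)"
    using m assms by (auto simp: length_Suc_conv)
qed

lemma unshuffle1_cong:
  assumes "\<And>I x J. mset I + ({#x#} + mset J) = mset K \<Longrightarrow> F I x J = G I x J"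
  shows "unshuffle1 V F K = unshuffle1 V G K"
  unfolding unshuffle1_pick
proof (intro unshuffle_cong pick_cong)
  fix I L x J assume "mset I + mset L = mset K" "{#x#} + mset J = mset L"
  then show "F I x J = G I x J" by (intro assms) simp
qed

lemma pick_add: "pick V (\<lambda>x J. F x J + G x J) K = pick V F K + pick V G K"
  unfolding pick_def unshuffle_add[symmetric] by (rule unshuffle_cong) simp

lemma pick_zero [simp]: "pick V (\<lambda>x J. 0) K = 0"
  by (simp add: pick_def)

lemma pick_hom:
  assumes "\<And>a c. h (a + c) = h a + h c" "\<And>n a. h (sg n a) = sg n (h a)"
  shows "h (pick V F K) = pick V (\<lambda>x J. h (F x J)) K"
proof -
  have "h 0 = 0" using assms(1)[of 0 0] by simp
  then show ?thesis
    unfolding pick_def unshuffle_hom[of h, OF assms] by (intro unshuffle_cong) simp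
qed

lemma unshuffle1_hom:
  assumes "\<And>a c. h (a + c) = h a + h c" "\<And>n a. h (sg n a) = sg n (h a)"
  shows "h (unshuffle1 V F K) = unshuffle1 V (\<lambda>I x J. h (F I x J)) K"
  unfolding unshuffle1_pick unshuffle_hom[of h, OF assms] pick_hom[of h, OF assms] ..

lemma pick_sg: "sg n (pick V F K) = pick V (\<lambda>x J. sg n (F x J)) K"
  by (rule pick_hom) (auto simp: sg_plus sg_sg add.commute)

lemma unshuffle1_sg: "sg n (unshuffle1 V F K) = unshuffle1 V (\<lambda>I x J. sg n (F I x J)) K"
  by (rule unshuffle1_hom) (auto simp: sg_plus sg_sg add.commute)

lemma unshuffle1_add:
  "unshuffle1 V (\<lambda>I x J. F I x J + G I x J) K = unshuffle1 V F K + unshuffle1 V G K"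
  unfolding unshuffle1_pick pick_add by (rule unshuffle_add)

lemma unshuffle1_mult:
  fixes c :: "'k::field_char_0"
  shows "c * unshuffle1 V F xs = unshuffle1 V (\<lambda>I x J. c * F I x J) xs"
    "unshuffle1 V F xs * c = unshuffle1 V (\<lambda>I x J. F I x J * c) xs"
  by (rule unshuffle1_hom; simp add: algebra_simps sg_mult)+

lemma unshuffle_fun_apply: "unshuffle V F xs g = unshuffle V (\<lambda>I J. F I J g) xs"
  by (rule unshuffle_hom[of "\<lambda>t. t g"]) (simp_all add: sg_fun)

lemma unshuffle1_fun_apply: "unshuffle1 V F xs g = unshuffle1 V (\<lambda>I x J. F I x J g) xs"
  by (rule unshuffle1_hom[of "\<lambda>t. t g"]) (simp_all add: sg_fun)

text \<open>Both sides are the unshuffle into three blocks whose first block is a single letter,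
  grouped in the two ways that \<open>unshuffle_assoc\<close> identifies.\<close>

lemma unshuffle_pick:
  "unshuffle V (\<lambda>K J. pick V (\<lambda>a B. F a B J) K) R = pick V (\<lambda>a S. unshuffle V (F a) S) R"
proof -
  have "pick V (\<lambda>a S. unshuffle V (F a) S) R =
      unshuffle V (\<lambda>M S. unshuffle V (\<lambda>B J. if length M = 1 then F (hd M) B J else 0) S) R"
    unfolding pick_def by (rule unshuffle_cong) simp
  then show ?thesis unfolding pick_def unshuffle_assoc by simp
qed

text \<open>The defining recursion reads the list from the left, whereas \<open>coder_ext\<close>
  appends the value of \<open>Q\<close> at the right end. To join I the last letter has to cross J,
  whence the sign.\<close>

lemma unshuffle_snoc:
  "unshuffle V F (xs @ [v]) = unshuffle V (\<lambda>I J. sg (deg V v * ldeg V J) (F (I @ [v]) J)) xs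
     + unshuffle V (\<lambda>I J. F I (J @ [v])) xs"
proof (induct xs arbitrary: F)
  case (Cons x xs)
  show ?case
    by (simp add: Cons.hyps sg_sg algebra_simps)
qed simp

lemma pick_Nil [simp]: "pick V F [] = 0"
  by (simp add: pick_def)

lemma pick_Cons:
  "pick V F (x # xs) = F x xs + pick V (\<lambda>y J. sg (deg V x * deg V y) (F y (x # J))) xs"
proof -
  have "unshuffle V (\<lambda>I J. if length (x # I) = 1 then F (hd (x # I)) J else 0) xs = F x xs"
    by (subst unshuffle_Nil_left[of V "F x" xs, symmetric], rule unshuffle_cong) auto
  moreover have "unshuffle V (\<lambda>I J. sg (deg V x * ldeg V I) (if length I = 1 then F (hd I) (x # J) else 0)) xs
     = pick V (\<lambda>y J. sg (deg V x * deg V y) (F y (x # J))) xs"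
    unfolding pick_def by (rule unshuffle_cong) (auto simp: length_Suc_conv)
  ultimately show ?thesis by (simp add: pick_def)
qed

lemma pick_snoc:
  "pick V F (xs @ [v]) = pick V (\<lambda>a B. F a (B @ [v])) xs + sg (deg V v * ldeg V xs) (F v xs)"
proof (induct xs arbitrary: F)
  case (Cons x xs)
  show ?case by (simp add: Cons.hyps pick_Cons sg_sg algebra_simps)
qed (simp add: pick_Cons)

text \<open>The last letter may join the first block, become the distinguished letter, or stay in
  the last block; each sign records the letters that it crosses. This is how a value of
  \<open>Q\<close> at the end of a monomial is distributed by the coproduct.\<close>

lemma unshuffle1_snoc:
  "unshuffle1 V F (xs @ [v]) =
     unshuffle1 V (\<lambda>A a B. sg (deg V v * (deg V a + ldeg V B)) (F (A @ [v]) a B)) xs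
     + unshuffle V (\<lambda>A B. sg (deg V v * ldeg V B) (F A v B)) xs
     + unshuffle1 V (\<lambda>A a B. F A a (B @ [v])) xs"
proof -
  have "unshuffle V (\<lambda>I J. sg (deg V v * ldeg V J) (pick V (F (I @ [v])) J)) xs
      = unshuffle1 V (\<lambda>A a B. sg (deg V v * (deg V a + ldeg V B)) (F (A @ [v]) a B)) xs"
    unfolding unshuffle1_pick pick_sg
    by (intro unshuffle_cong pick_cong) (simp add: ldeg_pick)
  then show ?thesis
    by (simp add: unshuffle1_pick unshuffle_snoc pick_snoc unshuffle_add add_ac)
qed

text \<open>All three pairs among the blocks I, x, J cross when their order is reversed. The
  reversal is done by two exchanges of neighbours, I past xJ and then x past J.\<close>

lemma unshuffle1_rev:
  "unshuffle1 V F K = unshuffle1 V (\<lambda>I x J.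
     sg (ldeg V I * ldeg V J + deg V x * ldeg V I + deg V x * ldeg V J) (F J x I)) K"
proof -
  have "unshuffle1 V F K = unshuffle V (\<lambda>L I. sg (ldeg V I * ldeg V L) (pick V (F I) L)) K"
    unfolding unshuffle1_pick
    using unshuffle_comm[of V "\<lambda>L I. pick V (F I) L" K] by (simp add: mult.commute)
  also have "\<dots> = unshuffle V (\<lambda>L I. pick V (\<lambda>x J. sg (ldeg V I * (deg V x + ldeg V J)) (F I x J)) L) K"
    unfolding pick_sg by (intro unshuffle_cong pick_cong) (simp add: ldeg_pick)
  also have "\<dots> = pick V (\<lambda>x S. unshuffle V (\<lambda>J I. sg (ldeg V I * (deg V x + ldeg V J)) (F I x J)) S) K"
    by (rule unshuffle_pick)
  also have "\<dots> = unshuffle V (\<lambda>M S. unshuffle V (\<lambda>J I. if length M = 1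
      then sg (ldeg V I * (deg V (hd M) + ldeg V J)) (F I (hd M) J) else 0) S) K"
    unfolding pick_def by (rule unshuffle_cong) simp
  also have "\<dots> = unshuffle V (\<lambda>L I. unshuffle V (\<lambda>M J. if length M = 1
      then sg (ldeg V I * (deg V (hd M) + ldeg V J)) (F I (hd M) J) else 0) L) K"
    by (rule unshuffle_assoc)
  also have "\<dots> = unshuffle V (\<lambda>L I. unshuffle V (\<lambda>J M. sg (ldeg V J * ldeg V M) (if length M = 1
      then sg (ldeg V I * (deg V (hd M) + ldeg V J)) (F I (hd M) J) else 0)) L) K"
    unfolding unshuffle_comm[symmetric] using unshuffle_comm by simp
  also have "\<dots> = unshuffle V (\<lambda>J L. unshuffle V (\<lambda>M I. sg (ldeg V J * ldeg V M) (if length M = 1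
      then sg (ldeg V I * (deg V (hd M) + ldeg V J)) (F I (hd M) J) else 0)) L) K"
    by (rule unshuffle_assoc[symmetric])
  also have "\<dots> = unshuffle1 V (\<lambda>I x J.
     sg (ldeg V I * ldeg V J + deg V x * ldeg V I + deg V x * ldeg V J) (F J x I)) K"
    unfolding unshuffle1_def
  proof (intro unshuffle_cong)
    fix J L M I
    show "sg (ldeg V J * ldeg V M) (if length M = 1
        then sg (ldeg V I * (deg V (hd M) + ldeg V J)) (F I (hd M) J) else 0) = (if length M = 1 then
        sg (ldeg V J * ldeg V I + deg V (hd M) * ldeg V J + deg V (hd M) * ldeg V I) (F I (hd M) J) else 0)"
      by (auto simp: length_Suc_conv sg_sg algebra_simps)
  qed
  finally show ?thesis .
qed

text \<open>Coderivations, and bilinear forms on P, are additive on \<open>P_space\<close> only, so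
  \<open>unshuffle_hom\<close> does not apply to them. Membership in \<open>S\<close> is proved
  together with the identity because every step of the recursion adds two partial sums.\<close>

lemma unshuffle_hom_on:
  assumes h: "\<And>a c. a \<in> S \<Longrightarrow> c \<in> S \<Longrightarrow> h (a + c) = h a + h c"
      "\<And>a n. a \<in> S \<Longrightarrow> h (sg n a) = sg n (h a)"
    and S: "\<And>a c. a \<in> S \<Longrightarrow> c \<in> S \<Longrightarrow> a + c \<in> S" "\<And>a n. a \<in> S \<Longrightarrow> sg n a \<in> S"
    and F: "\<And>I J. mset I + mset J = mset xs \<Longrightarrow> F I J \<in> S"
  shows "h (unshuffle V F xs) = unshuffle V (\<lambda>I J. h (F I J)) xs \<and> unshuffle V F xs \<in> S"
  using F
proof (induct xs arbitrary: F)
  case (Cons x xs)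
  have 1: "h (unshuffle V (\<lambda>I J. F (x # I) J) xs) = unshuffle V (\<lambda>I J. h (F (x # I) J)) xs
      \<and> unshuffle V (\<lambda>I J. F (x # I) J) xs \<in> S"
    by (rule Cons.hyps) (simp add: Cons.prems)
  let ?G = "\<lambda>I J. sg (deg V x * ldeg V I) (F I (x # J))"
  have 2: "h (unshuffle V ?G xs) = unshuffle V (\<lambda>I J. h (?G I J)) xs \<and> unshuffle V ?G xs \<in> S"
    by (rule Cons.hyps) (simp add: Cons.prems S)
  moreover have "unshuffle V (\<lambda>I J. h (?G I J)) xs
      = unshuffle V (\<lambda>I J. sg (deg V x * ldeg V I) (h (F I (x # J)))) xs"
    by (rule unshuffle_cong) (simp add: Cons.prems h)
  ultimately show ?case using 1 by (simp add: h S)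
qed simp

lemma unshuffle1_hom_on:
  assumes h: "\<And>a c. a \<in> S \<Longrightarrow> c \<in> S \<Longrightarrow> h (a + c) = h a + h c"
      "\<And>a n. a \<in> S \<Longrightarrow> h (sg n a) = sg n (h a)"
    and S: "\<And>a c. a \<in> S \<Longrightarrow> c \<in> S \<Longrightarrow> a + c \<in> S" "\<And>a n. a \<in> S \<Longrightarrow> sg n a \<in> S" "0 \<in> S"
    and F: "\<And>I x J. mset I + ({#x#} + mset J) = mset xs \<Longrightarrow> F I x J \<in> S"
  shows "h (unshuffle1 V F xs) = unshuffle1 V (\<lambda>I x J. h (F I x J)) xs \<and> unshuffle1 V F xs \<in> S"
proof -
  have h0: "h 0 = 0" using h(1)[OF S(3) S(3)] by simp
  have p: "h (pick V (F I) K) = pick V (\<lambda>x J. h (F I x J)) K \<and> pick V (F I) K \<in> S"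
    if m: "mset I + mset K = mset xs" for I K
  proof -
    have "(if length M = 1 then F I (hd M) J else 0) \<in> S" if "mset M + mset J = mset K" for M J
    proof (cases "length M = 1")
      case True
      then obtain x where "M = [x]" by (auto simp: length_Suc_conv)
      then show ?thesis using m that F[of I x J] by auto
    qed (use S in simp)
    then have "h (unshuffle V (\<lambda>M J. if length M = 1 then F I (hd M) J else 0) K)
        = unshuffle V (\<lambda>M J. h (if length M = 1 then F I (hd M) J else 0)) K
        \<and> unshuffle V (\<lambda>M J. if length M = 1 then F I (hd M) J else 0) K \<in> S"
      by (intro unshuffle_hom_on[of S h, OF h S(1,2)]) auto
    then show ?thesis
      unfolding pick_def if_distrib[of h] h0 .
  qed
  then have "h (unshuffle V (\<lambda>I. pick V (F I)) xs) = unshuffle V (\<lambda>I J. h (pick V (F I) J)) xs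
      \<and> unshuffle V (\<lambda>I. pick V (F I)) xs \<in> S"
    by (intro unshuffle_hom_on[of S h, OF h S(1,2)]) auto
  moreover have "unshuffle V (\<lambda>I J. h (pick V (F I) J)) xs
      = unshuffle V (\<lambda>I J. pick V (\<lambda>x J. h (F I x J)) J) xs"
    by (rule unshuffle_cong) (simp add: p)
  ultimately show ?thesis by (simp add: unshuffle1_pick)
qed

section \<open>Linear algebra on P\<close>

text \<open>As rewrite rules these eta-expand sums and zeros of operators applied to elements of \<open>P\<close>.\<close>

declare plus_fun_apply [simp del] zero_fun_apply [simp del]

locale graded =
  fixes s :: "'k::field_char_0 \<Rightarrow> 'v::ab_group_add \<Rightarrow> 'v" and V :: "int \<Rightarrow> 'v set"
  assumes V: "graded_space s V"
begin

sublocale vs: vector_space s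
  using V by (simp add: graded_space_def)

lemma V_closed:
  "0 \<in> V n" "x \<in> V n \<Longrightarrow> y \<in> V n \<Longrightarrow> x + y \<in> V n" "x \<in> V n \<Longrightarrow> s c x \<in> V n"
  "x \<in> V n \<Longrightarrow> - x \<in> V n" "x \<in> V n \<Longrightarrow> sg k x \<in> V n"
  using V vs.subspace_0 vs.subspace_add vs.subspace_scale vs.subspace_neg
  by (auto simp: graded_space_def sg_def)

lemma homog_0 [simp]: "homog V 0"
  using V_closed(1) by (auto simp: homog_def)

lemma mforms_zero_arg:
  assumes "f \<in> mforms s V" "0 \<in> set zs"
  shows "f zs = 0"
proof -
  obtain us ws where zs: "zs = us @ 0 # ws" using assms(2) by (metis split_list)
  have "slot_linear s V (\<lambda>x. f (us @ x # ws))" using assms(1) by (simp add: mforms_slot)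
  from slot_linear_0[OF V this] show ?thesis by (simp add: zs)
qed

lemma mon_zero_arg: "0 \<in> set zs \<Longrightarrow> mon s V zs = 0"
  by (rule ext) (simp add: mon_def pforms_def mforms_zero_arg zero_fun_apply)

lemma mon_Nil [simp]: "mon s V [] = 0"
  by (auto simp: mon_def pforms_def fun_eq_iff zero_fun_apply)

lemma subspace_P: "module.subspace fscale (P_space s V)"
  unfolding P_space_def by (rule module.subspace_span[OF module_fscale])

lemma subspace_P_deg: "module.subspace fscale (P_deg s V n)"
  unfolding P_deg_def by (rule module.subspace_span[OF module_fscale])

lemma fscale_zero: "fscale 0 p = 0" and fscale_minus: "fscale (- 1) p = - p"
  and fscale_sg: "fscale c (sg n p) = sg n (fscale c p)" and fscale_0 [simp]: "fscale c 0 = 0"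
  and fscale_add: "fscale c (p + q) = fscale c p + fscale c q"
  by (auto simp: fscale_def sg_def fun_eq_iff distrib_left plus_fun_apply zero_fun_apply)

lemma subspace_fscale:
  assumes "module.subspace fscale S"
  shows "0 \<in> S" "p \<in> S \<Longrightarrow> q \<in> S \<Longrightarrow> p + q \<in> S" "p \<in> S \<Longrightarrow> fscale c p \<in> S"
    "p \<in> S \<Longrightarrow> - p \<in> S" "p \<in> S \<Longrightarrow> q \<in> S \<Longrightarrow> p - q \<in> S" "p \<in> S \<Longrightarrow> sg n p \<in> S"
  using module.subspace_0[OF module_fscale assms] module.subspace_add[OF module_fscale assms]
    module.subspace_scale[OF module_fscale assms] module.subspace_neg[OF module_fscale assms]
    module.subspace_diff[OF module_fscale assms]
  by (auto simp: sg_def)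

lemmas P_closed = subspace_fscale[OF subspace_P]
lemmas P_deg_closed = subspace_fscale[OF subspace_P_deg]

lemma mon_in_P_deg: "ldeg V zs = n \<Longrightarrow> mon s V zs \<in> P_deg s V n"
  unfolding P_deg_def by (rule module.span_base[OF module_fscale]) auto

lemma P_deg_subset: "p \<in> P_deg s V n \<Longrightarrow> p \<in> P_space s V"
  unfolding P_deg_def P_space_def
  using module.span_mono[OF module_fscale, of "{mon s V zs | zs. ldeg V zs = n}" "range (mon s V)"] by auto

text \<open>The generator of the empty list is 0, hence 0 times any other generator, so it suffices
  to treat monomials with a last letter.\<close>

lemma P_induct [consumes 1, case_names mon add scale]:
  assumes p: "p \<in> P_space s V"
    and mon: "\<And>xs y. \<Phi> (mon s V (xs @ [y]))"
    and add: "\<And>p q. p \<in> P_space s V \<Longrightarrow> q \<in> P_space s V \<Longrightarrow> \<Phi> p \<Longrightarrow> \<Phi> q \<Longrightarrow> \<Phi> (p + q)"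
    and scale: "\<And>c p. p \<in> P_space s V \<Longrightarrow> \<Phi> p \<Longrightarrow> \<Phi> (fscale c p)"
  shows "\<Phi> p"
proof -
  have 0: "\<Phi> 0" using scale[OF mon_in_P mon, of 0] by (simp add: fscale_zero)
  have "p \<in> P_space s V \<and> \<Phi> p"
    using p[unfolded P_space_def]
  proof (rule module.span_induct[OF module_fscale])
    show "module.subspace fscale {p. p \<in> P_space s V \<and> \<Phi> p}"
      using 0 add scale P_closed by (auto simp: module.subspace_def[OF module_fscale])
    fix x assume "x \<in> range (mon s V)"
    then obtain zs where "x = mon s V zs" by auto
    then show "x \<in> P_space s V \<and> \<Phi> x"
      using mon mon_in_P[of s V zs] 0 by (cases zs rule: rev_cases) auto
  qed
  then show ?thesis ..
qed

lemma P_deg_induct [consumes 1, case_names mon zero add scale]: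
  assumes p: "p \<in> P_deg s V n"
    and mon: "\<And>xs y. ldeg V (xs @ [y]) = n \<Longrightarrow> \<Phi> (mon s V (xs @ [y]))" and 0: "\<Phi> 0"
    and add: "\<And>p q. p \<in> P_deg s V n \<Longrightarrow> q \<in> P_deg s V n \<Longrightarrow> \<Phi> p \<Longrightarrow> \<Phi> q \<Longrightarrow> \<Phi> (p + q)"
    and scale: "\<And>c p. p \<in> P_deg s V n \<Longrightarrow> \<Phi> p \<Longrightarrow> \<Phi> (fscale c p)"
  shows "\<Phi> p"
proof -
  have "p \<in> P_deg s V n \<and> \<Phi> p"
    using p[unfolded P_deg_def]
  proof (rule module.span_induct[OF module_fscale])
    show "module.subspace fscale {p. p \<in> P_deg s V n \<and> \<Phi> p}"
      using 0 add scale P_deg_closed by (auto simp: module.subspace_def[OF module_fscale])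
    fix x assume "x \<in> {mon s V zs | zs. ldeg V zs = n}"
    then obtain zs where "x = mon s V zs" "ldeg V zs = n" by auto
    then show "x \<in> P_deg s V n \<and> \<Phi> x"
      using mon mon_in_P_deg[of zs n] 0 by (cases zs rule: rev_cases) auto
  qed
  then show ?thesis ..
qed

lemma pformsI:
  assumes "f [] = 0" "\<And>zs. \<exists>z\<in>set zs. \<not> homog V z \<Longrightarrow> f zs = 0"
    and "\<And>us ws. slot_linear s V (\<lambda>x. f (us @ x # ws))"
    and "\<And>us x y ws. ws \<noteq> [] \<Longrightarrow> f (us @ x # y # ws) = sg (deg V x * deg V y) (f (us @ y # x # ws))"
  shows "f \<in> pforms s V"
  unfolding pforms_def mem_Collect_eq mforms_slot using assms by blast

lemma pformsD:
  assumes "f \<in> pforms s V"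
  shows "f [] = 0" "\<exists>z\<in>set zs. \<not> homog V z \<Longrightarrow> f zs = 0"
    and "slot_linear s V (\<lambda>x. f (us @ x # ws))"
    and "ws \<noteq> [] \<Longrightarrow> f (us @ x # y # ws) = sg (deg V x * deg V y) (f (us @ y # x # ws))"
  using assms unfolding pforms_def mem_Collect_eq mforms_slot by blast+

lemma slot_linear_mult: "slot_linear s V h \<Longrightarrow> slot_linear s V (\<lambda>x. c * h x)"
  unfolding slot_linear_def by (simp add: distrib_left)

lemma pforms_add:
  assumes "f \<in> pforms s V" "g \<in> pforms s V"
  shows "(\<lambda>zs. f zs + g zs) \<in> pforms s V"
proof (rule pformsI)
  fix us ws :: "'v list" and x y assume "ws \<noteq> []"
  then show "f (us @ x # y # ws) + g (us @ x # y # ws)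
      = sg (deg V x * deg V y) (f (us @ y # x # ws) + g (us @ y # x # ws))"
    unfolding sg_plus by (intro arg_cong2[where f = "(+)"] pformsD(4) assms)
qed (intro slot_linear_add pformsD(3) assms | simp add: pformsD(1,2)[OF assms(1)] pformsD(1,2)[OF assms(2)])+

text \<open>A scalar depending on the arity alone disturbs neither multilinearity nor symmetry. This
  covers the projection to one arity as well as the division by the number of terms of a
  coproduct.\<close>

lemma pforms_weight:
  assumes "f \<in> pforms s V"
  shows "(\<lambda>zs. w (length zs) * f zs) \<in> pforms s V"
proof (rule pformsI)
  fix us ws :: "'v list" and x y assume "ws \<noteq> []"
  then show "w (length (us @ x # y # ws)) * f (us @ x # y # ws)
      = sg (deg V x * deg V y) (w (length (us @ y # x # ws)) * f (us @ y # x # ws))"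
    using pformsD(4)[OF assms, of ws us x y] by (simp add: sg_mult)
next
  fix us ws :: "'v list"
  show "slot_linear s V (\<lambda>x. w (length (us @ x # ws)) * f (us @ x # ws))"
    using slot_linear_mult[OF pformsD(3)[OF assms]] by simp
qed (simp_all add: pformsD(1,2)[OF assms])

lemma P_apply:
  assumes p: "p \<in> P_space s V" and f: "f \<in> pforms s V" "g \<in> pforms s V"
  shows "p (\<lambda>zs. f zs + g zs) = p f + p g" "p (\<lambda>zs. c * f zs) = c * p f"
proof -
  have m: "(\<lambda>zs. f zs + g zs) \<in> pforms s V" "(\<lambda>zs. c * f zs) \<in> pforms s V"
    using pforms_add[OF f] pforms_weight[OF f(1), of "\<lambda>_. c"] by auto
  show "p (\<lambda>zs. f zs + g zs) = p f + p g"
    using p by (induct p rule: P_induct) (simp_all add: mon_def m f fscale_def plus_fun_apply distrib_left add_ac)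
  show "p (\<lambda>zs. c * f zs) = c * p f"
    using p by (induct p rule: P_induct) (simp_all add: mon_def m f fscale_def plus_fun_apply distrib_left mult_ac)
qed

text \<open>A coderivation is set to 0 outside \<open>P_space\<close> and is therefore not linear on
  all functionals; linearity is demanded on \<open>P_space\<close> only.\<close>

definition P_end :: "(('v, 'k) pelem \<Rightarrow> ('v, 'k) pelem) \<Rightarrow> bool" where
  "P_end F \<longleftrightarrow> (\<forall>p\<in>P_space s V. \<forall>q\<in>P_space s V. \<forall>c.
     F p \<in> P_space s V \<and> F (p + q) = F p + F q \<and> F (fscale c p) = fscale c (F p))"

lemma P_endD:
  assumes "P_end F" "p \<in> P_space s V" 
  shows "F p \<in> P_space s V" "q \<in> P_space s V \<Longrightarrow> F (p + q) = F p + F q" "F (fscale c p) = fscale c (F p)"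
    "F (sg n p) = sg n (F p)" "F 0 = 0" "q \<in> P_space s V \<Longrightarrow> F (p - q) = F p - F q"
proof -
  show 1: "F p \<in> P_space s V" "q \<in> P_space s V \<Longrightarrow> F (p + q) = F p + F q"
    and 2: "F (fscale c p) = fscale c (F p)" for q c
    using assms unfolding P_end_def by blast+
  show "F 0 = 0" using 2[of 0] by (simp add: fscale_zero)
  have m: "F (- q) = - F q" if "q \<in> P_space s V" for q
    using assms(1) that fscale_minus unfolding P_end_def by metis
  then show "F (sg n p) = sg n (F p)" using assms(2) by (simp add: sg_def)
  assume q: "q \<in> P_space s V"
  then have "F (p + - q) = F p + F (- q)"
    using assms P_closed(4) unfolding P_end_def by blast
  then show "F (p - q) = F p - F q" using m[OF q] by simp
qed

lemma P_end_id: "P_end id"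
  by (simp add: P_end_def)

lemma P_end_comp: "P_end F \<Longrightarrow> P_end G \<Longrightarrow> P_end (F \<circ> G)"
  by (simp add: P_end_def)

lemma P_end_unshuffle:
  assumes F: "P_end F" and p: "\<And>I J. mset I + mset J = mset xs \<Longrightarrow> p I J \<in> P_space s V"
  shows "F (unshuffle V p xs) = unshuffle V (\<lambda>I J. F (p I J)) xs"
  using unshuffle_hom_on[of "P_space s V" F xs p V] P_endD[OF F] p P_closed by auto

lemma P_end_unshuffle1:
  assumes F: "P_end F" and p: "\<And>I x J. mset I + ({#x#} + mset J) = mset xs \<Longrightarrow> p I x J \<in> P_space s V"
  shows "F (unshuffle1 V p xs) = unshuffle1 V (\<lambda>I x J. F (p I x J)) xs"
  using unshuffle1_hom_on[of "P_space s V" F xs p V] P_endD[OF F] p P_closed by auto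

lemma unshuffle_closed:
  assumes "module.subspace fscale S" "\<And>I J. mset I + mset J = mset xs \<Longrightarrow> p I J \<in> S"
  shows "unshuffle V p xs \<in> S"
  using unshuffle_hom_on[of S id xs p V] subspace_fscale[OF assms(1)] assms(2) by auto

lemma unshuffle1_closed:
  assumes "module.subspace fscale S" "\<And>I x J. mset I + ({#x#} + mset J) = mset xs \<Longrightarrow> p I x J \<in> S"
  shows "unshuffle1 V p xs \<in> S"
  using unshuffle1_hom_on[of S id xs p V] subspace_fscale[OF assms(1)] assms(2) by auto

lemma ptrans_add: "ptrans s V T (p + q) = ptrans s V T p + ptrans s V T q"
  and ptrans_scale: "ptrans s V T (fscale c p) = fscale c (ptrans s V T p)"
  by (auto simp: ptrans_def fscale_def plus_fun_apply zero_fun_apply)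

lemma ptrans_mon:
  assumes "\<And>f. f \<in> pforms s V \<Longrightarrow> T f \<in> pforms s V"
  shows "ptrans s V T (mon s V zs) f = (if f \<in> pforms s V then T f zs else 0)"
  using assms by (simp add: ptrans_def mon_def)

lemma P_proj0_mon: "P_proj0 s V (mon s V zs) = (if length zs = 1 then mon s V zs else 0)"
proof -
  have "(\<lambda>zs. if length zs = 1 then f zs else 0) \<in> pforms s V" if "f \<in> pforms s V" for f
    using pforms_weight[OF that, of "\<lambda>n. if n = 1 then 1 else 0"]
    by (simp add: if_distrib[of "\<lambda>c. c * _"] cong: if_cong)
  from ptrans_mon[OF this, of "\<lambda>f. f"] show ?thesis
    unfolding P_proj0_def by (intro ext) (auto simp: mon_def zero_fun_apply)
qed

lemma P_proj0_add: "P_proj0 s V (p + q) = P_proj0 s V p + P_proj0 s V q"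
  and P_proj0_scale: "P_proj0 s V (fscale c p) = fscale c (P_proj0 s V p)"
  by (simp_all add: P_proj0_def ptrans_add ptrans_scale)

lemma P_end_proj0: "P_end (P_proj0 s V)"
proof -
  have "P_proj0 s V p \<in> P_space s V" if "p \<in> P_space s V" for p
    using that by (induct rule: P_induct)
      (auto simp: P_proj0_mon P_proj0_add P_proj0_scale P_closed mon_in_P simp del: One_nat_def)
  then show ?thesis by (simp add: P_end_def P_proj0_add P_proj0_scale)
qed

text \<open>The operator p -> (-1)^(n deg p) p that acts on the first factor in the second term of
  the coderivation identity.\<close>

definition par :: "int \<Rightarrow> ('v, 'k) pelem \<Rightarrow> ('v, 'k) pelem" where
  "par n = (if even n then id else P_parity s V)"

lemma P_parity_mon: "P_parity s V (mon s V zs) = sg (ldeg V zs) (mon s V zs)"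
proof -
  have T: "(\<lambda>zs. sg (ldeg V zs) (f zs)) \<in> pforms s V" if f: "f \<in> pforms s V" for f
  proof -
    from slot_linear_sg[OF V pformsD(3)[OF f], of "\<lambda>n. ldeg V us + (n + ldeg V ws)" for us ws]
    have 1: "slot_linear s V (\<lambda>x. sg (ldeg V (us @ x # ws)) (f (us @ x # ws)))" for us ws by simp
    have 2: "sg (ldeg V (us @ x # y # ws)) (f (us @ x # y # ws))
        = sg (deg V x * deg V y) (sg (ldeg V (us @ y # x # ws)) (f (us @ y # x # ws)))"
      if "ws \<noteq> []" for us x y ws
    proof -
      have "f (us @ x # y # ws) = sg (deg V x * deg V y) (f (us @ y # x # ws))"
        by (rule pformsD(4)[OF f that])
      then show ?thesis by (simp add: sg_sg algebra_simps)
    qed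
    show ?thesis
      by (rule pformsI[OF _ _ 1 2]) (simp_all add: pformsD(1,2)[OF f])
  qed
  show ?thesis
    unfolding P_parity_def using ptrans_mon[OF T] by (intro ext) (auto simp: mon_def sg_fun)
qed

lemma P_parity_add: "P_parity s V (p + q) = P_parity s V p + P_parity s V q"
  and P_parity_scale: "P_parity s V (fscale c p) = fscale c (P_parity s V p)"
  by (simp_all add: P_parity_def ptrans_add ptrans_scale)

lemma P_end_par: "P_end (par n)"
proof -
  have "P_parity s V p \<in> P_space s V" if "p \<in> P_space s V" for p
    using that by (induct rule: P_induct) (auto simp: P_parity_mon P_parity_add P_parity_scale P_closed mon_in_P)
  then have "P_end (P_parity s V)" by (simp add: P_end_def P_parity_add P_parity_scale)
  then show ?thesis using P_end_id by (simp add: par_def)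
qed

lemma par_deg:
  assumes "p \<in> P_deg s V m"
  shows "par n p = sg (n * m) p"
proof -
  have 0: "P_parity s V 0 = 0" by (simp add: P_parity_def ptrans_def fun_eq_iff zero_fun_apply)
  have "P_parity s V p = sg m p"
    using assms
    by (induct rule: P_deg_induct)
      (auto simp: 0 P_parity_mon P_parity_add P_parity_scale sg_plus fscale_sg)
  then show ?thesis by (auto simp: par_def sg_def)
qed

lemma par_mon: "par n (mon s V zs) = sg (n * ldeg V zs) (mon s V zs)"
  by (rule par_deg[OF mon_in_P_deg]) simp

lemma Delta_add: "Delta s V (p + q) = Delta s V p + Delta s V q"
  and Delta_scale: "Delta s V (fscale c p) = fscale c (Delta s V p)"
  by (auto simp: Delta_def fscale_def fun_eq_iff plus_fun_apply zero_fun_apply)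

lemma PP_map_add: "PP_map s V F G (t + u) = PP_map s V F G t + PP_map s V F G u"
  and PP_map_scale: "PP_map s V F G (fscale c t) = fscale c (PP_map s V F G t)"
  by (auto simp: PP_map_def fscale_def fun_eq_iff plus_fun_apply zero_fun_apply)

lemma P_bilforms_comp:
  assumes "P_end F" "P_end G" "g \<in> P_bilforms s V"
  shows "(\<lambda>p r. g (F p) (G r)) \<in> P_bilforms s V"
  using P_endD[OF assms(1)] P_endD[OF assms(2)] P_bilforms_simps(1-4)[OF assms(3)]
  unfolding P_bilforms_def by simp

lemma PP_map_comp:
  assumes "P_end F" "P_end G"
  shows "PP_map s V F G (PP_map s V F' G' t) = PP_map s V (F \<circ> F') (G \<circ> G') t"
  using P_bilforms_comp[OF assms] by (auto simp: PP_map_def fun_eq_iff zero_fun_apply)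

lemma PP_map_Delta_mon:
  assumes "P_end F" "P_end G"
  shows "PP_map s V F G (Delta s V (mon s V (xs @ [y])))
    = unshuffle1 V (\<lambda>I x J. P_tensor s V (F (mon s V (I @ [x]))) (G (mon s V (J @ [y])))) xs"
  using P_bilforms_comp[OF assms]
  by (auto simp: fun_eq_iff PP_map_def Delta_mon[OF V] unshuffle1_fun_apply P_tensor_def unshuffle1_eq_0)

lemma P_tensor_linear:
  assumes "p \<in> P_space s V" "q \<in> P_space s V" "r \<in> P_space s V"
  shows "P_tensor s V (p + q) r = P_tensor s V p r + P_tensor s V q r"
    "P_tensor s V r (p + q) = P_tensor s V r p + P_tensor s V r q"
    "P_tensor s V (sg n p) r = sg n (P_tensor s V p r)"
    "P_tensor s V r (sg n p) = sg n (P_tensor s V r p)"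
    "P_tensor s V 0 r = 0" "P_tensor s V r 0 = 0"
    "P_tensor s V (p - q) r = P_tensor s V p r - P_tensor s V q r"
    "P_tensor s V r (p - q) = P_tensor s V r p - P_tensor s V r q"
proof -
  have "g (p - q) r = g p r - g q r" "g r (p - q) = g r p - g r q" if g: "g \<in> P_bilforms s V" for g
    using P_bilforms_simps(1,3)[OF g assms(1) P_closed(4)[OF assms(2)] assms(3)]
      P_bilforms_simps(7,8)[OF g assms(2,2,3), of 1] by (simp_all add: sg_def)
  then show "P_tensor s V (p - q) r = P_tensor s V p r - P_tensor s V q r"
    "P_tensor s V r (p - q) = P_tensor s V r p - P_tensor s V r q"
    unfolding P_tensor_def by (simp_all add: fun_eq_iff)
qed (auto simp: P_tensor_def fun_eq_iff sg_fun plus_fun_apply zero_fun_apply P_bilforms_simps[OF _ assms])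

lemma P_tensor_unshuffle:
  assumes "r \<in> P_space s V" and "\<And>I J. mset I + mset J = mset xs \<Longrightarrow> p I J \<in> P_space s V"
  shows "P_tensor s V (unshuffle V p xs) r = unshuffle V (\<lambda>I J. P_tensor s V (p I J) r) xs"
    "P_tensor s V r (unshuffle V p xs) = unshuffle V (\<lambda>I J. P_tensor s V r (p I J)) xs"
  using unshuffle_hom_on[of "P_space s V" "\<lambda>p. P_tensor s V p r" xs p V]
    unshuffle_hom_on[of "P_space s V" "P_tensor s V r" xs p V] assms
  by (auto simp: P_tensor_linear P_closed)

lemma P_tensor_unshuffle1:
  assumes "r \<in> P_space s V" and "\<And>I x J. mset I + ({#x#} + mset J) = mset xs \<Longrightarrow> p I x J \<in> P_space s V"
  shows "P_tensor s V (unshuffle1 V p xs) r = unshuffle1 V (\<lambda>I x J. P_tensor s V (p I x J) r) xs"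
    "P_tensor s V r (unshuffle1 V p xs) = unshuffle1 V (\<lambda>I x J. P_tensor s V r (p I x J)) xs"
  using unshuffle1_hom_on[of "P_space s V" "\<lambda>p. P_tensor s V p r" xs p V]
    unshuffle1_hom_on[of "P_space s V" "P_tensor s V r" xs p V] assms
  by (auto simp: P_tensor_linear P_closed)

lemma codersD:
  assumes "D \<in> coders s V n"
  shows "P_end D" "p \<notin> P_space s V \<Longrightarrow> D p = 0" "p \<in> P_deg s V m \<Longrightarrow> D p \<in> P_deg s V (m + n)"
    "p \<in> P_space s V \<Longrightarrow> Delta s V (D p) = PP_map s V D id (Delta s V p) + PP_map s V (par n) D (Delta s V p)"
  using assms unfolding coders_def P_end_def par_def by auto

lemma codersI:
  assumes D: "P_end D" and 0: "\<And>p. p \<notin> P_space s V \<Longrightarrow> D p = 0"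
    and deg: "\<And>xs y. D (mon s V (xs @ [y])) \<in> P_deg s V (ldeg V (xs @ [y]) + n)"
    and Delta: "\<And>xs y. Delta s V (D (mon s V (xs @ [y])))
      = PP_map s V D id (Delta s V (mon s V (xs @ [y])))
        + PP_map s V (par n) D (Delta s V (mon s V (xs @ [y])))"
  shows "D \<in> coders s V n"
proof -
  have "D p \<in> P_deg s V (m + n)" if "p \<in> P_deg s V m" for p m
    using that
  proof (induct rule: P_deg_induct)
    case (mon xs y)
    then show ?case using deg[of xs y] by simp
  qed (simp_all add: P_deg_subset P_deg_closed P_endD[OF D] P_endD(5)[OF D P_closed(1)])
  moreover have "Delta s V (D p) = PP_map s V D id (Delta s V p) + PP_map s V (par n) D (Delta s V p)"
    if "p \<in> P_space s V" for p
    using that by (induct rule: P_induct)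
      (simp_all add: Delta P_endD[OF D] Delta_add Delta_scale PP_map_add PP_map_scale fscale_add del: id_apply)
  ultimately show ?thesis
    using D 0 unfolding coders_def P_end_def par_def by simp
qed

end

section \<open>The kernel of the coproduct\<close>

text \<open>The sum of \<open>c (card J)\<close> over all subsets J of an n-element set, that is, of
  the binomial coefficients (n choose j) times \<open>c j\<close>. For \<open>c = id\<close> it is n
  * 2^(n-1), the number of terms in the coproduct of a monomial with n letters before the
  last.\<close>

fun unshuffle_weight :: "(nat \<Rightarrow> nat) \<Rightarrow> nat \<Rightarrow> nat" where
  "unshuffle_weight c 0 = c 0"
| "unshuffle_weight c (Suc n) = unshuffle_weight c n + unshuffle_weight (\<lambda>i. c (Suc i)) n"

text \<open>The subset consisting of everything already contributes \<open>c n\<close>. For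
  \<open>c = id\<close> this keeps the count nonzero, hence invertible in characteristic 0.\<close>

lemma unshuffle_weight_ge: "c n \<le> unshuffle_weight c n"
proof (induct n arbitrary: c)
  case (Suc n)
  show ?case using Suc[of "\<lambda>i. c (Suc i)"] by simp
qed simp

lemma symmetric_move:
  assumes "\<And>us x y ws. h (us @ x # y # ws) = sg (deg V x * deg V y) (h (us @ y # x # ws))"
  shows "h (us @ B @ x # ws) = sg (deg V x * ldeg V B) (h (us @ x # B @ ws))"
proof (induct B arbitrary: us)
  case (Cons y B)
  have "h (us @ (y # B) @ x # ws) = sg (deg V x * ldeg V B) (h (us @ y # x # B @ ws))"
    using Cons[of "us @ [y]"] by simp
  also have "h (us @ y # x # B @ ws) = sg (deg V y * deg V x) (h (us @ x # y # B @ ws))"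
    by (rule assms)
  finally show ?case by (simp add: sg_sg algebra_simps)
qed simp

text \<open>For symmetric \<open>h\<close> the Koszul sign of a splitting cancels against the sign
  of restoring the original order in \<open>I @ J\<close>, so the sum merely counts splittings. The
  weight \<open>c (length J)\<close> makes room for the choice of a further letter from J.\<close>

lemma unshuffle_symmetric:
  fixes h :: "'v list \<Rightarrow> 'k::field_char_0"
  assumes "\<And>us x y ws. h (us @ x # y # ws) = sg (deg V x * deg V y) (h (us @ y # x # ws))"
  shows "unshuffle V (\<lambda>I J. of_nat (c (length J)) * h (I @ J)) xs = of_nat (unshuffle_weight c (length xs)) * h xs"
  using assms
proof (induct xs arbitrary: h c)
  case (Cons x xs)
  have h: "h (x # us @ y # z # ws) = sg (deg V y * deg V z) (h (x # us @ z # y # ws))" for us y z ws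
    using Cons.prems[of "x # us" y z ws] by simp
  have "unshuffle V (\<lambda>I J. sg (deg V x * ldeg V I) (of_nat (c (length (x # J))) * h (I @ x # J))) xs
      = unshuffle V (\<lambda>I J. of_nat (c (Suc (length J))) * h (x # I @ J)) xs"
  proof (rule unshuffle_cong)
    fix I J
    show "sg (deg V x * ldeg V I) (of_nat (c (length (x # J))) * h (I @ x # J))
        = of_nat (c (Suc (length J))) * h (x # I @ J)"
      using symmetric_move[of h V "[]" I x J, OF Cons.prems] by (simp add: sg_mult sg_sg) (simp add: sg_def)
  qed
  then show ?case
    using Cons.hyps[of "\<lambda>zs. h (x # zs)" c, OF h] Cons.hyps[of "\<lambda>zs. h (x # zs)" "\<lambda>i. c (Suc i)", OF h]
    by (simp add: distrib_right)
next
  case Nil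
  show ?case by simp
qed

lemma pick_symmetric:
  fixes h :: "'v list \<Rightarrow> 'k::field_char_0"
  assumes "\<And>us x y ws. h (us @ x # y # ws) = sg (deg V x * deg V y) (h (us @ y # x # ws))"
  shows "pick V (\<lambda>x J. h (I @ x # J)) K = of_nat (length K) * h (I @ K)"
proof (induct K arbitrary: I)
  case (Cons x K)
  have "pick V (\<lambda>y J. sg (deg V x * deg V y) (h (I @ y # x # J))) K = pick V (\<lambda>y J. h (I @ x # y # J)) K"
    by (rule pick_cong) (rule assms[symmetric])
  then show ?case using Cons[of "I @ [x]"] by (simp add: pick_Cons distrib_right)
qed simp

lemma unshuffle1_symmetric:
  fixes h :: "'v list \<Rightarrow> 'k::field_char_0"
  assumes "\<And>us x y ws. h (us @ x # y # ws) = sg (deg V x * deg V y) (h (us @ y # x # ws))"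
  shows "unshuffle1 V (\<lambda>I x J. h (I @ x # J)) xs = of_nat (unshuffle_weight id (length xs)) * h xs"
  unfolding unshuffle1_pick pick_symmetric[of h, OF assms]
  using unshuffle_symmetric[of h V id xs, OF assms] by simp

context graded
begin

lemma P_outside: "p \<in> P_space s V \<Longrightarrow> f \<notin> pforms s V \<Longrightarrow> p f = 0"
  by (induct p rule: P_induct) (simp_all add: mon_def fscale_def plus_fun_apply)

text \<open>The transpose of gluing the tensor factors of a coproduct back together by
  concatenation. Empty lists give 0 so that the result lies in \<open>pforms\<close> in each
  variable separately.\<close>

definition concat_form :: "('v list \<Rightarrow> 'k) \<Rightarrow> 'v list \<Rightarrow> 'v list \<Rightarrow> 'k" where
  "concat_form f I J = (if I = [] \<or> J = [] then 0 else f (I @ J))"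

lemma concat_form_pforms:
  assumes f: "f \<in> pforms s V"
  shows "concat_form f I \<in> pforms s V" "(\<lambda>I. concat_form f I J) \<in> pforms s V"
proof -
  show "concat_form f I \<in> pforms s V"
  proof (rule pformsI)
    fix us ws :: "'v list"
    show "slot_linear s V (\<lambda>x. concat_form f I (us @ x # ws))"
      using pformsD(3)[OF f, of "I @ us" ws] slot_linear_zero by (cases I) (auto simp: concat_form_def)
    fix x y assume "ws \<noteq> []"
    then show "concat_form f I (us @ x # y # ws) = sg (deg V x * deg V y) (concat_form f I (us @ y # x # ws))"
      using pformsD(4)[OF f, of ws "I @ us" x y] by (simp add: concat_form_def)
  next
    fix zs :: "'v list" assume "\<exists>z\<in>set zs. \<not> homog V z"
    then show "concat_form f I zs = 0"
      using pformsD(2)[OF f, of "I @ zs"] by (auto simp: concat_form_def)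
  qed (simp add: concat_form_def)
  show "(\<lambda>I. concat_form f I J) \<in> pforms s V"
  proof (rule pformsI)
    fix us ws :: "'v list"
    show "slot_linear s V (\<lambda>x. concat_form f (us @ x # ws) J)"
      using pformsD(3)[OF f, of us "ws @ J"] slot_linear_zero by (cases J) (auto simp: concat_form_def)
    fix x y assume "ws \<noteq> []"
    then show "concat_form f (us @ x # y # ws) J = sg (deg V x * deg V y) (concat_form f (us @ y # x # ws) J)"
      using pformsD(4)[OF f, of "ws @ J" us x y] by (simp add: concat_form_def)
  next
    fix zs :: "'v list" assume "\<exists>z\<in>set zs. \<not> homog V z"
    then show "concat_form f zs J = 0"
      using pformsD(2)[OF f, of "zs @ J"] by (auto simp: concat_form_def)
  qed (simp add: concat_form_def)
qed

lemma concat_form_bilform: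
  assumes f: "f \<in> pforms s V"
  shows "(\<lambda>p r. p (\<lambda>I. r (concat_form f I))) \<in> P_bilforms s V"
proof -
  \<comment> \<open>Elements of P are linear on \<open>pforms\<close> only, so the function of I
    that p is applied to has to be placed there first.\<close>
  have psi: "(\<lambda>I. r (concat_form f I)) \<in> pforms s V" if "r \<in> P_space s V" for r
    using that
  proof (induct rule: P_induct)
    case (mon xs y)
    then show ?case using concat_form_pforms[OF f] by (simp add: mon_def)
  next
    case (add p q)
    then show ?case using pforms_add[OF add(3,4)] by (simp add: plus_fun_apply)
  next
    case (scale c p)
    then show ?case using pforms_weight[OF scale(2), of "\<lambda>_. c"] by (simp add: fscale_def)
  qed
  show ?thesis
    unfolding P_bilforms_def
    by (auto simp: plus_fun_apply fscale_def P_apply[OF _ psi psi])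
qed

text \<open>Pairing the coproduct of p with a suitably weighted concatenation form returns p on the
  part of f of arity other than 1. If the coproduct is 0, only the arity 1 part of p
  survives.\<close>

lemma Delta_kernel:
  assumes p: "p \<in> P_space s V" and D: "Delta s V p = 0"
  shows "P_proj0 s V p = p"
proof
  fix f
  show "P_proj0 s V p f = p f"
  proof (cases "f \<in> pforms s V")
    case False
    then show ?thesis using P_outside[OF p] by (simp add: P_proj0_def ptrans_def)
  next
    case f: True
    \<comment> \<open>The coproduct of a monomial with n letters in all has
      \<open>unshuffle_weight id (n - 1)\<close> terms, and concatenation makes them all equal;
      \<open>w\<close> divides by their number. For n < 2 there are no terms and \<open>w\<close> is
      0.\<close>
    define w :: "nat \<Rightarrow> 'k" where "w n = (if n < 2 then 0 else inverse (of_nat (unshuffle_weight id (n - 1))))" for n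
    define h where "h zs = w (length zs) * f zs" for zs
    have h: "h \<in> pforms s V" unfolding h_def by (rule pforms_weight[OF f])
    let ?g = "\<lambda>p r. p (\<lambda>I. r (concat_form h I))"
    have g: "?g (mon s V (I @ [x])) (mon s V (J @ [y])) = h (I @ x # J @ [y])" for I x J y
      using concat_form_pforms[OF h] by (simp add: mon_def) (simp add: concat_form_def)
    have e: "unshuffle1 V (\<lambda>I x J. ?g (mon s V (I @ [x])) (mon s V (J @ [last zs]))) (butlast zs)
        = (if length zs \<noteq> 1 then 1 else 0) * f zs" if zs: "zs \<noteq> []" for zs
    proof -
      obtain xs y where zs: "zs = xs @ [y]" using zs by (metis rev_exhaust)
      have "h ((us @ x # z # ws) @ [y]) = sg (deg V x * deg V z) (h ((us @ z # x # ws) @ [y]))" for us x z ws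
        using pformsD(4)[OF h, of "ws @ [y]" us x z] by simp
      from unshuffle1_symmetric[of "\<lambda>zs. h (zs @ [y])" V xs, OF this]
      have "unshuffle1 V (\<lambda>I x J. h (I @ x # J @ [y])) xs
          = of_nat (unshuffle_weight id (length xs)) * h (xs @ [y])" by simp
      moreover have "unshuffle_weight id (length xs) \<noteq> 0" if "xs \<noteq> []"
        using unshuffle_weight_ge[of id "length xs"] that by (cases xs) auto
      ultimately show ?thesis
        unfolding g by (auto simp: zs h_def w_def)
    qed
    have "0 = Delta s V p ?g" using D by (simp add: zero_fun_apply)
    also have "\<dots> = p (\<lambda>zs. (if length zs \<noteq> 1 then 1 else 0) * f zs)"
      unfolding Delta_def using concat_form_bilform[OF h]
      by (auto simp: e pformsD(1)[OF f] intro!: arg_cong[where f = p])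
    finally have 0: "p (\<lambda>zs. (if length zs \<noteq> 1 then 1 else 0) * f zs) = 0" by simp
    have "P_proj0 s V p f = p (\<lambda>zs. (if length zs = 1 then 1 else 0) * f zs)"
      using f by (auto simp: P_proj0_def ptrans_def intro!: arg_cong[where f = p])
    also have "\<dots> = p (\<lambda>zs. (if length zs = 1 then 1 else 0) * f zs + (if length zs \<noteq> 1 then 1 else 0) * f zs)"
      using P_apply(1)[OF p pforms_weight[OF f] pforms_weight[OF f],
          of "\<lambda>n. if n = 1 then 1 else 0" "\<lambda>n. if n \<noteq> 1 then 1 else 0"] 0 by simp
    also have "\<dots> = p f"
      by (intro arg_cong[where f = p]) auto
    finally show ?thesis .
  qed
qed

text \<open>Induction on the length of a monomial: the coderivation identity expresses the coproduct
  of its image through images of shorter monomials, which vanish. The image then lies in the kernel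
  of the coproduct and equals its projection to arity 1, which is 0 by assumption.\<close>

lemma coders_eq_0:
  assumes D: "D \<in> coders s V n"
    and 0: "\<And>xs y. P_proj0 s V (D (mon s V (xs @ [y]))) = 0"
  shows "D = 0"
proof
  note d = codersD[OF D]
  have mon: "D (mon s V (xs @ [y])) = 0" for xs y
  proof (induct "length xs" arbitrary: xs y rule: less_induct)
    case less
    have "Delta s V (D (mon s V (xs @ [y]))) =
        unshuffle1 V (\<lambda>I x J. P_tensor s V (D (mon s V (I @ [x]))) (mon s V (J @ [y]))) xs
        + unshuffle1 V (\<lambda>I x J. P_tensor s V (par n (mon s V (I @ [x]))) (D (mon s V (J @ [y])))) xs"
      by (simp add: d(4)[OF mon_in_P] PP_map_Delta_mon d(1) P_end_id P_end_par)
    also have "\<dots> = 0"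
    proof -
      have "P_tensor s V (D (mon s V (I @ [x]))) (mon s V (J @ [y])) = 0
          \<and> P_tensor s V (par n (mon s V (I @ [x]))) (D (mon s V (J @ [y]))) = 0"
        if m: "mset I + {#x#} + mset J = mset xs" for I x J
      proof -
        have "length I < length xs" "length J < length xs"
          using arg_cong[OF m, of size] by auto
        then show ?thesis
          using less[of I x] less[of J y] P_tensor_linear(5)[OF mon_in_P mon_in_P mon_in_P]
            P_tensor_linear(6)[OF mon_in_P mon_in_P P_endD(1)[OF P_end_par mon_in_P]]
          by simp
      qed
      then show ?thesis
        unfolding unshuffle1_add[symmetric] by (intro unshuffle1_eq_0) (simp only: add_0)
    qed
    finally show ?case
      using Delta_kernel[OF P_endD(1)[OF d(1) mon_in_P]] 0[of xs y] by simp
  qed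
  have "D p = 0" if "p \<in> P_space s V" for p
    using that by (induct rule: P_induct) (simp_all add: mon P_endD[OF d(1)])
  then show "D p = 0 p" for p
    using d(2)[of p] by (cases "p \<in> P_space s V") (simp_all add: zero_fun_apply)
qed

end

section \<open>Coderivations from their components\<close>

text \<open>The two letters are taken from unrelated lists, so neither crosses the other and no sign
  appears.\<close>

lemma pick_pick:
  "pick V (\<lambda>x J. pick V (\<lambda>a B. H a B x J) K) R = pick V (\<lambda>a B. pick V (\<lambda>x J. H a B x J) R) K"
proof (induct K arbitrary: H)
  case (Cons y K)
  show ?case by (simp add: pick_Cons pick_add pick_sg Cons)
qed simp

lemma pick_unshuffle:
  "pick V (\<lambda>x J. unshuffle V (\<lambda>A K. F A K x J) I) R = unshuffle V (\<lambda>A K. pick V (\<lambda>x J. F A K x J) R) I"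
proof (induct I arbitrary: F)
  case (Cons y I)
  show ?case by (simp add: pick_add pick_sg Cons)
qed simp

lemma unshuffle_unshuffle1:
  "unshuffle V (\<lambda>K J. unshuffle1 V (\<lambda>A a B. H A a B J) K) xs
    = unshuffle1 V (\<lambda>A a S. unshuffle V (\<lambda>B J. H A a B J) S) xs"
  unfolding unshuffle1_pick unshuffle_assoc[symmetric] unshuffle_pick ..

lemma unshuffle1_unshuffle:
  "unshuffle1 V (\<lambda>I x J. unshuffle V (\<lambda>A B. H A B x J) I) xs
    = unshuffle V (\<lambda>A S. unshuffle1 V (\<lambda>B x J. H A B x J) S) xs"
  unfolding unshuffle1_pick unshuffle_assoc pick_unshuffle ..

text \<open>A normal form in which both distinguished letters are extracted last: first the block A,
  then two blocks that each give up a letter. The regroupings that follow are compared through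
  it.\<close>

lemma unshuffle1_unshuffle1:
  "unshuffle1 V (\<lambda>I x J. unshuffle1 V (\<lambda>A a B. H A a B x J) I) xs
    = unshuffle V (\<lambda>A S. unshuffle V (\<lambda>K R. pick V (\<lambda>a B. pick V (\<lambda>x J. H A a B x J) R) K) S) xs"
  unfolding unshuffle1_pick pick_unshuffle unshuffle_assoc
  by (intro unshuffle_cong) (rule pick_pick)

lemma unshuffle1_assoc:
  "unshuffle1 V (\<lambda>I x J. unshuffle1 V (\<lambda>A a B. H A a B x J) I) xs
    = unshuffle1 V (\<lambda>A a S. unshuffle1 V (\<lambda>B x J. H A a B x J) S) xs"
  unfolding unshuffle1_unshuffle1 unfolding unshuffle1_pick unshuffle_pick ..

text \<open>The list is split into A and two blocks aB and xJ, each with a distinguished letter.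
  Listing xJ before aB costs the sign of their total degrees.\<close>

lemma unshuffle1_exchange:
  "unshuffle1 V (\<lambda>I x J. unshuffle1 V (\<lambda>A a B. H A a B x J) I) xs
    = unshuffle1 V (\<lambda>I a B. unshuffle1 V (\<lambda>A x J.
        sg ((deg V x + ldeg V J) * (deg V a + ldeg V B)) (H A a B x J)) I) xs"
proof -
  have "unshuffle V (\<lambda>K R. pick V (\<lambda>a B. pick V (\<lambda>x J. H A a B x J) R) K) S
      = unshuffle V (\<lambda>R K. pick V (\<lambda>x J. pick V (\<lambda>a B.
          sg ((deg V x + ldeg V J) * (deg V a + ldeg V B)) (H A a B x J)) K) R) S" for A S
  proof -
    have "sg (ldeg V R * ldeg V K) (pick V (\<lambda>a B. pick V (\<lambda>x J. H A a B x J) R) K)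
        = pick V (\<lambda>x J. pick V (\<lambda>a B. sg ((deg V x + ldeg V J) * (deg V a + ldeg V B)) (H A a B x J)) K) R"
      for R K
      unfolding pick_sg by (subst (2) pick_pick) (intro pick_cong, simp add: ldeg_pick)
    then show ?thesis
      unfolding unshuffle_comm[of V "\<lambda>R K. pick V (\<lambda>a B. pick V (\<lambda>x J. H A a B x J) R) K" S] by simp
  qed
  then show ?thesis unfolding unshuffle1_unshuffle1 by (intro unshuffle_cong[where xs = xs])
qed

context graded
begin

lemma sym_mapD:
  assumes "sym_map s V d Q"
  shows "\<exists>z\<in>set zs. \<not> homog V z \<Longrightarrow> Q zs = 0"
    "\<forall>z\<in>set zs. homog V z \<Longrightarrow> Q zs \<in> V (ldeg V zs + d + 1)" "homog V (Q zs)"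
    "x \<in> V n \<Longrightarrow> y \<in> V n \<Longrightarrow> Q (us @ (x + y) # ws) = Q (us @ x # ws) + Q (us @ y # ws)"
    "x \<in> V n \<Longrightarrow> Q (us @ s c x # ws) = s c (Q (us @ x # ws))"
    "ws \<noteq> [] \<Longrightarrow> Q (us @ x # y # ws) = sg (deg V x * deg V y) (Q (us @ y # x # ws))"
proof -
  show 1: "Q zs = 0" if "\<exists>z\<in>set zs. \<not> homog V z" using assms that unfolding sym_map_def by blast
  show 2: "Q zs \<in> V (ldeg V zs + d + 1)" if "\<forall>z\<in>set zs. homog V z"
    using assms that unfolding sym_map_def by blast
  show "homog V (Q zs)" using 1 2 homog_0 by (metis homog_def)
qed (use assms in \<open>unfold sym_map_def, blast+\<close>)

lemma deg_sym_map: "sym_map s V d Q \<Longrightarrow> Q zs \<noteq> 0 \<Longrightarrow> deg V (Q zs) = ldeg V zs + d"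
  using deg_eq[OF V, of "Q zs" "ldeg V zs + d + 1"] sym_mapD(1,2)[of d Q zs] by fastforce

text \<open>At 0 the value of \<open>deg\<close> is arbitrary, but there the monomial vanishes too;
  so inside a sign the degree of a value of \<open>Q\<close> may be replaced by the expected
  one.\<close>

lemma mon_sym_map_sg:
  assumes "sym_map s V d Q"
  shows "sg (\<phi> (deg V (Q zs))) (mon s V (us @ Q zs # ws)) = sg (\<phi> (ldeg V zs + d)) (mon s V (us @ Q zs # ws))"
  using deg_sym_map[OF assms, of zs] mon_zero_arg[of "us @ Q zs # ws"] by (cases "Q zs = 0") auto

lemma Delta_unshuffle:
  "Delta s V (unshuffle V p xs) = unshuffle V (\<lambda>I J. Delta s V (p I J)) xs"
  "Delta s V (unshuffle1 V q xs) = unshuffle1 V (\<lambda>I x J. Delta s V (q I x J)) xs"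
  and Delta_sg: "Delta s V (sg n r) = sg n (Delta s V r)"
proof -
  show *: "Delta s V (sg n r) = sg n (Delta s V r)" for n r
    using Delta_scale[of "-1" r] by (simp add: sg_def fscale_minus)
  show "Delta s V (unshuffle V p xs) = unshuffle V (\<lambda>I J. Delta s V (p I J)) xs"
    by (rule unshuffle_hom[of "Delta s V"]) (simp_all add: Delta_add *)
  show "Delta s V (unshuffle1 V q xs) = unshuffle1 V (\<lambda>I x J. Delta s V (q I x J)) xs"
    by (rule unshuffle1_hom[of "Delta s V"]) (simp_all add: Delta_add *)
qed

lemma P_end_coder_ext:
  assumes Q: "sym_map s V d Q"
  shows "P_end (coder_ext s V d Q)"
proof -
  have add: "coder_ext s V d Q (p + q) = coder_ext s V d Q p + coder_ext s V d Q q"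
    "coder_ext s V d Q (fscale c p) = fscale c (coder_ext s V d Q p)"
    if "p \<in> P_space s V" "q \<in> P_space s V" for p q c
    using that by (simp_all add: coder_ext_def P_closed ptrans_add ptrans_scale)
  have "coder_ext s V d Q p \<in> P_space s V" if "p \<in> P_space s V" for p
    using that
  proof (induct rule: P_induct)
    case (mon xs y)
    show ?case
      unfolding coder_ext_mon[OF V Q]
      by (intro P_closed unshuffle_closed unshuffle1_closed subspace_P mon_in_P)
  qed (simp_all add: add P_closed)
  then show ?thesis using add by (simp add: P_end_def)
qed

lemma coder_ext_deg:
  assumes Q: "sym_map s V d Q"
  shows "coder_ext s V d Q (mon s V (xs @ [y])) \<in> P_deg s V (ldeg V (xs @ [y]) + d)"
proof -
  have mon: "mon s V (us @ Q zs # ws) \<in> P_deg s V n" if "n = ldeg V us + (ldeg V zs + d) + ldeg V ws" for us zs ws n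
    using deg_sym_map[OF Q, of zs] mon_zero_arg[of "us @ Q zs # ws"] that P_deg_closed(1)
    by (cases "Q zs = 0") (auto intro!: mon_in_P_deg)
  show ?thesis
    unfolding coder_ext_mon[OF V Q]
  proof (intro P_deg_closed(2) unshuffle_closed unshuffle1_closed subspace_P_deg P_deg_closed(6))
    fix I J assume "mset I + mset J = mset xs"
    then show "mon s V (I @ [Q (J @ [y])]) \<in> P_deg s V (ldeg V (xs @ [y]) + d)"
      using ldeg_split by (intro mon) fastforce
  next
    fix I x J assume m: "mset I + ({#x#} + mset J) = mset xs"
    have "ldeg V xs = ldeg V (I @ x # J)" by (rule ldeg_mset) (use m in simp)
    then show "mon s V (I @ [Q (J @ [x]), y]) \<in> P_deg s V (ldeg V (xs @ [y]) + d)"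
      by (intro mon) simp
  qed
qed

text \<open>Both sides consist of four families of terms, according to the place of the value of
  \<open>Q\<close>: in the first factor among the symmetric letters or at its end, in the second
  factor among the symmetric letters or at its end. The families are matched one by one, and only
  orders of splitting and signs have to be compared.\<close>

lemma coder_ext_Delta:
  assumes Q: "sym_map s V d Q"
  defines "D \<equiv> coder_ext s V d Q" and "m \<equiv> mon s V" and "T \<equiv> P_tensor s V"
  shows "Delta s V (D (m (xs @ [y]))) = PP_map s V D id (Delta s V (m (xs @ [y])))
    + PP_map s V (par d) D (Delta s V (m (xs @ [y])))"
proof -
  let ?U = "unshuffle V" and ?U1 = "unshuffle1 V"
  have P: "m zs \<in> P_space s V" for zs by (simp add: m_def mon_in_P)
  have D: "D (m (xs @ [y])) = ?U (\<lambda>I J. sg (d * ldeg V I) (m (I @ [Q (J @ [y])]))) xs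
    + ?U1 (\<lambda>I x J. sg (deg V x * ldeg V J + d * ldeg V I) (m (I @ [Q (J @ [x]), y]))) xs" for xs y
    unfolding D_def m_def by (rule coder_ext_mon[OF V Q])
  have Tsg: "T (sg n p) r = sg n (T p r)" "T r (sg n p) = sg n (T r p)"
    "T (p + q) r = T p r + T q r" "T r (p + q) = T r p + T r q"
    if "p \<in> P_space s V" "r \<in> P_space s V" "q \<in> P_space s V" for p q r n
    using P_tensor_linear[OF that(1,3,2)] by (auto simp: T_def)
  note closed = P_closed(6) P unshuffle_closed[OF subspace_P] unshuffle1_closed[OF subspace_P]
  \<comment> \<open>If \<open>Q\<close> has absorbed y, its value replaces y at the end of the
    second factor; this is the first family. Otherwise the value is the last symmetric letter and
    takes the three places of \<open>unshuffle1_snoc\<close>.\<close>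
  have L: "Delta s V (D (m (xs @ [y]))) =
      ?U (\<lambda>K J. ?U1 (\<lambda>A a B. sg (d * ldeg V K) (T (m (A @ [a])) (m (B @ [Q (J @ [y])])))) K) xs
      + ?U1 (\<lambda>I x J. ?U1 (\<lambda>A a B. sg (deg V x * ldeg V J + d * ldeg V I + (ldeg V J + deg V x + d) * (deg V a + ldeg V B))
            (T (m (A @ [Q (J @ [x]), a])) (m (B @ [y])))) I) xs
      + ?U1 (\<lambda>I x J. ?U (\<lambda>A B. sg (deg V x * ldeg V J + d * ldeg V I + (ldeg V J + deg V x + d) * ldeg V B)
            (T (m (A @ [Q (J @ [x])])) (m (B @ [y])))) I) xs
      + ?U1 (\<lambda>I x J. ?U1 (\<lambda>A a B. sg (deg V x * ldeg V J + d * ldeg V I)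
            (T (m (A @ [a])) (m (B @ [Q (J @ [x]), y])))) I) xs"
  proof -
    have 1: "Delta s V (m (I @ [z])) = ?U1 (\<lambda>A a B. T (m (A @ [a])) (m (B @ [z]))) I" for I z
      unfolding m_def T_def by (rule Delta_mon[OF V])
    have sgT: "sg (\<phi> (deg V (Q zs))) (T (m (us @ Q zs # ws)) r) = sg (\<phi> (ldeg V zs + d)) (T (m (us @ Q zs # ws)) r)"
      if "r \<in> P_space s V" for \<phi> zs us ws r
      using arg_cong[OF mon_sym_map_sg[OF Q, of \<phi> zs us ws], of "\<lambda>p. T p r"]
      by (simp add: Tsg(1)[OF P that P] m_def[symmetric])
    have 2: "Delta s V (m (I @ [Q zs, z])) =
        ?U1 (\<lambda>A a B. sg ((ldeg V zs + d) * (deg V a + ldeg V B)) (T (m (A @ [Q zs, a])) (m (B @ [z])))) I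
        + ?U (\<lambda>A B. sg ((ldeg V zs + d) * ldeg V B) (T (m (A @ [Q zs])) (m (B @ [z])))) I
        + ?U1 (\<lambda>A a B. T (m (A @ [a])) (m (B @ [Q zs, z]))) I" for I zs z
    proof -
      have a: "sg (deg V (Q zs) * (deg V a + ldeg V B)) (T (m (A @ [Q zs, a])) (m (B @ [z])))
          = sg ((ldeg V zs + d) * (deg V a + ldeg V B)) (T (m (A @ [Q zs, a])) (m (B @ [z])))" for A a B
        using sgT[OF P, of "\<lambda>n. n * (deg V a + ldeg V B)"] by simp
      have b: "sg (deg V (Q zs) * ldeg V B) (T (m (A @ [Q zs])) (m (B @ [z])))
          = sg ((ldeg V zs + d) * ldeg V B) (T (m (A @ [Q zs])) (m (B @ [z])))" for A B
        using sgT[OF P, of "\<lambda>n. n * ldeg V B"] by simp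
      show ?thesis
        using 1[of "I @ [Q zs]" z] by (simp add: unshuffle1_snoc a b)
    qed
    show ?thesis
      unfolding D Delta_add Delta_unshuffle Delta_sg 1 2
      by (simp add: sg_plus unshuffle1_add unshuffle_sg unshuffle1_sg sg_sg add_ac)
  qed
  have R: "PP_map s V D id (Delta s V (m (xs @ [y]))) + PP_map s V (par d) D (Delta s V (m (xs @ [y]))) =
      ?U1 (\<lambda>I x J. ?U (\<lambda>A B. sg (d * ldeg V A) (T (m (A @ [Q (B @ [x])])) (m (J @ [y])))) I) xs
      + ?U1 (\<lambda>I x J. ?U1 (\<lambda>A a B. sg (deg V a * ldeg V B + d * ldeg V A)
            (T (m (A @ [Q (B @ [a]), x])) (m (J @ [y])))) I) xs
      + ?U1 (\<lambda>I x J. ?U (\<lambda>A B. sg (d * (ldeg V I + deg V x) + d * ldeg V A)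
            (T (m (I @ [x])) (m (A @ [Q (B @ [y])])))) J) xs
      + ?U1 (\<lambda>I x J. ?U1 (\<lambda>A a B. sg (d * (ldeg V I + deg V x) + deg V a * ldeg V B + d * ldeg V A)
            (T (m (I @ [x])) (m (A @ [Q (B @ [a]), y])))) J) xs"
  proof -
    have 1: "T (D (m (I @ [x]))) r = ?U (\<lambda>A B. sg (d * ldeg V A) (T (m (A @ [Q (B @ [x])])) r)) I
      + ?U1 (\<lambda>A a B. sg (deg V a * ldeg V B + d * ldeg V A) (T (m (A @ [Q (B @ [a]), x])) r)) I"
      if "r \<in> P_space s V" for I x r
      unfolding D using that
      by (simp add: Tsg closed P_tensor_unshuffle P_tensor_unshuffle1 T_def[symmetric])
        (simp add: T_def P_tensor_unshuffle P_tensor_unshuffle1 P_tensor_linear(3)[OF P P] closed)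
    have 2: "T r (D (m (I @ [x]))) = ?U (\<lambda>A B. sg (d * ldeg V A) (T r (m (A @ [Q (B @ [x])])))) I
      + ?U1 (\<lambda>A a B. sg (deg V a * ldeg V B + d * ldeg V A) (T r (m (A @ [Q (B @ [a]), x])))) I"
      if "r \<in> P_space s V" for I x r
      unfolding D using that
      by (simp add: Tsg closed P_tensor_unshuffle P_tensor_unshuffle1 T_def[symmetric])
        (simp add: T_def P_tensor_unshuffle P_tensor_unshuffle1 P_tensor_linear(4)[OF P P] closed)
    have PE: "P_end D" unfolding D_def by (rule P_end_coder_ext[OF Q])
    have 3: "T (par d (m (I @ [x]))) (D (m (J @ [y]))) = sg (d * (ldeg V I + deg V x)) (T (m (I @ [x])) (D (m (J @ [y]))))"
      for I x J
      using Tsg(1)[OF P P_endD(1)[OF PE P] P] par_mon[of d "I @ [x]"] by (simp add: m_def)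
    show ?thesis
      unfolding m_def[symmetric] PP_map_Delta_mon[OF PE P_end_id, folded m_def T_def]
        PP_map_Delta_mon[OF P_end_par PE, folded m_def T_def] id_apply 1[OF P] 2[OF P] 3
      by (simp add: sg_plus unshuffle1_add unshuffle_sg unshuffle1_sg sg_sg add_ac)
  qed
  have 1: "?U (\<lambda>K J. ?U1 (\<lambda>A a B. sg (d * ldeg V K) (T (m (A @ [a])) (m (B @ [Q (J @ [y])])))) K) xs
      = ?U1 (\<lambda>I x J. ?U (\<lambda>A B. sg (d * (ldeg V I + deg V x) + d * ldeg V A)
            (T (m (I @ [x])) (m (A @ [Q (B @ [y])])))) J) xs"
    unfolding unshuffle_unshuffle1[symmetric]
  proof (intro unshuffle_cong unshuffle1_cong)
    fix K J A B :: "'v list" and a assume m: "mset A + ({#a#} + mset B) = mset K"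
    have "ldeg V K = ldeg V (A @ a # B)" by (rule ldeg_mset) (use m in simp)
    then show "sg (d * ldeg V K) (T (m (A @ [a])) (m (B @ [Q (J @ [y])])))
        = sg (d * (ldeg V A + deg V a) + d * ldeg V B) (T (m (A @ [a])) (m (B @ [Q (J @ [y])])))"
      by (simp add: algebra_simps)
  qed
  have 2: "?U1 (\<lambda>I x J. ?U1 (\<lambda>A a B. sg (deg V x * ldeg V J + d * ldeg V I + (ldeg V J + deg V x + d) * (deg V a + ldeg V B))
            (T (m (A @ [Q (J @ [x]), a])) (m (B @ [y])))) I) xs
      = ?U1 (\<lambda>I x J. ?U1 (\<lambda>A a B. sg (deg V a * ldeg V B + d * ldeg V A)
            (T (m (A @ [Q (B @ [a]), x])) (m (J @ [y])))) I) xs"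
  proof -
    \<comment> \<open>Since I is split into A, a, B, the part of \<open>d * ldeg V I\<close> coming
      from a and B cancels against the \<open>d\<close> in the sign for moving the value of
      \<open>Q\<close> over them.\<close>
    have "?U1 (\<lambda>I x J. ?U1 (\<lambda>A a B. sg (deg V x * ldeg V J + d * ldeg V I + (ldeg V J + deg V x + d) * (deg V a + ldeg V B))
            (T (m (A @ [Q (J @ [x]), a])) (m (B @ [y])))) I) xs
        = ?U1 (\<lambda>I x J. ?U1 (\<lambda>A a B. sg (deg V x * ldeg V J + d * ldeg V A + (ldeg V J + deg V x) * (deg V a + ldeg V B))
            (T (m (A @ [Q (J @ [x]), a])) (m (B @ [y])))) I) xs"
    proof (intro unshuffle1_cong)
      fix I J A B :: "'v list" and x a assume m: "mset A + ({#a#} + mset B) = mset I"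
      have "ldeg V I = ldeg V (A @ a # B)" by (rule ldeg_mset) (use m in simp)
      then show "sg (deg V x * ldeg V J + d * ldeg V I + (ldeg V J + deg V x + d) * (deg V a + ldeg V B))
          (T (m (A @ [Q (J @ [x]), a])) (m (B @ [y])))
        = sg (deg V x * ldeg V J + d * ldeg V A + (ldeg V J + deg V x) * (deg V a + ldeg V B))
          (T (m (A @ [Q (J @ [x]), a])) (m (B @ [y])))"
        by (intro sg_cong refl) (simp add: algebra_simps)
    qed
    also have "\<dots> = ?U1 (\<lambda>I x J. ?U1 (\<lambda>A a B. sg (deg V a * ldeg V B + d * ldeg V A)
            (T (m (A @ [Q (B @ [a]), x])) (m (J @ [y])))) I) xs"
      by (subst unshuffle1_exchange, intro unshuffle1_cong, unfold sg_sg, intro sg_cong refl)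
        (simp add: algebra_simps)
    finally show ?thesis .
  qed
  have 3: "?U1 (\<lambda>I x J. ?U (\<lambda>A B. sg (deg V x * ldeg V J + d * ldeg V I + (ldeg V J + deg V x + d) * ldeg V B)
            (T (m (A @ [Q (J @ [x])])) (m (B @ [y])))) I) xs
      = ?U1 (\<lambda>I x J. ?U (\<lambda>A B. sg (d * ldeg V A) (T (m (A @ [Q (B @ [x])])) (m (J @ [y])))) I) xs"
  proof -
    have "?U1 (\<lambda>I x J. ?U (\<lambda>A B. sg (deg V x * ldeg V J + d * ldeg V I + (ldeg V J + deg V x + d) * ldeg V B)
            (T (m (A @ [Q (J @ [x])])) (m (B @ [y])))) I) xs
        = ?U1 (\<lambda>I x J. ?U (\<lambda>A B. sg (deg V x * ldeg V J + d * ldeg V A + (ldeg V J + deg V x) * ldeg V B)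
            (T (m (A @ [Q (J @ [x])])) (m (B @ [y])))) I) xs"
    proof (intro unshuffle_cong unshuffle1_cong)
      fix I J A B :: "'v list" and x :: 'v assume m: "mset A + mset B = mset I"
      show "sg (deg V x * ldeg V J + d * ldeg V I + (ldeg V J + deg V x + d) * ldeg V B)
            (T (m (A @ [Q (J @ [x])])) (m (B @ [y])))
        = sg (deg V x * ldeg V J + d * ldeg V A + (ldeg V J + deg V x) * ldeg V B)
            (T (m (A @ [Q (J @ [x])])) (m (B @ [y])))"
        by (intro sg_cong refl) (simp add: ldeg_split[OF m] algebra_simps)
    qed
    \<comment> \<open>On one side \<open>Q\<close> swallows the block after x, on the other the
      block before x; reversing the two blocks around x identifies them.\<close>
    also have "\<dots> = ?U1 (\<lambda>I x J. ?U (\<lambda>A B. sg (d * ldeg V A) (T (m (A @ [Q (B @ [x])])) (m (J @ [y])))) I) xs"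
      unfolding unshuffle1_unshuffle
    proof (rule unshuffle_cong)
      fix A S :: "'v list"
      show "?U1 (\<lambda>B x J. sg (deg V x * ldeg V J + d * ldeg V A + (ldeg V J + deg V x) * ldeg V B)
            (T (m (A @ [Q (J @ [x])])) (m (B @ [y])))) S
        = ?U1 (\<lambda>B x J. sg (d * ldeg V A) (T (m (A @ [Q (B @ [x])])) (m (J @ [y])))) S"
        by (subst unshuffle1_rev, intro unshuffle1_cong, unfold sg_sg, intro sg_cong refl)
          (simp add: algebra_simps)
    qed
    finally show ?thesis .
  qed
  have 4: "?U1 (\<lambda>I x J. ?U1 (\<lambda>A a B. sg (deg V x * ldeg V J + d * ldeg V I)
            (T (m (A @ [a])) (m (B @ [Q (J @ [x]), y])))) I) xs
      = ?U1 (\<lambda>I x J. ?U1 (\<lambda>A a B. sg (d * (ldeg V I + deg V x) + deg V a * ldeg V B + d * ldeg V A)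
            (T (m (I @ [x])) (m (A @ [Q (B @ [a]), y])))) J) xs"
    unfolding unshuffle1_assoc[symmetric]
  proof (intro unshuffle1_cong)
    fix I J A B :: "'v list" and x a assume m: "mset A + ({#a#} + mset B) = mset I"
    have "ldeg V I = ldeg V (A @ a # B)" by (rule ldeg_mset) (use m in simp)
    then show "sg (deg V x * ldeg V J + d * ldeg V I) (T (m (A @ [a])) (m (B @ [Q (J @ [x]), y])))
      = sg (d * (ldeg V A + deg V a) + deg V x * ldeg V J + d * ldeg V B)
            (T (m (A @ [a])) (m (B @ [Q (J @ [x]), y])))"
      by (simp add: algebra_simps)
  qed
  show ?thesis unfolding L R 1 2 3 4 by (simp add: add_ac)
qed

lemma coder_ext_coders:
  assumes "sym_map s V d Q"
  shows "coder_ext s V d Q \<in> coders s V d"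
  using P_end_coder_ext[OF assms] coder_ext_deg[OF assms] coder_ext_Delta[OF assms]
  by (intro codersI) (auto simp: coder_ext_def)

end

section \<open>Commutators and components\<close>

context graded
begin

lemma P_tensor_scale:
  assumes "p \<in> P_space s V" "r \<in> P_space s V"
  shows "P_tensor s V (fscale c p) r = fscale c (P_tensor s V p r)"
    "P_tensor s V r (fscale c p) = fscale c (P_tensor s V r p)"
  by (auto simp: P_tensor_def fun_eq_iff fscale_def[of c "\<lambda>g. if _ g then _ g else _"]
      P_bilforms_simps(2,4)[OF _ assms(1,1,2)])

lemma unshuffle1_fscale: "fscale c (unshuffle1 V F xs) = unshuffle1 V (\<lambda>I x J. fscale c (F I x J)) xs"
  by (rule unshuffle1_hom[of "fscale c"]) (simp_all add: fscale_add fscale_sg)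

text \<open>Sums, scalar multiples, differences and commutators all have the shape F + c G, so
  closure is proved for this single combination.\<close>

lemma P_end_lincomb:
  assumes "P_end F" "P_end G"
  shows "P_end (\<lambda>p. F p + fscale c (G p))"
  unfolding P_end_def
proof (intro ballI allI)
  fix p q e assume p: "p \<in> P_space s V" and q: "q \<in> P_space s V"
  have "fscale c (fscale e (G p)) = fscale e (fscale c (G p))" by (simp add: fscale_def fun_eq_iff)
  then show "F p + fscale c (G p) \<in> P_space s V \<and>
      F (p + q) + fscale c (G (p + q)) = F p + fscale c (G p) + (F q + fscale c (G q)) \<and>
      F (fscale e p) + fscale c (G (fscale e p)) = fscale e (F p + fscale c (G p))"
    using P_endD(1,3)[OF assms(1) p] P_endD(1,3)[OF assms(2) p]
    unfolding P_endD(2)[OF assms(1) p q] P_endD(2)[OF assms(2) p q]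
    by (simp add: P_closed fscale_add add_ac)
qed

lemma PP_map_lincomb:
  assumes "P_end F" "P_end G" "P_end H"
  shows "PP_map s V (\<lambda>p. F p + fscale c (G p)) H (Delta s V (mon s V (xs @ [y])))
      = PP_map s V F H (Delta s V (mon s V (xs @ [y]))) + fscale c (PP_map s V G H (Delta s V (mon s V (xs @ [y]))))"
    "PP_map s V H (\<lambda>p. F p + fscale c (G p)) (Delta s V (mon s V (xs @ [y])))
      = PP_map s V H F (Delta s V (mon s V (xs @ [y]))) + fscale c (PP_map s V H G (Delta s V (mon s V (xs @ [y]))))"
proof -
  note e = P_endD(1)[OF assms(1) mon_in_P] P_endD(1)[OF assms(2) mon_in_P] P_endD(1)[OF assms(3) mon_in_P]
  note l = PP_map_Delta_mon[OF P_end_lincomb[OF assms(1,2)] assms(3)]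
    PP_map_Delta_mon[OF assms(3) P_end_lincomb[OF assms(1,2)]]
    PP_map_Delta_mon[OF assms(1,3)] PP_map_Delta_mon[OF assms(2,3)]
    PP_map_Delta_mon[OF assms(3,1)] PP_map_Delta_mon[OF assms(3,2)]
  show "PP_map s V (\<lambda>p. F p + fscale c (G p)) H (Delta s V (mon s V (xs @ [y])))
      = PP_map s V F H (Delta s V (mon s V (xs @ [y]))) + fscale c (PP_map s V G H (Delta s V (mon s V (xs @ [y]))))"
    unfolding l unshuffle1_fscale unshuffle1_add[symmetric]
    by (intro unshuffle1_cong) (simp add: e P_closed P_tensor_linear(1)[OF e(1) P_closed(3)[OF e(2)] e(3)] P_tensor_scale)
  show "PP_map s V H (\<lambda>p. F p + fscale c (G p)) (Delta s V (mon s V (xs @ [y])))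
      = PP_map s V H F (Delta s V (mon s V (xs @ [y]))) + fscale c (PP_map s V H G (Delta s V (mon s V (xs @ [y]))))"
    unfolding l unshuffle1_fscale unshuffle1_add[symmetric]
    by (intro unshuffle1_cong) (simp add: e P_closed P_tensor_linear(2)[OF e(1) P_closed(3)[OF e(2)] e(3)] P_tensor_scale)
qed

lemma PP_map_sg:
  assumes "P_end F" "P_end F'" "P_end G" "P_end G'"
    and "\<And>zs. F (mon s V zs) = sg k (F' (mon s V zs))" "\<And>zs. G (mon s V zs) = G' (mon s V zs)"
  shows "PP_map s V F G (Delta s V (mon s V (xs @ [y]))) = sg k (PP_map s V F' G' (Delta s V (mon s V (xs @ [y]))))"
proof -
  note e = P_endD(1)[OF assms(2) mon_in_P] P_endD(1)[OF assms(4) mon_in_P]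
  show ?thesis
    unfolding PP_map_Delta_mon[OF assms(1,3)] PP_map_Delta_mon[OF assms(2,4)] unshuffle1_sg assms(5,6)
    by (intro unshuffle1_cong P_tensor_linear(3)[OF e(1) e(1) e(2)])
qed

lemma coders_lincomb:
  assumes D: "D \<in> coders s V n" and D': "D' \<in> coders s V n"
  shows "(\<lambda>p. D p + fscale c (D' p)) \<in> coders s V n"
proof -
  note d = codersD[OF D] and d' = codersD[OF D']
  show ?thesis
  proof (rule codersI[OF P_end_lincomb[OF d(1) d'(1)]])
    fix xs y
    show "D (mon s V (xs @ [y])) + fscale c (D' (mon s V (xs @ [y]))) \<in> P_deg s V (ldeg V (xs @ [y]) + n)"
      by (intro P_deg_closed(2,3) d(3) d'(3) mon_in_P_deg refl)
    show "Delta s V (D (mon s V (xs @ [y])) + fscale c (D' (mon s V (xs @ [y])))) =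
      PP_map s V (\<lambda>p. D p + fscale c (D' p)) id (Delta s V (mon s V (xs @ [y])))
      + PP_map s V (par n) (\<lambda>p. D p + fscale c (D' p)) (Delta s V (mon s V (xs @ [y])))"
      unfolding PP_map_lincomb(1)[OF d(1) d'(1) P_end_id] PP_map_lincomb(2)[OF d(1) d'(1) P_end_par]
        Delta_add Delta_scale d(4)[OF mon_in_P] d'(4)[OF mon_in_P] fscale_add
      by (simp only: add_ac)
  qed (simp add: d(2) d'(2))
qed

lemma commutator_lincomb: "commutator m D n D' = (\<lambda>p. D (D' p) + fscale (sg (m * n) (- 1)) (D' (D p)))"
  by (auto simp: commutator_def fscale_def sg_def fun_eq_iff plus_fun_apply)

text \<open>The coproduct of a composite has two extra terms in which the two operators act on
  different tensor factors. The composite in the other order has the same two terms, and the sign in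
  the commutator makes them cancel.\<close>

lemma commutator_coders:
  assumes D: "D \<in> coders s V m" and D': "D' \<in> coders s V n"
  shows "commutator m D n D' \<in> coders s V (m + n)"
proof -
  note d = codersD[OF D] and d' = codersD[OF D']
  note PE = P_end_comp[OF d(1) d'(1)] P_end_comp[OF d'(1) d(1)]
  have e: "P_end (\<lambda>p. D (D' p))" "P_end (\<lambda>p. D' (D p))"
    using PE by (simp_all add: comp_def)
  have E: "P_end (commutator m D n D')"
    unfolding commutator_lincomb by (rule P_end_lincomb[OF e])
  show ?thesis
  proof (rule codersI[OF E])
    fix p assume "p \<notin> P_space s V"
    then show "commutator m D n D' p = 0"
      using P_endD(5)[OF d(1) P_closed(1)] P_endD(5)[OF d'(1) P_closed(1)]
      by (simp add: commutator_def d(2) d'(2))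
  next
    fix xs y
    have "D (D' (mon s V (xs @ [y]))) \<in> P_deg s V (ldeg V (xs @ [y]) + (m + n))"
      using d(3)[OF d'(3)[OF mon_in_P_deg[OF refl]], of "xs @ [y]"] by (simp add: add_ac)
    moreover have "D' (D (mon s V (xs @ [y]))) \<in> P_deg s V (ldeg V (xs @ [y]) + (m + n))"
      using d'(3)[OF d(3)[OF mon_in_P_deg[OF refl]], of "xs @ [y]"] by (simp add: add_ac)
    ultimately show "commutator m D n D' (mon s V (xs @ [y])) \<in> P_deg s V (ldeg V (xs @ [y]) + (m + n))"
      unfolding commutator_def by (intro P_deg_closed(5,6))
    let ?t = "Delta s V (mon s V (xs @ [y]))"
    \<comment> \<open>F raises degrees by l, so passing it through the operator (-1)^(k deg)
      produces (-1)^(l k).\<close>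
    have swap: "F (par k (mon s V zs)) = sg (l * k) (par k (F (mon s V zs)))"
      if F: "F \<in> coders s V l" for F k l zs
      using P_endD(4)[OF codersD(1)[OF F] mon_in_P, of "k * ldeg V zs" zs]
        par_deg[OF codersD(3)[OF F mon_in_P_deg[OF refl]], of k zs]
      by (simp add: par_mon sg_sg algebra_simps) (simp add: sg_def)
    have parpar: "par k (par l (mon s V zs)) = par (k + l) (mon s V zs)" for k l zs
      using P_endD(4)[OF P_end_par mon_in_P, of k "l * ldeg V zs" zs]
      by (simp add: par_mon sg_sg algebra_simps)
    \<comment> \<open>The second and third summands are the mixed terms. Exchanging F with G and k
      with l permutes them and moves the sign (-1)^(k l) from one to the other.\<close>
    have 1: "Delta s V (F (G (mon s V (xs @ [y])))) =
        PP_map s V (\<lambda>p. F (G p)) id ?t + sg (k * l) (PP_map s V (par l \<circ> F) G ?t)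
        + PP_map s V (par k \<circ> G) F ?t + PP_map s V (par (k + l)) (\<lambda>p. F (G p)) ?t"
      if F: "F \<in> coders s V k" and G: "G \<in> coders s V l" for F G k l
    proof -
      note f = codersD[OF F] and g = codersD[OF G]
      note c = P_end_comp[OF f(1) g(1)]
      have a: "PP_map s V (F \<circ> par l) (id \<circ> G) ?t = sg (k * l) (PP_map s V (par l \<circ> F) G ?t)"
        using g(1) by (intro PP_map_sg) (simp_all add: P_end_comp f(1) P_end_par swap[OF F])
      have b: "PP_map s V (par k \<circ> par l) (F \<circ> G) ?t = sg 0 (PP_map s V (par (k + l)) (\<lambda>p. F (G p)) ?t)"
        by (intro PP_map_sg P_end_comp P_end_par f(1) g(1) c[unfolded comp_def]) (simp_all add: parpar)
      have "Delta s V (F (G (mon s V (xs @ [y])))) =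
          PP_map s V (F \<circ> G) id ?t + PP_map s V (F \<circ> par l) (id \<circ> G) ?t
          + (PP_map s V (par k \<circ> G) F ?t + PP_map s V (par k \<circ> par l) (F \<circ> G) ?t)"
        by (simp add: f(4)[OF P_endD(1)[OF g(1) mon_in_P]] g(4)[OF mon_in_P] PP_map_add
            PP_map_comp[OF f(1) P_end_id] PP_map_comp[OF P_end_par f(1)])
      then show ?thesis unfolding a b by (simp add: comp_def add_ac)
    qed
    have c: "fscale (sg (m * n) (- 1)) t = - sg (m * n) t" for t :: "('v, 'k) ppelem"
      by (auto simp: fscale_def sg_def fun_eq_iff)
    show "Delta s V (commutator m D n D' (mon s V (xs @ [y]))) =
        PP_map s V (commutator m D n D') id ?t + PP_map s V (par (m + n)) (commutator m D n D') ?t"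
      unfolding commutator_lincomb PP_map_lincomb(1)[OF e P_end_id] PP_map_lincomb(2)[OF e P_end_par]
        Delta_add Delta_scale 1[OF D D'] 1[OF D' D] c
      by (simp add: sg_plus sg_sg mult.commute[of n m] add.commute[of n m]) (simp add: sg_def)
  qed
qed

end

section \<open>Components as vectors, recovered from functionals by means of the non-degenerate
  form\<close>

locale quadratic = graded s V
  for s :: "'k::field_char_0 \<Rightarrow> 'v::ab_group_add \<Rightarrow> 'v" and V :: "int \<Rightarrow> 'v set" +
  fixes b :: "'v \<Rightarrow> 'v \<Rightarrow> 'k"
  assumes b: "quadratic_form s V b"
begin

lemma b_linear:
  "b (x + y) z = b x z + b y z" "b (s c x) z = c * b x z" "b 0 z = 0" "b (sg n x) z = sg n (b x z)"
  "b z (x + y) = b z x + b z y" "b z (s c x) = c * b z x" "b z 0 = 0" "b z (sg n x) = sg n (b z x)"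
proof -
  have l: "Vector_Spaces.linear s (*) (b z)" "Vector_Spaces.linear s (*) (\<lambda>x. b x z)" for z
    using b unfolding quadratic_form_def bilin_def by auto
  note h = Vector_Spaces.linear.axioms(3)[OF l(1)] Vector_Spaces.linear.axioms(3)[OF l(2)]
  show "b (x + y) z = b x z + b y z" "b (s c x) z = c * b x z" "b 0 z = 0"
    "b z (x + y) = b z x + b z y" "b z (s c x) = c * b z x" "b z 0 = 0"
    by (rule module_hom.add[OF h(1)] module_hom.add[OF h(2)] module_hom.scale[OF h(1)]
        module_hom.scale[OF h(2)] module_hom.zero[OF h(1)] module_hom.zero[OF h(2)])+
  show "b (sg n x) z = sg n (b x z)" "b z (sg n x) = sg n (b z x)"
    using module_hom.neg[OF h(1)] module_hom.neg[OF h(2)] by (auto simp: sg_def)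
qed

lemma b_graded:
  "x \<in> V m \<Longrightarrow> y \<in> V n \<Longrightarrow> b x y = sg (m * n) (b y x)"
  "x \<in> V m \<Longrightarrow> y \<in> V n \<Longrightarrow> b x y \<noteq> 0 \<Longrightarrow> m + n = 0"
  using b unfolding quadratic_form_def by blast+

lemma b_nondegenerate:
  assumes "\<And>y. b v y = b w y"
  shows "v = w"
proof -
  have "b (v - w) y = 0" for y
    using b_linear(1)[of v "s (-1) w" y] b_linear(2)[of "-1" w y] assms[of y] by simp
  then have "v - w = 0" using b unfolding quadratic_form_def by blast
  then show ?thesis by simp
qed

text \<open>The linear form b(., y), extended by 0 to all other arities. Evaluating a functional at
  these forms recovers the vector v from the monomial \<open>mon s V [v]\<close>.\<close>

definition pair_form :: "'v \<Rightarrow> 'v list \<Rightarrow> 'k" where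
  "pair_form y zs = (if length zs = 1 \<and> homog V (hd zs) then b (hd zs) y else 0)"

lemma pair_form_pforms: "pair_form y \<in> pforms s V"
proof (rule pformsI)
  fix us ws :: "'v list"
  have cl: "homog V x" "homog V (x + z)" "homog V (s c x)" if "x \<in> V n" "z \<in> V n" for x z n c
    using that by (auto simp: homog_def intro: V_closed(2,3))
  have "slot_linear s V (\<lambda>x. pair_form y [x])"
    unfolding slot_linear_def pair_form_def using cl b_linear by auto
  then show "slot_linear s V (\<lambda>x. pair_form y (us @ x # ws))"
    using slot_linear_zero by (cases "us = [] \<and> ws = []") (auto simp: pair_form_def)
next
  fix zs :: "'v list" assume "\<exists>z\<in>set zs. \<not> homog V z"
  then show "pair_form y zs = 0" by (cases zs) (auto simp: pair_form_def)
qed (auto simp: pair_form_def)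

lemma mon_pair_form: "homog V v \<Longrightarrow> mon s V [v] (pair_form y) = b v y"
  using pair_form_pforms by (simp add: mon_def) (simp add: pair_form_def)

lemma mon_single_inj: "homog V v \<Longrightarrow> homog V w \<Longrightarrow> mon s V [v] = mon s V [w] \<Longrightarrow> v = w"
  using mon_pair_form b_nondegenerate by metis

lemma mon_single:
  "x \<in> V n \<Longrightarrow> y \<in> V n \<Longrightarrow> mon s V [x + y] = mon s V [x] + mon s V [y]"
  "x \<in> V n \<Longrightarrow> mon s V [s c x] = fscale c (mon s V [x])"
  "x \<in> V n \<Longrightarrow> mon s V [sg k x] = sg k (mon s V [x])"
proof -
  show "x \<in> V n \<Longrightarrow> y \<in> V n \<Longrightarrow> mon s V [x + y] = mon s V [x] + mon s V [y]"
    and *: "\<And>c. x \<in> V n \<Longrightarrow> mon s V [s c x] = fscale c (mon s V [x])"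
    using mon_slot(1)[of x V n y s "[]" "[]"] mon_slot(2)[of x V n x s "[]" _ "[]"] by auto
  show "x \<in> V n \<Longrightarrow> mon s V [sg k x] = sg k (mon s V [x])"
    using *[of "-1"] by (auto simp: sg_def fscale_minus)
qed

text \<open>This is the existence statement behind \<open>component\<close>. The induction runs
  inside one degree because one-letter monomials add up to a one-letter monomial only if the letters
  have equal degree; a sum of mixed degree would not be homogeneous.\<close>

lemma P_proj0_deg:
  assumes "p \<in> P_deg s V n"
  shows "\<exists>v\<in>V (n + 1). P_proj0 s V p = mon s V [v]"
  using assms
proof (induct rule: P_deg_induct)
  case (mon xs y)
  show ?case
  proof (cases "xs = [] \<and> homog V y \<and> y \<noteq> 0")
    case True
    then obtain k where "y \<in> V k" by (auto simp: homog_def)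
    moreover from this have "k = n + 1" using deg_eq[OF V] True mon by fastforce
    ultimately show ?thesis using True by (auto simp: P_proj0_mon)
  next
    case False
    then have "P_proj0 s V (mon s V (xs @ [y])) = 0"
      using mon_zero_arg[of "[y]"] mon_0[of "[y]" V s] by (auto simp: P_proj0_mon)
    then show ?thesis using V_closed(1) mon_zero_arg[of "[0]"] by auto
  qed
next
  case zero
  then show ?case using V_closed(1) mon_zero_arg[of "[0]"] P_endD(5)[OF P_end_proj0 P_closed(1)] by auto
next
  case (add p q)
  then obtain v w where "v \<in> V (n + 1)" "P_proj0 s V p = mon s V [v]" "w \<in> V (n + 1)" "P_proj0 s V q = mon s V [w]"
    by blast
  then show ?case
    using V_closed(2)[of v "n + 1" w] mon_single(1)[of v "n + 1" w] by (auto simp: P_proj0_add intro!: bexI[of _ "v + w"])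
next
  case (scale c p)
  then obtain v where "v \<in> V (n + 1)" "P_proj0 s V p = mon s V [v]" by blast
  then show ?case
    using V_closed(3)[of v "n + 1" c] mon_single(2)[of v "n + 1" c] by (auto simp: P_proj0_scale intro!: bexI[of _ "s c v"])
qed

lemma component_eqI: "homog V v \<Longrightarrow> P_proj0 s V (D (mon s V zs)) = mon s V [v] \<Longrightarrow> component s V D zs = v"
  unfolding component_def by (rule the_equality) (use mon_single_inj in auto)

lemma component:
  assumes "D \<in> coders s V n"
  shows "component s V D zs \<in> V (ldeg V zs + n + 1)" "homog V (component s V D zs)"
    "P_proj0 s V (D (mon s V zs)) = mon s V [component s V D zs]"
proof -
  obtain v where v: "v \<in> V (ldeg V zs + n + 1)" "P_proj0 s V (D (mon s V zs)) = mon s V [v]"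
    using P_proj0_deg[OF codersD(3)[OF assms mon_in_P_deg[OF refl]]] by blast
  moreover have "homog V v" using v by (auto simp: homog_def)
  ultimately show "component s V D zs \<in> V (ldeg V zs + n + 1)" "homog V (component s V D zs)"
    "P_proj0 s V (D (mon s V zs)) = mon s V [component s V D zs]"
    using component_eqI by metis+
qed

lemma component_zero:
  assumes "D \<in> coders s V n" "mon s V zs = 0"
  shows "component s V D zs = 0"
  using P_endD(5)[OF codersD(1)[OF assms(1)] P_closed(1)] P_endD(5)[OF P_end_proj0 P_closed(1)]
    mon_zero_arg[of "[0]"] assms(2) by (intro component_eqI) simp_all

lemma component_slot:
  assumes D: "D \<in> coders s V n" and x: "x \<in> V m"
  shows "component s V D (us @ x # ws) \<in> V (ldeg V us + m + ldeg V ws + n)"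
proof (cases "x = 0")
  case True
  then show ?thesis using component_zero[OF D mon_zero_arg] V_closed(1) by simp
next
  case False
  have "ldeg V (us @ x # ws) + n + 1 = ldeg V us + m + ldeg V ws + n"
    using deg_eq[OF V x False] by simp
  with component(1)[OF D, of "us @ x # ws"] show ?thesis by (rule back_subst[of "\<lambda>k. _ \<in> V k"])
qed

lemma sym_map_component:
  assumes D: "D \<in> coders s V n"
  shows "sym_map s V n (component s V D)"
  unfolding sym_map_def
proof (intro conjI allI ballI impI)
  note E = codersD(1)[OF D]
  note comp = component(3)[OF D]
  show "\<exists>z\<in>set zs. \<not> homog V z \<Longrightarrow> component s V D zs = 0" for zs
    by (rule component_zero[OF D mon_0])
  show "component s V D zs \<in> V (ldeg V zs + n + 1)" for zs
    by (rule component(1)[OF D])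
  fix us ws :: "'v list" and x
  {
    fix k y assume x: "x \<in> V k" and y: "y \<in> V k"
    note cs = component_slot[OF D x, of us ws] component_slot[OF D y, of us ws]
    show "component s V D (us @ (x + y) # ws) = component s V D (us @ x # ws) + component s V D (us @ y # ws)"
    proof (rule component_eqI)
      show "homog V (component s V D (us @ x # ws) + component s V D (us @ y # ws))"
        using V_closed(2)[OF cs] by (auto simp: homog_def)
      show "P_proj0 s V (D (mon s V (us @ (x + y) # ws)))
          = mon s V [component s V D (us @ x # ws) + component s V D (us @ y # ws)]"
        unfolding mon_slot(1)[where V = V and n = k, OF x y] mon_single(1)[OF cs] comp[symmetric]
        using P_endD(2)[OF E mon_in_P mon_in_P] by (simp add: P_proj0_add)
    qed
  }
  {
    fix k c assume x: "x \<in> V k"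
    note cs = component_slot[OF D x, of us ws]
    show "component s V D (us @ s c x # ws) = s c (component s V D (us @ x # ws))"
    proof (rule component_eqI)
      show "homog V (s c (component s V D (us @ x # ws)))"
        using V_closed(3)[OF cs] by (auto simp: homog_def)
      show "P_proj0 s V (D (mon s V (us @ s c x # ws))) = mon s V [s c (component s V D (us @ x # ws))]"
        unfolding mon_slot(2)[where V = V and n = k, OF x x] mon_single(2)[OF cs] comp[symmetric]
        using P_endD(3)[OF E mon_in_P] by (simp add: P_proj0_scale)
    qed
  }
  fix y :: 'v assume ws: "ws \<noteq> []"
  note cs = component(1)[OF D, of "us @ y # x # ws"]
  show "component s V D (us @ x # y # ws) = sg (deg V x * deg V y) (component s V D (us @ y # x # ws))"
  proof (rule component_eqI)
    show "homog V (sg (deg V x * deg V y) (component s V D (us @ y # x # ws)))"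
      using V_closed(5)[OF cs] by (auto simp: homog_def)
    show "P_proj0 s V (D (mon s V (us @ x # y # ws)))
        = mon s V [sg (deg V x * deg V y) (component s V D (us @ y # x # ws))]"
      unfolding mon_swap[OF ws, of s V us x y] mon_single(3)[OF cs] comp[symmetric]
      using P_endD(4)[OF E mon_in_P] P_endD(4)[OF P_end_proj0 P_endD(1)[OF E mon_in_P]] by simp
  qed
qed

lemma component_lincomb:
  assumes D: "D \<in> coders s V n" and D': "D' \<in> coders s V n"
  shows "component s V (\<lambda>p. D p + fscale c (D' p)) zs = component s V D zs + s c (component s V D' zs)"
proof (rule component_eqI)
  note v = component(1)[OF D, of zs] V_closed(3)[OF component(1)[OF D', of zs], of c]
  show "homog V (component s V D zs + s c (component s V D' zs))"
    using V_closed(2)[OF v] by (auto simp: homog_def)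
  show "P_proj0 s V (D (mon s V zs) + fscale c (D' (mon s V zs)))
      = mon s V [component s V D zs + s c (component s V D' zs)]"
    unfolding mon_single(1)[OF v] mon_single(2)[OF component(1)[OF D']]
      P_proj0_add P_proj0_scale component(3)[OF D] component(3)[OF D'] ..
qed

lemma component_inj:
  assumes D: "D \<in> coders s V n" and D': "D' \<in> coders s V n"
    and eq: "component s V D = component s V D'"
  shows "D = D'"
proof -
  have "(\<lambda>p. D p + fscale (- 1) (D' p)) = 0"
    by (rule coders_eq_0[OF coders_lincomb[OF D D']],
        unfold P_proj0_add P_proj0_scale component(3)[OF D] component(3)[OF D'] eq) (simp add: fscale_minus)
  then have "D p - D' p = 0" for p
    using fun_cong[of "\<lambda>p. D p + fscale (- 1) (D' p)" 0 p] by (simp add: fscale_minus zero_fun_apply)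
  then have "D p = D' p" for p unfolding eq_iff_diff_eq_0[of "D p"] .
  then show ?thesis by (rule ext)
qed

lemma P_proj0_coder_ext:
  assumes Q: "sym_map s V d Q" and D: "P_end D"
  shows "P_proj0 s V (D (coder_ext s V d Q (mon s V (xs @ [y])))) =
    unshuffle V (\<lambda>I J. sg (d * ldeg V I) (P_proj0 s V (D (mon s V (I @ [Q (J @ [y])]))))) xs
    + unshuffle1 V (\<lambda>I x J. sg (deg V x * ldeg V J + d * ldeg V I)
        (P_proj0 s V (D (mon s V (I @ [Q (J @ [x]), y]))))) xs"
proof -
  have E: "P_end (\<lambda>p. P_proj0 s V (D p))"
    using P_end_comp[OF P_end_proj0 D] by (simp add: comp_def)
  show ?thesis
    unfolding coder_ext_mon[OF V Q]
    by (simp add: P_endD(2)[OF E] P_end_unshuffle[OF E] P_end_unshuffle1[OF E] P_endD(4)[OF E mon_in_P]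
        P_closed mon_in_P unshuffle_closed[OF subspace_P] unshuffle1_closed[OF subspace_P])
qed

text \<open>A term of the extension has a single letter only if \<open>Q\<close> has absorbed
  everything, that is, for I empty in the first sum; the terms of the second sum keep y as a further
  letter. On the empty list the component is 0, and \<open>Q\<close> has to agree with it.\<close>

lemma component_coder_ext:
  assumes Q: "sym_map s V d Q" and Nil: "Q [] = 0"
  shows "component s V (coder_ext s V d Q) = Q"
proof
  fix zs
  show "component s V (coder_ext s V d Q) zs = Q zs"
  proof (cases zs rule: rev_cases)
    case Nil
    then show ?thesis using component_zero[OF coder_ext_coders[OF Q]] assms(2) by simp
  next
    case (snoc xs y)
    have "P_proj0 s V (coder_ext s V d Q (mon s V (xs @ [y]))) = mon s V [Q (xs @ [y])]"
    proof -
      have "unshuffle V (\<lambda>I J. sg (d * ldeg V I) (P_proj0 s V (mon s V (I @ [Q (J @ [y])])))) xs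
          = unshuffle V (\<lambda>I J. if I = [] then mon s V [Q (J @ [y])] else 0) xs"
        by (rule unshuffle_cong) (simp add: P_proj0_mon)
      moreover have "unshuffle1 V (\<lambda>I x J. sg (deg V x * ldeg V J + d * ldeg V I)
          (P_proj0 s V (mon s V (I @ [Q (J @ [x]), y])))) xs = 0"
        by (rule unshuffle1_eq_0) (simp add: P_proj0_mon)
      ultimately show ?thesis
        using P_proj0_coder_ext[OF Q P_end_id, of xs y] by (simp add: unshuffle_Nil_left)
    qed
    then show ?thesis using component_eqI sym_mapD(3)[OF Q] snoc by simp
  qed
qed

lemma coder_ext_component:
  assumes D: "D \<in> coders s V n"
  shows "coder_ext s V n (component s V D) = D"
  using component_inj[OF coder_ext_coders[OF sym_map_component[OF D]] D]
    component_coder_ext[OF sym_map_component[OF D] component_zero[OF D mon_Nil]] by simp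

text \<open>The component of a composite of two coderivations with components q and c, paired with
  z: the inner one is expanded by the extension formula and the outer one is projected. Pairing
  yields a scalar, so that composites, which need not be coderivations, are compared through
  evaluation at \<open>pair_form z\<close>.\<close>

definition compose_form :: "int \<Rightarrow> ('v list \<Rightarrow> 'v) \<Rightarrow> ('v list \<Rightarrow> 'v) \<Rightarrow> 'v list \<Rightarrow> 'v \<Rightarrow> 'v \<Rightarrow> 'k" where
  "compose_form n q c xs y z =
    unshuffle V (\<lambda>I J. sg (n * ldeg V I) (b (q (I @ [c (J @ [y])])) z)) xs
    + unshuffle1 V (\<lambda>I x J. sg (deg V x * ldeg V J + n * ldeg V I) (b (q (I @ [c (J @ [x]), y])) z)) xs"

lemma P_proj0_compose:
  assumes D: "D \<in> coders s V m" and D': "D' \<in> coders s V n"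
  shows "P_proj0 s V (D (D' (mon s V (xs @ [y])))) (pair_form z)
    = compose_form n (component s V D) (component s V D') xs y z"
proof -
  have "P_proj0 s V (D (D' (mon s V (xs @ [y])))) (pair_form z)
      = P_proj0 s V (D (coder_ext s V n (component s V D') (mon s V (xs @ [y])))) (pair_form z)"
    by (simp add: coder_ext_component[OF D'])
  then show ?thesis
    by (simp add: P_proj0_coder_ext[OF sym_map_component[OF D'] codersD(1)[OF D]] component(3)[OF D]
        plus_fun_apply unshuffle_fun_apply unshuffle1_fun_apply sg_fun mon_pair_form component(2)[OF D]
        compose_form_def)
qed

lemma component_commutator:
  assumes D: "D \<in> coders s V m" and D': "D' \<in> coders s V n"
  shows "b (component s V (commutator m D n D') (xs @ [y])) z =
    compose_form n (component s V D) (component s V D') xs y z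
    - sg (m * n) (compose_form m (component s V D') (component s V D) xs y z)"
proof -
  note C = commutator_coders[OF D D']
  have P: "D (D' (mon s V zs)) \<in> P_space s V" "D' (D (mon s V zs)) \<in> P_space s V" for zs
    by (intro P_endD(1)[OF codersD(1)[OF D]] P_endD(1)[OF codersD(1)[OF D']] mon_in_P)+
  have "b (component s V (commutator m D n D') (xs @ [y])) z
      = P_proj0 s V (commutator m D n D' (mon s V (xs @ [y]))) (pair_form z)"
    by (simp add: component[OF C] mon_pair_form)
  also have "\<dots> = P_proj0 s V (D (D' (mon s V (xs @ [y])))) (pair_form z)
      - sg (m * n) (P_proj0 s V (D' (D (mon s V (xs @ [y])))) (pair_form z))"
    unfolding commutator_def
    by (simp add: P_endD(6)[OF P_end_proj0] P_endD(4)[OF P_end_proj0] P P_closed sg_fun)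
  finally show ?thesis
    unfolding P_proj0_compose[OF D D'] P_proj0_compose[OF D' D] .
qed

end

section \<open>Quadratic coderivations and bi-symmetric forms\<close>

context graded
begin

lemma slot_linear_cong:
  assumes "\<And>n x. x \<in> V n \<Longrightarrow> h x = h' x" "slot_linear s V h'"
  shows "slot_linear s V h"
  using assms V_closed unfolding slot_linear_def by metis

lemma slot_linear_sum:
  assumes h: "slot_linear s V h" and "finite A" "\<And>i. i \<in> A \<Longrightarrow> t i \<in> V k"
  shows "h (\<Sum>i\<in>A. t i) = (\<Sum>i\<in>A. h (t i)) \<and> (\<Sum>i\<in>A. t i) \<in> V k"
  using assms(2,3)
proof (induct A)
  case (insert i A)
  then have "h (t i + (\<Sum>i\<in>A. t i)) = h (t i) + h (\<Sum>i\<in>A. t i)"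
    using h unfolding slot_linear_def by blast
  then show ?case using insert V_closed(2) by simp
qed (simp add: slot_linear_0[OF V h] V_closed(1))

end

context quadratic
begin

lemma b_minus: "b (- x) z = - b x z" "b z (- x) = - b z x"
  using b_linear(4)[where n = 1] b_linear(8)[where n = 1] by (simp_all add: sg_def)

lemma Bform_V: "v \<in> V k \<Longrightarrow> Bform V b v y = sg (k - 1) (b v y)"
  using deg_eq[OF V, of v k] by (cases "v = 0") (simp_all add: Bform_def b_linear)

text \<open>Since b has degree 0, vectors with nonzero pairing have opposite degrees, hence equal
  parity in V[1]. So the sign in B can be read off from the given argument instead of the
  component.\<close>

lemma Bform_homog:
  assumes "homog V v" "homog V y"
  shows "Bform V b v y = sg (deg V y) (b v y)"
proof (cases "b v y = 0")
  case False
  obtain m n where mn: "v \<in> V m" "y \<in> V n" using assms by (auto simp: homog_def)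
  have "y \<noteq> 0" using False b_linear(7) by auto
  then have "deg V y = n - 1" using deg_eq[OF V mn(2)] by simp
  moreover have "m = - n" using b_graded(2)[OF mn False] by simp
  ultimately show ?thesis unfolding Bform_V[OF mn(1)] by (intro sg_cong) auto
qed (simp add: Bform_def)

lemma bcoders_iff:
  "D \<in> bcoders fin s V b n \<longleftrightarrow> D \<in> coders s V n \<and>
     (\<forall>xs y z. (\<forall>x\<in>set (xs @ [y, z]). homog V x) \<longrightarrow>
        sg (deg V z) (b (component s V D (xs @ [y])) z) =
        sg (deg V y * deg V z + deg V y) (b (component s V D (xs @ [z])) y)) \<and>
     (fin \<longrightarrow> finitary (component s V D))"
proof -
  have "(\<forall>xs y z. (\<forall>x\<in>set (xs @ [y, z]). homog V x) \<longrightarrow>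
      Bform V b (component s V D (xs @ [y])) z = sg (deg V y * deg V z) (Bform V b (component s V D (xs @ [z])) y))
    \<longleftrightarrow> (\<forall>xs y z. (\<forall>x\<in>set (xs @ [y, z]). homog V x) \<longrightarrow>
        sg (deg V z) (b (component s V D (xs @ [y])) z) =
        sg (deg V y * deg V z + deg V y) (b (component s V D (xs @ [z])) y))"
    if "D \<in> coders s V n"
    by (simp add: Bform_homog component(2)[OF that] sg_sg)
  then show ?thesis unfolding bcoders_def by blast
qed

lemma bcodersD:
  assumes "D \<in> bcoders fin s V b n"
  shows "D \<in> coders s V n" "fin \<Longrightarrow> finitary (component s V D)"
    "\<forall>x\<in>set (xs @ [y, z]). homog V x \<Longrightarrow> sg (deg V z) (b (component s V D (xs @ [y])) z) =
        sg (deg V y * deg V z + deg V y) (b (component s V D (xs @ [z])) y)"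
  using assms unfolding bcoders_iff by blast+

lemma snoc2_exhaust:
  obtains "length zs < 2" | xs y z where "zs = xs @ [y, z]"
proof (cases zs rule: rev_cases)
  case (snoc ws z)
  then show ?thesis using that by (cases ws rule: rev_cases) auto
qed (use that in simp)

lemma Omega_short: "length zs < 2 \<Longrightarrow> Omega s V b D zs = 0"
  by (simp add: Omega_def)

lemma Omega_snoc2:
  assumes "D \<in> bcoders fin s V b n"
  shows "Omega s V b D (xs @ [y, z]) = (if homog V z then 2 * sg (deg V z) (b (component s V D (xs @ [y])) z) else 0)"
proof (cases "\<forall>x\<in>set (xs @ [y, z]). homog V x")
  case True
  then show ?thesis
    using bcodersD(3)[OF assms True]
    by (simp add: Omega_def Bform_homog component(2)[OF bcodersD(1)[OF assms]] sg_sg nth_append)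
next
  case False
  moreover have "component s V D (xs @ [y]) = 0" if "homog V z"
    using False that by (intro sym_mapD(1)[OF sym_map_component[OF bcodersD(1)[OF assms]]]) auto
  ultimately show ?thesis by (auto simp: Omega_def b_linear)
qed

lemma Omega_lincomb:
  assumes D: "D \<in> coders s V n" and D': "D' \<in> coders s V n"
  shows "Omega s V b (\<lambda>p. D p + fscale c (D' p)) = Omega s V b D + fscale c (Omega s V b D')"
proof
  have B: "Bform V b (component s V (\<lambda>p. D p + fscale c (D' p)) zs) y
      = Bform V b (component s V D zs) y + c * Bform V b (component s V D' zs) y" for zs y
  proof -
    note v = component(1)[OF D, of zs] component(1)[OF D', of zs]
    show ?thesis
      unfolding component_lincomb[OF D D'] Bform_V[OF v(1)] Bform_V[OF v(2)]
        Bform_V[OF V_closed(2)[OF v(1) V_closed(3)[OF v(2)]]]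
      by (simp add: b_linear sg_plus sg_mult)
  qed
  show "Omega s V b (\<lambda>p. D p + fscale c (D' p)) zs = (Omega s V b D + fscale c (Omega s V b D')) zs" for zs
    by (simp add: Omega_def plus_fun_apply fscale_def B[unfolded fscale_def] Let_def sg_plus sg_mult algebra_simps)
qed

lemma finitary_lincomb:
  fixes f g :: "'v list \<Rightarrow> 'v"
  assumes "finitary f" "finitary g"
  shows "finitary (\<lambda>zs. f zs + s c (g zs))"
proof -
  obtain M N where "\<forall>zs. length zs > M \<longrightarrow> f zs = 0" "\<forall>zs. length zs > N \<longrightarrow> g zs = 0"
    using assms unfolding finitary_def by blast
  then have "\<forall>zs. length zs > max M N \<longrightarrow> f zs + s c (g zs) = 0" by simp
  then show ?thesis unfolding finitary_def by blast
qed

lemma bcoders_lincomb: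
  assumes D: "D \<in> bcoders fin s V b n" and D': "D' \<in> bcoders fin s V b n"
  shows "(\<lambda>p. D p + fscale c (D' p)) \<in> bcoders fin s V b n"
proof -
  note d = bcodersD[OF D] and d' = bcodersD[OF D']
  have C: "component s V (\<lambda>p. D p + fscale c (D' p)) = (\<lambda>zs. component s V D zs + s c (component s V D' zs))"
    by (rule ext) (rule component_lincomb[OF d(1) d'(1)])
  show ?thesis
    unfolding bcoders_iff C
    using d(3) d'(3) coders_lincomb[OF d(1) d'(1)] finitary_lincomb d(2) d'(2)
    by (simp add: b_linear sg_plus sg_mult(2)[symmetric])
qed

text \<open>The shift by 2 in the degree arises because b pairs opposite degrees of V, whose degrees
  in V[1] add up to -2.\<close>

lemma Omega_bisym:
  assumes D: "D \<in> bcoders fin s V b n"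
  shows "Omega s V b D \<in> bisym_deg fin s V (n + 2)"
proof -
  let ?f = "Omega s V b D" and ?c = "component s V D"
  note d = bcodersD[OF D] and f = Omega_snoc2[OF D]
  note c = sym_map_component[OF d(1)]
  have nh: "?f zs = 0" if "\<exists>z\<in>set zs. \<not> homog V z" for zs
    using that by (auto simp: Omega_def)
  have slot: "slot_linear s V (\<lambda>x. ?f (us @ x # ws))" for us ws
  proof (cases ws rule: rev_cases)
    case Nil
    show ?thesis
    proof (cases us rule: rev_cases)
      case us: (snoc xs y)
      have "slot_linear s V (\<lambda>x. 2 * sg (deg V x) (b (?c (xs @ [y])) x))"
        by (intro slot_linear_mult slot_linear_sg[OF V, of _ "\<lambda>n. n"]) (simp add: slot_linear_def b_linear)
      then show ?thesis
        by (rule slot_linear_cong[rotated]) (use f[of xs y] in \<open>auto simp: Nil us homog_def\<close>)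
    qed (simp add: Nil Omega_short slot_linear_zero)
  next
    case ws: (snoc w z)
    have "slot_linear s V (\<lambda>x. pair_form z (?c (us @ x # w) # []))"
      using sym_map_form_slot[OF V c, of "pair_form z" "[]" us w "[]"] pair_form_pforms by (simp add: pforms_def)
    then have *: "slot_linear s V (\<lambda>x. b (?c (us @ x # w)) z)"
      by (simp add: pair_form_def component(2)[OF d(1)])
    have g: "?f (us @ x # ws) = (if homog V z then 2 * sg (deg V z) (b (?c (us @ x # w)) z) else 0)" for x
    proof -
      obtain xs y where xs: "us @ x # w = xs @ [y]" by (metis rev_exhaust append_is_Nil_conv list.distinct(1))
      then have "us @ x # ws = xs @ [y, z]" by (simp add: ws)
      then show ?thesis using f[of xs y z] xs by simp
    qed
    show ?thesis
      unfolding g using * slot_linear_mult[OF slot_linear_sg[OF V *, of "\<lambda>_. deg V z"]] slot_linear_zero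
      by (cases "homog V z") auto
  qed
  \<comment> \<open>Symmetry in the last two variables is built into \<open>Omega\<close>. Earlier
    variables inherit the symmetry of the component, which applies because its own last argument u
    stays behind them.\<close>
  have swap: "?f (us @ x # y # ws) = sg (deg V x * deg V y) (?f (us @ y # x # ws))" if "length ws \<noteq> 1" for us x y ws
  proof (cases ws rule: rev_cases)
    case Nil
    show ?thesis by (auto simp: Nil Omega_def nth_append sg_def)
  next
    case (snoc w z)
    then obtain w' u where ws: "ws = (w' @ [u]) @ [z]" using \<open>length ws \<noteq> 1\<close> by (cases w rule: rev_cases) auto
    have "?c (us @ x # y # w' @ [u]) = sg (deg V x * deg V y) (?c (us @ y # x # w' @ [u]))"
      by (rule sym_mapD(6)[OF c]) simp
    then show ?thesis
      using f[of "us @ x # y # w'" u z] f[of "us @ y # x # w'" u z]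
      by (simp add: ws b_minus sg_def)
  qed
  have fin: "finitary ?f" if F: fin
  proof -
    obtain N where N: "\<And>zs. length zs > N \<Longrightarrow> ?c zs = 0" using d(2)[OF F] unfolding finitary_def by blast
    have "?f zs = 0" if "length zs > N + 1" for zs
      using N that f b_linear(3) Omega_short by (cases zs rule: snoc2_exhaust) auto
    then show ?thesis unfolding finitary_def by blast
  qed
  have "has_degree V (n + 2) ?f"
    unfolding has_degree_def
  proof (intro allI impI)
    fix zs assume nz: "?f zs \<noteq> 0"
    then obtain xs y z where zs: "zs = xs @ [y, z]"
      using Omega_short by (cases zs rule: snoc2_exhaust) auto
    have z: "homog V z" "b (?c (xs @ [y])) z \<noteq> 0"
      using nz f[of xs y z] by (auto simp: zs split: if_splits)
    then obtain k where k: "z \<in> V k" by (auto simp: homog_def)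
    have "z \<noteq> 0" using z b_linear(7) by auto
    then have "deg V z = k - 1" using deg_eq[OF V k] by simp
    moreover have "ldeg V (xs @ [y]) + n + 1 + k = 0"
      by (rule b_graded(2)[OF component(1)[OF d(1)] k z(2)])
    ultimately show "ldeg V zs = - (n + 2)" by (simp add: zs)
  qed
  moreover have "?f \<in> mforms s V"
    unfolding mforms_slot using nh slot by blast
  ultimately show ?thesis
    unfolding bisym_deg_def bisym_def using swap fin Omega_short by blast
qed

end

section \<open>Dual bases and the inverse of \<open>Omega\<close>\<close>

locale quadratic_bases = quadratic s V b
  for s :: "'k::field_char_0 \<Rightarrow> 'v::ab_group_add \<Rightarrow> 'v" and V :: "int \<Rightarrow> 'v set" and b :: "'v \<Rightarrow> 'v \<Rightarrow> 'k" +
  fixes E :: "('v \<times> 'v) list"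
  assumes E: "dual_bases s V b E"
begin

lemma dual:
  assumes "i < length E" "j < length E"
  shows "b (fst (E ! i)) (snd (E ! j)) = (if i = j then 1 else 0)"
  using E assms unfolding dual_bases_def by blast

lemma homog_bases:
  assumes "i < length E"
  shows "homog V (fst (E ! i))" "homog V (snd (E ! i))"
  using E nth_mem[OF assms] unfolding dual_bases_def by (auto simp: case_prod_unfold)

lemma expand:
  "(\<Sum>i<length E. s (b v (snd (E ! i))) (fst (E ! i))) = v"
  "(\<Sum>i<length E. s (b (fst (E ! i)) v) (snd (E ! i))) = v"
proof -
  have "v \<in> vs.span (fst ` set E)" "v \<in> vs.span (snd ` set E)" using E unfolding dual_bases_def by auto
  note span = this
  show "(\<Sum>i<length E. s (b v (snd (E ! i))) (fst (E ! i))) = v"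
  proof (rule vs.span_induct[OF span(1)])
    show "vs.subspace {v. (\<Sum>i<length E. s (b v (snd (E ! i))) (fst (E ! i))) = v}"
      unfolding vs.subspace_def
      by (auto simp: b_linear vs.scale_left_distrib sum.distrib vs.scale_scale[symmetric] vs.scale_sum_right[symmetric]
          simp del: vs.scale_scale)
    fix x assume "x \<in> fst ` set E"
    then obtain j where j: "j < length E" "x = fst (E ! j)" by (auto simp: in_set_conv_nth)
    have "(\<Sum>i<length E. s (b x (snd (E ! i))) (fst (E ! i))) = (\<Sum>i<length E. if i = j then fst (E ! i) else 0)"
      by (rule sum.cong) (auto simp: j dual)
    then show "(\<Sum>i<length E. s (b x (snd (E ! i))) (fst (E ! i))) = x" using j by simp
  qed
  show "(\<Sum>i<length E. s (b (fst (E ! i)) v) (snd (E ! i))) = v"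
  proof (rule vs.span_induct[OF span(2)])
    show "vs.subspace {v. (\<Sum>i<length E. s (b (fst (E ! i)) v) (snd (E ! i))) = v}"
      unfolding vs.subspace_def
      by (auto simp: b_linear vs.scale_left_distrib sum.distrib vs.scale_scale[symmetric] vs.scale_sum_right[symmetric]
          simp del: vs.scale_scale)
    fix x assume "x \<in> snd ` set E"
    then obtain j where j: "j < length E" "x = snd (E ! j)" by (auto simp: in_set_conv_nth)
    have "(\<Sum>i<length E. s (b (fst (E ! i)) x) (snd (E ! i))) = (\<Sum>i<length E. if i = j then snd (E ! i) else 0)"
      by (rule sum.cong) (auto simp: j dual)
    then show "(\<Sum>i<length E. s (b (fst (E ! i)) x) (snd (E ! i))) = x" using j by simp
  qed
qed

lemma dual_degree:
  assumes "i < length E" "snd (E ! i) \<in> V k"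
  shows "fst (E ! i) \<in> V (- k)" "deg V (snd (E ! i)) = k - 1" "deg V (fst (E ! i)) = - k - 1"
proof -
  obtain m where m: "fst (E ! i) \<in> V m" using homog_bases(1)[OF assms(1)] by (auto simp: homog_def)
  have nz: "b (fst (E ! i)) (snd (E ! i)) \<noteq> 0" using dual[OF assms(1,1)] by simp
  have "m = - k" using b_graded(2)[OF m assms(2) nz] by simp
  then show 1: "fst (E ! i) \<in> V (- k)" using m by simp
  have "snd (E ! i) \<noteq> 0" "fst (E ! i) \<noteq> 0" using nz b_linear(3,7) by auto
  then show "deg V (snd (E ! i)) = k - 1" "deg V (fst (E ! i)) = - k - 1"
    using deg_eq[OF V assms(2)] deg_eq[OF V 1] by auto
qed

text \<open>A slot is linear on each \<open>V k\<close> separately, so all terms of the expansion of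
  v must have the degree of v. They do, because b vanishes unless degrees are opposite. With this
  identity a contraction turns into a substitution.\<close>

lemma slot_linear_expand:
  assumes h: "slot_linear s V h" and v: "homog V v"
  shows "(\<Sum>i<length E. b v (snd (E ! i)) * h (fst (E ! i))) = h v"
    "(\<Sum>i<length E. b (fst (E ! i)) v * h (snd (E ! i))) = h v"
proof -
  obtain k where k: "v \<in> V k" using v by (auto simp: homog_def)
  have sc: "h (s c x) = c * h x" if "homog V x" for c x
    using h that unfolding slot_linear_def homog_def by blast
  have "s (b v (snd (E ! i))) (fst (E ! i)) \<in> V k" "s (b (fst (E ! i)) v) (snd (E ! i)) \<in> V k"
    if i: "i < length E" for i
  proof -
    obtain l where l: "snd (E ! i) \<in> V l" using homog_bases(2)[OF i] by (auto simp: homog_def)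
    note dd = dual_degree(1)[OF i l]
    show "s (b v (snd (E ! i))) (fst (E ! i)) \<in> V k"
    proof (cases "b v (snd (E ! i)) = 0")
      case False
      then have "- l = k" using b_graded(2)[OF k l] by simp
      then show ?thesis using V_closed(3)[OF dd] by simp
    qed (simp add: V_closed(1))
    show "s (b (fst (E ! i)) v) (snd (E ! i)) \<in> V k"
    proof (cases "b (fst (E ! i)) v = 0")
      case False
      then have "l = k" using b_graded(2)[OF dd k] by simp
      then show ?thesis using V_closed(3)[OF l] by simp
    qed (simp add: V_closed(1))
  qed
  then show "(\<Sum>i<length E. b v (snd (E ! i)) * h (fst (E ! i))) = h v"
    "(\<Sum>i<length E. b (fst (E ! i)) v * h (snd (E ! i))) = h v"
    using slot_linear_sum[OF h, of "{..<length E}" "\<lambda>i. s (b v (snd (E ! i))) (fst (E ! i))" k]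
      slot_linear_sum[OF h, of "{..<length E}" "\<lambda>i. s (b (fst (E ! i)) v) (snd (E ! i))" k]
    by (simp_all add: expand sc homog_bases)
qed

text \<open>\<open>Omega\<close> tests components against homogeneous vectors only, but the e'_i are
  homogeneous and the coefficients b(v, e'_i) determine v. The component at the empty list,
  invisible to \<open>Omega\<close>, is 0.\<close>

lemma Omega_inj:
  assumes D: "D \<in> bcoders fin s V b n" and D': "D' \<in> bcoders fin s V b n"
    and eq: "Omega s V b D = Omega s V b D'"
  shows "D = D'"
proof (rule component_inj[OF bcodersD(1)[OF D] bcodersD(1)[OF D']], rule ext)
  fix zs
  show "component s V D zs = component s V D' zs"
  proof (cases zs rule: rev_cases)
    case Nil
    then show ?thesis
      using component_zero[OF bcodersD(1)[OF D] mon_Nil] component_zero[OF bcodersD(1)[OF D'] mon_Nil] by simp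
  next
    case (snoc xs y)
    have "b (component s V D zs) z = b (component s V D' zs) z" if "homog V z" for z
      using fun_cong[OF eq, of "xs @ [y, z]"] that
      unfolding Omega_snoc2[OF D] Omega_snoc2[OF D'] by (auto simp: snoc sg_def split: if_splits)
    then have "(\<Sum>i<length E. s (b (component s V D zs) (snd (E ! i))) (fst (E ! i)))
        = (\<Sum>i<length E. s (b (component s V D' zs) (snd (E ! i))) (fst (E ! i)))"
      by (simp add: homog_bases)
    then show ?thesis by (simp only: expand)
  qed
qed

text \<open>The solution c of 2 * (-1)^(deg z) b(c(zs), z) = f(zs, z): by duality the coefficient of
  e_i is the pairing with e'_i, which this equation prescribes.\<close>

definition form_component :: "('v list \<Rightarrow> 'k) \<Rightarrow> 'v list \<Rightarrow> 'v" where
  "form_component f zs = (\<Sum>i<length E. s (sg (deg V (snd (E ! i))) (f (zs @ [snd (E ! i)]) / 2)) (fst (E ! i)))"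

lemma Omega_surj:
  assumes f: "f \<in> bisym_deg fin s V (n + 2)"
  obtains D where "D \<in> bcoders fin s V b n" "Omega s V b D = f"
proof -
  have fm: "f \<in> mforms s V" and f2: "\<And>zs. length zs < 2 \<Longrightarrow> f zs = 0"
    and fs: "\<And>us x y ws. length ws \<noteq> 1 \<Longrightarrow> f (us @ x # y # ws) = sg (deg V x * deg V y) (f (us @ y # x # ws))"
    and ff: "fin \<Longrightarrow> finitary f" and fd: "\<And>zs. f zs \<noteq> 0 \<Longrightarrow> ldeg V zs = - (n + 2)"
    using f unfolding bisym_deg_def bisym_def has_degree_def by blast+
  have f0: "f zs = 0" if "\<exists>z\<in>set zs. \<not> homog V z" for zs using fm that unfolding mforms_slot by blast
  have slot: "slot_linear s V (\<lambda>x. f (us @ x # ws))" for us ws using fm unfolding mforms_slot by blast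
  let ?c = "form_component f"
  have sg2: "sg k (x / 2) = sg k x / 2" for k and x :: 'k by (simp add: sg_def)
  have s_sg: "s (sg k x) v = sg k (s x v)" for k x v by (simp add: sg_def)
  have c: "sym_map s V n ?c"
    unfolding sym_map_def
  proof (intro conjI allI ballI impI)
    fix zs assume "\<exists>z\<in>set zs. \<not> homog V z"
    then show "?c zs = 0" using f0 by (simp add: form_component_def)
  next
    fix zs
    have "s (sg (deg V (snd (E ! i))) (f (zs @ [snd (E ! i)]) / 2)) (fst (E ! i)) \<in> V (ldeg V zs + n + 1)"
      if i: "i < length E" for i
    proof (cases "f (zs @ [snd (E ! i)]) = 0")
      case False
      obtain l where l: "snd (E ! i) \<in> V l" using homog_bases(2)[OF i] by (auto simp: homog_def)
      have "ldeg V zs + n + 1 = - l" using fd[OF False] dual_degree(2)[OF i l] by simp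
      then show ?thesis using V_closed(3)[OF dual_degree(1)[OF i l]] by simp
    qed (simp add: V_closed(1))
    then show "?c zs \<in> V (ldeg V zs + n + 1)"
      unfolding form_component_def
      using slot_linear_sum[OF slot_linear_zero, of "{..<length E}" _ "ldeg V zs + n + 1"] by simp
  next
    fix us ws k x y assume "x \<in> V k" "y \<in> V k"
    then have "f ((us @ (x + y) # ws) @ [z]) = f ((us @ x # ws) @ [z]) + f ((us @ y # ws) @ [z])" for z
      using slot[of us "ws @ [z]"] unfolding slot_linear_def by simp
    then show "?c (us @ (x + y) # ws) = ?c (us @ x # ws) + ?c (us @ y # ws)"
      unfolding form_component_def sum.distrib[symmetric]
      by (simp only: add_divide_distrib sg_plus vs.scale_left_distrib)
  next
    fix us ws k x a assume "x \<in> V k"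
    then have "f ((us @ s a x # ws) @ [z]) = a * f ((us @ x # ws) @ [z])" for z
      using slot[of us "ws @ [z]"] unfolding slot_linear_def by simp
    then show "?c (us @ s a x # ws) = s a (?c (us @ x # ws))"
      unfolding form_component_def vs.scale_sum_right
      by (simp only: vs.scale_scale sg_mult times_divide_eq_right)
  next
    fix us x y and ws :: "'v list" assume "ws \<noteq> []"
    then have "f ((us @ x # y # ws) @ [z]) = sg (deg V x * deg V y) (f ((us @ y # x # ws) @ [z]))" for z
      using fs[of "ws @ [z]" us x y] by simp
    then show "?c (us @ x # y # ws) = sg (deg V x * deg V y) (?c (us @ y # x # ws))"
      unfolding form_component_def sg_sum
      by (intro sum.cong refl) (simp only: sg2[symmetric] s_sg sg_sg add.commute)
  qed
  define D where "D = coder_ext s V n ?c"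
  \<comment> \<open>Forms in \<open>bisym\<close> have arity at least 2, so the map takes at least
    one argument, as \<open>component_coder_ext\<close> demands.\<close>
  have "?c [] = 0" using f2 by (simp add: form_component_def)
  then have comp: "component s V D = ?c" unfolding D_def by (rule component_coder_ext[OF c])
  \<comment> \<open>The equation holds by construction for z = e'_i; its right side is linear in the
    slot, so expanding y in the e'_i extends it to every homogeneous y.\<close>
  have bc: "b (?c zs) y = sg (deg V y) (f (zs @ [y])) / 2" if y: "homog V y" for zs y
  proof -
    have "slot_linear s V (\<lambda>y. sg (deg V y) (f (zs @ [y])))"
      using slot_linear_sg[OF V slot[of zs "[]"], of "\<lambda>n. n"] by simp
    from slot_linear_expand(2)[OF slot_linear_mult[OF this, of "1 / 2"] y]
    have "(\<Sum>i<length E. sg (deg V (snd (E ! i))) (f (zs @ [snd (E ! i)]) / 2) * b (fst (E ! i)) y)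
        = sg (deg V y) (f (zs @ [y])) / 2" by (simp add: sg2 mult.commute)
    moreover have "b (sum t A) y = (\<Sum>i\<in>A. b (t i) y)" for t and A :: "nat set"
      by (induct A rule: infinite_finite_induct) (simp_all add: b_linear)
    ultimately show ?thesis by (simp add: form_component_def b_linear)
  qed
  have D: "D \<in> bcoders fin s V b n"
    unfolding bcoders_iff comp
  proof (intro conjI allI impI)
    show "D \<in> coders s V n" unfolding D_def by (rule coder_ext_coders[OF c])
    fix xs y z assume h: "\<forall>x\<in>set (xs @ [y, z]). homog V x"
    then have e: "b (?c (xs @ [y])) z = sg (deg V z) (f (xs @ [y, z])) / 2"
      "b (?c (xs @ [z])) y = sg (deg V y) (f (xs @ [z, y])) / 2"
      using bc[of z "xs @ [y]"] bc[of y "xs @ [z]"] by simp_all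
    have "f (xs @ [y, z]) = sg (deg V y * deg V z) (f (xs @ [z, y]))"
      using fs[of "[]" xs y z] by simp
    then show "sg (deg V z) (b (?c (xs @ [y])) z) = sg (deg V y * deg V z + deg V y) (b (?c (xs @ [z])) y)"
      unfolding e by (auto simp: sg_def)
  next
    assume fin
    then obtain N where N: "\<And>zs. length zs > N \<Longrightarrow> f zs = 0" using ff unfolding finitary_def by blast
    then have "\<forall>zs. length zs > N \<longrightarrow> ?c zs = 0" by (simp add: form_component_def)
    then show "finitary ?c" unfolding finitary_def by blast
  qed
  moreover have "Omega s V b D zs = f zs" for zs
  proof (cases zs rule: snoc2_exhaust)
    case 1
    then show ?thesis by (simp add: Omega_short f2)
  next
    case (2 xs y z)
    show ?thesis
    proof (cases "homog V z")
      case True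
      then show ?thesis
        unfolding 2 Omega_snoc2[OF D] comp bc[OF True, of "xs @ [y]"] by (auto simp: sg_def)
    next
      case False
      then show ?thesis using f0[of zs] by (simp add: 2 Omega_snoc2[OF D])
    qed
  qed
  ultimately show ?thesis using that by blast
qed

end

section \<open>The bracket as a commutator\<close>

lemma bracket_snoc2:
  "bracket V E h h' (xs @ [y, z]) =
     unshuffle1 V (\<lambda>I x J. contract V E h h' I [x] [] (J @ [y, z])) xs
     + unshuffle1 V (\<lambda>I x J. sg (deg V x * ldeg V J + (deg V y + deg V z) * (ldeg V J + deg V x))
         (contract V E h h' [] (I @ [y, z]) J [x])) xs
     + unshuffle V (\<lambda>I J. sg (deg V y * ldeg V J) (contract V E h h' I [y] J [z])
         + sg (deg V z * ldeg V J + deg V y * deg V z) (contract V E h h' I [z] J [y])) xs"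
  by (simp add: bracket_def nth_append)

context quadratic
begin

lemma bisym_swap:
  assumes "f \<in> bisym_deg fin s V n" "length ws \<noteq> 1"
  shows "f (us @ x # y # ws) = sg (deg V x * deg V y) (f (us @ y # x # ws))"
  using assms unfolding bisym_deg_def bisym_def by blast

lemma bisym_slot: "f \<in> bisym_deg fin s V n \<Longrightarrow> slot_linear s V (\<lambda>x. f (us @ x # ws))"
  unfolding bisym_deg_def bisym_def mforms_slot by blast

text \<open>The letter crosses the whole symmetric block but must stop before the last two
  variables, where symmetry with the first ones ends.\<close>

lemma bisym_move:
  assumes f: "f \<in> bisym_deg fin s V n"
  shows "f (us @ x # I @ [y, z]) = sg (deg V x * ldeg V I) (f (us @ I @ x # [y, z]))"
proof (induct I arbitrary: us)
  case (Cons u I)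
  have "f (us @ x # (u # I) @ [y, z]) = sg (deg V x * deg V u) (f ((us @ [u]) @ x # I @ [y, z]))"
    using bisym_swap[OF f, of "I @ [y, z]" us x u] by simp
  then show ?case unfolding Cons by (simp add: sg_sg algebra_simps)
qed simp

text \<open>The symmetry sign is (-1)^(m n). Where b is nonzero, m = -n, so the exponent has the
  parity of n, which is the degree of w in V[1] plus 1.\<close>

lemma b_sym_homog:
  assumes "homog V v" "homog V w"
  shows "b v w = sg (deg V w + 1) (b w v)"
proof -
  obtain m n where mn: "v \<in> V m" "w \<in> V n" using assms by (auto simp: homog_def)
  note sym = b_graded(1)[OF mn]
  show ?thesis
  proof (cases "b v w = 0")
    case False
    have "m + n = 0" by (rule b_graded(2)[OF mn False])
    moreover have "deg V w = n - 1" using deg_eq[OF V mn(2)] False b_linear(7) by auto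
    ultimately have "even (deg V w + 1) = even (m * n)" by (cases "even n") (auto simp: add_eq_0_iff)
    then show ?thesis unfolding sym by (intro sg_cong) auto
  qed (use sym in \<open>simp add: sg_def split: if_splits\<close>)
qed

lemma b_eq_0_sym: "homog V v \<Longrightarrow> homog V w \<Longrightarrow> b v w = 0 \<longleftrightarrow> b w v = 0"
  using b_sym_homog sg_zero by metis

text \<open>Where the pairing is nonzero, the parity of w is determined by the arguments. Such
  relations eliminate the degree of the contracted basis vector from the signs.\<close>

lemma component_parity:
  assumes D: "D \<in> coders s V n" and w: "homog V w" and nz: "b (component s V D zs) w \<noteq> 0"
  shows "even (ldeg V zs + n + deg V w)"
proof -
  obtain k where k: "w \<in> V k" using w by (auto simp: homog_def)
  have "deg V w = k - 1" using deg_eq[OF V k] nz b_linear(7) by auto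
  moreover have "ldeg V zs + n + 1 + k = 0" by (rule b_graded(2)[OF component(1)[OF D] k nz])
  ultimately have "ldeg V zs + n + deg V w = - 2" by simp
  then show ?thesis by simp
qed

lemma Omega_parity:
  assumes "D \<in> bcoders fin s V b n" "Omega s V b D zs \<noteq> 0"
  shows "even (ldeg V zs + n)"
  using Omega_bisym[OF assms(1)] assms(2) unfolding bisym_deg_def has_degree_def by simp

text \<open>The contracted letter occupies the first of the last two variables. Exchanging these
  brings it to the final place, where \<open>Omega\<close> is a pairing with the component.\<close>

lemma Omega_contracted:
  assumes D: "D \<in> bcoders fin s V b n" and e: "homog V e"
  shows "Omega s V b D (I @ e # [x]) = sg (deg V e * deg V x + deg V e) (2 * b (component s V D (I @ [x])) e)"
  using bisym_swap[OF Omega_bisym[OF D], of "[]" I e x] Omega_snoc2[OF D, of I x e] e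
  by (simp add: sg_sg sg_mult)

end

context quadratic_bases
begin

lemma dual_parity:
  assumes "i < length E"
  shows "even (deg V (snd (E ! i))) = even (deg V (fst (E ! i)))"
proof -
  obtain k where "snd (E ! i) \<in> V k" using homog_bases(2)[OF assms] by (auto simp: homog_def)
  then show ?thesis using dual_degree(2,3)[OF assms] by auto
qed

lemma contract_sum:
  "contract V E f g A C A' C' = (\<Sum>i<length E.
     sg ((ldeg V A' + deg V (fst (E ! i)) + ldeg V C') * (ldeg V A + deg V (fst (E ! i)) + ldeg V C)
         + deg V (fst (E ! i)) * (ldeg V C + ldeg V A'))
       (f (A @ fst (E ! i) # C) * g (A' @ snd (E ! i) # C')))"
  unfolding contract_def sum_list_sum_nth by (simp add: case_prod_unfold atLeast0LessThan)

context
  fixes fin D D' m n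
  assumes D: "D \<in> bcoders fin s V b m" and D': "D' \<in> bcoders fin s V b n"
begin

abbreviation (input) "cmp \<equiv> component s V D"
abbreviation (input) "cmp' \<equiv> component s V D'"
abbreviation (input) "omg \<equiv> Omega s V b D"
abbreviation (input) "omg' \<equiv> Omega s V b D'"

lemma homog_component: "homog V (cmp zs)" "homog V (cmp' zs)"
  using component(2) bcodersD(1)[OF D] bcodersD(1)[OF D'] by blast+

text \<open>The form of D has e_i among its last two variables, hence is a pairing of its component
  with e_i; summing over i inserts that component into the form of D'. The expansion in the e'_i
  requires the order b(e_i, v), and turning b(v, e_i) around produces the overall minus sign of D' D
  in the commutator.\<close>

lemma contract_1:
  "contract V E omg omg' I [x] [] (J @ [y, z])
    = - sg (m * n + ldeg V J * (ldeg V I + deg V x + m)) (2 * omg' (J @ cmp (I @ [x]) # [y, z]))"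
proof -
  let ?v = "cmp (I @ [x])"
  have *: "sg ((ldeg V [] + deg V e + ldeg V (J @ [y, z])) * (ldeg V I + deg V e + ldeg V [x])
          + deg V e * (ldeg V [x] + ldeg V [])) (omg (I @ e # [x]) * omg' ([] @ e' # (J @ [y, z])))
      = - sg (m * n + ldeg V J * (ldeg V I + deg V x + m)) (2 * (b e ?v * omg' (J @ e' # [y, z])))"
    if ee: "homog V e" "homog V e'" "even (deg V e') = even (deg V e)" for e e'
  proof (cases "b ?v e = 0 \<or> omg' (J @ e' # [y, z]) = 0")
    case True
    then have "b e ?v = 0 \<or> omg' (J @ e' # [y, z]) = 0"
      using b_eq_0_sym[OF ee(1) homog_component(1), of "I @ [x]"] by simp
    then show ?thesis
      using True bisym_move[OF Omega_bisym[OF D'], of "[]" e' J y z] by (auto simp: Omega_contracted[OF D ee(1)])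
  next
    case False
    have 1: "even (ldeg V I + deg V x + m + deg V e)"
      using component_parity[OF bcodersD(1)[OF D] ee(1), of "I @ [x]"] False by simp
    have 2: "even (ldeg V J + deg V e + deg V y + deg V z + n)"
      using Omega_parity[OF D', of "J @ e' # [y, z]"] False ee(3) by (simp; argo)
    have A: "omg (I @ e # [x]) * omg' (e' # J @ [y, z])
        = sg (deg V e * deg V x + deg V e + (deg V e + 1) + deg V e' * ldeg V J) (2 * (b e ?v * omg' (J @ e' # [y, z])))"
      using bisym_move[OF Omega_bisym[OF D'], of "[]" e' J y z]
      unfolding Omega_contracted[OF D ee(1)] b_sym_homog[OF homog_component(1) ee(1)]
      by (simp add: sg_mult sg_sg add_ac mult.assoc)
    have N: "- sg k t = sg (k + 1) t" for k and t :: 'k by (simp add: sg_def)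
    \<comment> \<open>Both products are nonzero here, so facts 1 and 2 relate the parities involved;
      with them the equality of the two exponents modulo 2 is a propositional matter.\<close>
    show ?thesis
      unfolding append_Nil A N sg_sg using 1 2 ee(3) by (intro sg_cong refl) (simp; argo)
  qed
  have "contract V E omg omg' I [x] [] (J @ [y, z]) = (\<Sum>i<length E.
      - sg (m * n + ldeg V J * (ldeg V I + deg V x + m)) (2 * (b (fst (E ! i)) ?v * omg' (J @ snd (E ! i) # [y, z]))))"
    unfolding contract_sum by (intro sum.cong refl *) (simp_all add: homog_bases dual_parity)
  also have "\<dots> = - sg (m * n + ldeg V J * (ldeg V I + deg V x + m))
      (2 * (\<Sum>i<length E. b (fst (E ! i)) ?v * omg' (J @ snd (E ! i) # [y, z])))"
    unfolding sum_negf sg_sum sum_distrib_left ..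
  finally show ?thesis
    unfolding slot_linear_expand(2)[OF bisym_slot[OF Omega_bisym[OF D'], of J "[y, z]"] homog_component(1)] .
qed

text \<open>Now the form of D' supplies the pairing. It already has the order b(v, e'_i) in which
  the e_i expand, so no minus sign appears and the result belongs to D D'.\<close>

lemma contract_2:
  "sg (deg V x * ldeg V J + (deg V y + deg V z) * (ldeg V J + deg V x)) (contract V E omg omg' [] (I @ [y, z]) J [x])
    = sg (deg V x * ldeg V J + n * ldeg V I) (2 * omg (I @ cmp' (J @ [x]) # [y, z]))"
proof -
  let ?v = "cmp' (J @ [x])"
  have *: "sg (deg V x * ldeg V J + (deg V y + deg V z) * (ldeg V J + deg V x))
      (sg ((ldeg V J + deg V e + ldeg V [x]) * (ldeg V [] + deg V e + ldeg V (I @ [y, z]))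
          + deg V e * (ldeg V (I @ [y, z]) + ldeg V J)) (omg ([] @ e # (I @ [y, z])) * omg' (J @ e' # [x])))
      = sg (deg V x * ldeg V J + n * ldeg V I) (2 * (b ?v e' * omg (I @ e # [y, z])))"
    if ee: "homog V e" "homog V e'" "even (deg V e') = even (deg V e)" for e e'
  proof (cases "b ?v e' = 0 \<or> omg (I @ e # [y, z]) = 0")
    case True
    then show ?thesis
      using bisym_move[OF Omega_bisym[OF D], of "[]" e I y z] by (auto simp: Omega_contracted[OF D' ee(2)])
  next
    case False
    have 1: "even (ldeg V J + deg V x + n + deg V e)"
      using component_parity[OF bcodersD(1)[OF D'] ee(2), of "J @ [x]"] False ee(3) by (simp; argo)
    have 2: "even (ldeg V I + deg V e + deg V y + deg V z + m)"
      using Omega_parity[OF D, of "I @ e # [y, z]"] False by (simp add: add_ac)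
    have A: "omg (e # I @ [y, z]) * omg' (J @ e' # [x])
        = sg (deg V e' * deg V x + deg V e' + deg V e * ldeg V I) (2 * (b ?v e' * omg (I @ e # [y, z])))"
      using bisym_move[OF Omega_bisym[OF D], of "[]" e I y z]
      unfolding Omega_contracted[OF D' ee(2)]
      by (simp add: sg_mult sg_sg ac_simps)
    show ?thesis
      unfolding append_Nil A sg_sg using 1 2 ee(3) by (intro sg_cong refl) (simp; argo)
  qed
  have "sg (deg V x * ldeg V J + (deg V y + deg V z) * (ldeg V J + deg V x)) (contract V E omg omg' [] (I @ [y, z]) J [x])
      = (\<Sum>i<length E. sg (deg V x * ldeg V J + n * ldeg V I)
          (2 * (b ?v (snd (E ! i)) * omg (I @ fst (E ! i) # [y, z]))))"
    unfolding contract_sum sg_sum by (intro sum.cong refl *) (simp_all add: homog_bases dual_parity)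
  also have "\<dots> = sg (deg V x * ldeg V J + n * ldeg V I)
      (2 * (\<Sum>i<length E. b ?v (snd (E ! i)) * omg (I @ fst (E ! i) # [y, z])))"
    unfolding sg_sum sum_distrib_left ..
  finally show ?thesis
    unfolding slot_linear_expand(1)[OF bisym_slot[OF Omega_bisym[OF D], of I "[y, z]"] homog_component(2)] .
qed

text \<open>The argument of \<open>contract_1\<close> with y as the letter absorbed by D. It yields
  the terms of D' D in which y is an argument of the inner map, while z remains the vector paired
  with the outcome.\<close>

lemma contract_3:
  "sg (deg V y * ldeg V J) (contract V E omg omg' I [y] J [z])
    = - sg (m * n + ldeg V J * ldeg V I + ldeg V J * m) (2 * omg' (J @ cmp (I @ [y]) # [z]))"
proof -
  let ?v = "cmp (I @ [y])"
  have *: "sg (deg V y * ldeg V J)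
      (sg ((ldeg V J + deg V e + ldeg V [z]) * (ldeg V I + deg V e + ldeg V [y])
          + deg V e * (ldeg V [y] + ldeg V J)) (omg (I @ e # [y]) * omg' (J @ e' # [z])))
      = - sg (m * n + ldeg V J * ldeg V I + ldeg V J * m) (2 * (b e ?v * omg' (J @ e' # [z])))"
    if ee: "homog V e" "homog V e'" "even (deg V e') = even (deg V e)" for e e'
  proof (cases "b ?v e = 0 \<or> omg' (J @ e' # [z]) = 0")
    case True
    then have "b e ?v = 0 \<or> omg' (J @ e' # [z]) = 0"
      using b_eq_0_sym[OF ee(1) homog_component(1), of "I @ [y]"] by simp
    then show ?thesis
      using True by (auto simp: Omega_contracted[OF D ee(1)])
  next
    case False
    have 1: "even (ldeg V I + deg V y + m + deg V e)"
      using component_parity[OF bcodersD(1)[OF D] ee(1), of "I @ [y]"] False by simp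
    have 2: "even (ldeg V J + deg V e + deg V z + n)"
      using Omega_parity[OF D', of "J @ e' # [z]"] False ee(3) by (simp; argo)
    have A: "omg (I @ e # [y]) * omg' (J @ e' # [z])
        = sg (deg V e * deg V y + deg V e + (deg V e + 1)) (2 * (b e ?v * omg' (J @ e' # [z])))"
      unfolding Omega_contracted[OF D ee(1)] b_sym_homog[OF homog_component(1) ee(1)]
      by (simp add: sg_mult sg_sg add_ac mult.assoc)
    have N: "- sg k t = sg (k + 1) t" for k and t :: 'k by (simp add: sg_def)
    show ?thesis
      unfolding append_Nil A N sg_sg using 1 2 ee(3) by (intro sg_cong refl) (simp; argo)
  qed
  have "sg (deg V y * ldeg V J) (contract V E omg omg' I [y] J [z]) = (\<Sum>i<length E.
      - sg (m * n + ldeg V J * ldeg V I + ldeg V J * m) (2 * (b (fst (E ! i)) ?v * omg' (J @ snd (E ! i) # [z]))))"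
    unfolding contract_sum sg_sum by (intro sum.cong refl *) (simp_all add: homog_bases dual_parity)
  also have "\<dots> = - sg (m * n + ldeg V J * ldeg V I + ldeg V J * m)
      (2 * (\<Sum>i<length E. b (fst (E ! i)) ?v * omg' (J @ snd (E ! i) # [z])))"
    unfolding sum_negf sg_sum sum_distrib_left ..
  finally show ?thesis
    unfolding slot_linear_expand(2)[OF bisym_slot[OF Omega_bisym[OF D'], of J "[z]"] homog_component(1)] .
qed

text \<open>The counterpart for D D': the form of D' absorbs y, and its component is inserted into
  the form of D next to z.\<close>

lemma contract_4:
  "sg (deg V z * ldeg V J + deg V y * deg V z) (contract V E omg omg' I [z] J [y])
    = sg (n * ldeg V I) (2 * omg (I @ cmp' (J @ [y]) # [z]))"
proof -
  let ?v = "cmp' (J @ [y])"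
  have *: "sg (deg V z * ldeg V J + deg V y * deg V z)
      (sg ((ldeg V J + deg V e + ldeg V [y]) * (ldeg V I + deg V e + ldeg V [z])
          + deg V e * (ldeg V [z] + ldeg V J)) (omg (I @ e # [z]) * omg' (J @ e' # [y])))
      = sg (n * ldeg V I) (2 * (b ?v e' * omg (I @ e # [z])))"
    if ee: "homog V e" "homog V e'" "even (deg V e') = even (deg V e)" for e e'
  proof (cases "b ?v e' = 0 \<or> omg (I @ e # [z]) = 0")
    case True
    then show ?thesis by (auto simp: Omega_contracted[OF D' ee(2)])
  next
    case False
    have 1: "even (ldeg V J + deg V y + n + deg V e)"
      using component_parity[OF bcodersD(1)[OF D'] ee(2), of "J @ [y]"] False ee(3) by (simp; argo)
    have 2: "even (ldeg V I + deg V e + deg V z + m)"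
      using Omega_parity[OF D, of "I @ e # [z]"] False by (simp add: add_ac)
    have A: "omg (I @ e # [z]) * omg' (J @ e' # [y])
        = sg (deg V e' * deg V y + deg V e') (2 * (b ?v e' * omg (I @ e # [z])))"
      unfolding Omega_contracted[OF D' ee(2)] by (simp add: sg_mult sg_sg ac_simps)
    show ?thesis
      unfolding append_Nil A sg_sg using 1 2 ee(3) by (intro sg_cong refl) (simp; argo)
  qed
  have "sg (deg V z * ldeg V J + deg V y * deg V z) (contract V E omg omg' I [z] J [y]) = (\<Sum>i<length E.
      sg (n * ldeg V I) (2 * (b ?v (snd (E ! i)) * omg (I @ fst (E ! i) # [z]))))"
    unfolding contract_sum sg_sum by (intro sum.cong refl *) (simp_all add: homog_bases dual_parity)
  also have "\<dots> = sg (n * ldeg V I) (2 * (\<Sum>i<length E. b ?v (snd (E ! i)) * omg (I @ fst (E ! i) # [z])))"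
    unfolding sg_sum sum_distrib_left ..
  finally show ?thesis
    unfolding slot_linear_expand(1)[OF bisym_slot[OF Omega_bisym[OF D], of I "[z]"] homog_component(2)] .
qed

text \<open>Contractions 2 and 4 make up D D', contractions 1 and 3 make up D' D with its sign. The
  constant 4 collects a factor 2 from each \<open>Omega\<close>.\<close>

lemma bracket_Omega_snoc2:
  assumes z: "homog V z"
  shows "bracket V E omg omg' (xs @ [y, z]) = 4 * sg (deg V z) (b (component s V (commutator m D n D') (xs @ [y])) z)"
proof -
  note fg = Omega_snoc2[OF D] Omega_snoc2[OF D']
  have v: "omg (I @ v # [y, z]) = 2 * sg (deg V z) (b (cmp (I @ [v, y])) z)"
    "omg' (I @ v # [y, z]) = 2 * sg (deg V z) (b (cmp' (I @ [v, y])) z)"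
    "omg (I @ v # [z]) = 2 * sg (deg V z) (b (cmp (I @ [v])) z)"
    "omg' (I @ v # [z]) = 2 * sg (deg V z) (b (cmp' (I @ [v])) z)" for I v
    using fg(1)[of "I @ [v]" y z] fg(2)[of "I @ [v]" y z] fg(1)[of I v z] fg(2)[of I v z] z by simp_all
  have fac: "sg k (2 * (2 * sg (deg V z) t)) = 4 * sg (deg V z) 1 * sg k t" for k and t :: 'k
    by (simp add: sg_def)
  have 1: "unshuffle1 V (\<lambda>I x J. contract V E omg omg' I [x] [] (J @ [y, z])) xs
    = 4 * sg (deg V z) 1 * - sg (m * n)
        (unshuffle1 V (\<lambda>I x J. sg (deg V x * ldeg V J + m * ldeg V I) (b (cmp' (I @ [cmp (J @ [x]), y])) z)) xs)"
  proof -
    have "unshuffle1 V (\<lambda>I x J. contract V E omg omg' I [x] [] (J @ [y, z])) xs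
      = unshuffle1 V (\<lambda>I x J. 4 * sg (deg V z) 1 * - sg (m * n)
          (sg (ldeg V J * (ldeg V I + deg V x + m)) (b (cmp' (J @ [cmp (I @ [x]), y])) z))) xs"
      unfolding contract_1 v fac sg_sg by simp
    also have "\<dots> = 4 * sg (deg V z) 1 * - sg (m * n)
        (unshuffle1 V (\<lambda>I x J. sg (ldeg V J * (ldeg V I + deg V x + m)) (b (cmp' (J @ [cmp (I @ [x]), y])) z)) xs)"
      by (rule unshuffle1_hom[symmetric]) (auto simp: sg_def algebra_simps)
    \<comment> \<open>In the contraction the absorbed block comes first, in
      \<open>compose_form\<close> it comes last; reversing the blocks around x accounts for the
      remaining sign.\<close>
    also have "unshuffle1 V (\<lambda>I x J. sg (ldeg V J * (ldeg V I + deg V x + m)) (b (cmp' (J @ [cmp (I @ [x]), y])) z)) xs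
      = unshuffle1 V (\<lambda>I x J. sg (deg V x * ldeg V J + m * ldeg V I) (b (cmp' (I @ [cmp (J @ [x]), y])) z)) xs"
      by (subst unshuffle1_rev, intro unshuffle1_cong, unfold sg_sg, intro sg_cong refl) (simp; argo)
    finally show ?thesis .
  qed
  have 2: "unshuffle1 V (\<lambda>I x J. sg (deg V x * ldeg V J + (deg V y + deg V z) * (ldeg V J + deg V x))
         (contract V E omg omg' [] (I @ [y, z]) J [x])) xs
    = 4 * sg (deg V z) 1 *
        unshuffle1 V (\<lambda>I x J. sg (deg V x * ldeg V J + n * ldeg V I) (b (cmp (I @ [cmp' (J @ [x]), y])) z)) xs"
    unfolding contract_2 v fac unshuffle1_mult ..
  have 3: "unshuffle V (\<lambda>I J. sg (deg V y * ldeg V J) (contract V E omg omg' I [y] J [z])) xs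
    = 4 * sg (deg V z) 1 * - sg (m * n)
        (unshuffle V (\<lambda>I J. sg (m * ldeg V I) (b (cmp' (I @ [cmp (J @ [y])])) z)) xs)"
  proof -
    have "unshuffle V (\<lambda>I J. sg (deg V y * ldeg V J) (contract V E omg omg' I [y] J [z])) xs
      = unshuffle V (\<lambda>I J. 4 * sg (deg V z) 1 * - sg (m * n)
          (sg (ldeg V I * ldeg V J) (sg (m * ldeg V J) (b (cmp' (J @ [cmp (I @ [y])])) z)))) xs"
      unfolding contract_3 v fac sg_sg by (simp add: ac_simps)
    also have "\<dots> = 4 * sg (deg V z) 1 * - sg (m * n)
        (unshuffle V (\<lambda>I J. sg (ldeg V I * ldeg V J) (sg (m * ldeg V J) (b (cmp' (J @ [cmp (I @ [y])])) z))) xs)"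
      by (rule unshuffle_hom[symmetric]) (auto simp: sg_def algebra_simps)
    finally show ?thesis unfolding unshuffle_comm[symmetric] .
  qed
  have 4: "unshuffle V (\<lambda>I J. sg (deg V z * ldeg V J + deg V y * deg V z) (contract V E omg omg' I [z] J [y])) xs
    = 4 * sg (deg V z) 1 * unshuffle V (\<lambda>I J. sg (n * ldeg V I) (b (cmp (I @ [cmp' (J @ [y])])) z)) xs"
    unfolding contract_4 v fac unshuffle_mult ..
  show ?thesis
    unfolding bracket_snoc2 unshuffle_add 1 2 3 4
      component_commutator[OF bcodersD(1)[OF D] bcodersD(1)[OF D']] compose_form_def
    by (simp add: sg_plus sg_mult algebra_simps) (simp add: sg_def algebra_simps)
qed

end

end

section \<open>Dependence of the bracket on its two arguments, for arbitrary functions of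
  lists\<close>

lemma bracket_short: "length zs < 2 \<Longrightarrow> bracket V E h h' zs = 0"
  by (simp add: bracket_def)

text \<open>At \<open>zs\<close> the bracket distributes exactly the letters of \<open>zs\<close>
  over four blocks, so questions about support, arity and degree reduce to a single
  contraction.\<close>

lemma bracket_cong:
  assumes c: "\<And>A C A' C'. mset A + mset C + mset A' + mset C' = mset zs
    \<Longrightarrow> contract V E f g A C A' C' = contract V E f' g' A C A' C'"
  shows "bracket V E f g zs = bracket V E f' g' zs"
proof (cases zs rule: rev_cases)
  case Nil
  then show ?thesis by (simp add: bracket_short)
next
  case (snoc ws z)
  show ?thesis
  proof (cases ws rule: rev_cases)
    case Nil
    then show ?thesis by (simp add: snoc bracket_short)
  next
    case ws: (snoc xs y)
    have zs: "zs = xs @ [y, z]" by (simp add: snoc ws)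
    have 1: "unshuffle1 V (\<lambda>I x J. contract V E f g I [x] [] (J @ [y, z])) xs
        = unshuffle1 V (\<lambda>I x J. contract V E f' g' I [x] [] (J @ [y, z])) xs"
    proof (intro unshuffle1_cong c)
      fix I x J assume m: "mset I + ({#x#} + mset J) = mset xs"
      show "mset I + mset [x] + mset [] + mset (J @ [y, z]) = mset zs"
        unfolding zs mset_append m[symmetric] by simp
    qed
    have 2: "unshuffle1 V (\<lambda>I x J. sg (deg V x * ldeg V J + (deg V y + deg V z) * (ldeg V J + deg V x))
          (contract V E f g [] (I @ [y, z]) J [x])) xs
        = unshuffle1 V (\<lambda>I x J. sg (deg V x * ldeg V J + (deg V y + deg V z) * (ldeg V J + deg V x))
          (contract V E f' g' [] (I @ [y, z]) J [x])) xs"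
    proof (intro unshuffle1_cong arg_cong[where f = "sg _"] c)
      fix I x J assume m: "mset I + ({#x#} + mset J) = mset xs"
      show "mset [] + mset (I @ [y, z]) + mset J + mset [x] = mset zs"
        unfolding zs mset_append m[symmetric] by simp
    qed
    have 3: "unshuffle V (\<lambda>I J. sg (deg V y * ldeg V J) (contract V E f g I [y] J [z])
          + sg (deg V z * ldeg V J + deg V y * deg V z) (contract V E f g I [z] J [y])) xs
        = unshuffle V (\<lambda>I J. sg (deg V y * ldeg V J) (contract V E f' g' I [y] J [z])
          + sg (deg V z * ldeg V J + deg V y * deg V z) (contract V E f' g' I [z] J [y])) xs"
    proof (intro unshuffle_cong arg_cong2[where f = "(+)"] arg_cong[where f = "sg _"] c)
      fix I J assume m: "mset I + mset J = mset xs"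
      show "mset I + mset [y] + mset J + mset [z] = mset zs" "mset I + mset [z] + mset J + mset [y] = mset zs"
        unfolding zs mset_append m[symmetric] by simp_all
    qed
    show ?thesis by (simp only: zs bracket_snoc2 1 2 3)
  qed
qed

lemma contract_zero [simp]: "contract V E (\<lambda>_. 0) g A C A' C' = 0" "contract V E f (\<lambda>_. 0) A C A' C' = 0"
  by (simp_all add: contract_def case_prod_unfold)

lemma bracket_eq_0:
  assumes "\<And>A C A' C'. mset A + mset C + mset A' + mset C' = mset zs \<Longrightarrow> contract V E f g A C A' C' = 0"
  shows "bracket V E f g zs = 0"
proof -
  have "bracket V E f g zs = bracket V E (\<lambda>_. 0) (\<lambda>_. 0) zs"
    using assms by (intro bracket_cong) simp
  also have "\<dots> = 0"
    by (simp add: bracket_def Let_def unshuffle1_eq_0)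
  finally show ?thesis .
qed

lemma contract_linear:
  "contract V E f (\<lambda>zs. g zs + g' zs) A C A' C' = contract V E f g A C A' C' + contract V E f g' A C A' C'"
  "contract V E f (\<lambda>zs. e * g zs) A C A' C' = e * contract V E f g A C A' C'"
  by (simp_all add: contract_def case_prod_unfold distrib_left sg_plus sum_list_addf sg_mult
      sum_list_const_mult[symmetric] mult.left_commute)

lemma bracket_add: "bracket V E f (g + g') = bracket V E f g + bracket V E f g'"
  by (rule ext) (simp add: bracket_def Let_def contract_linear plus_fun_def unshuffle_add unshuffle1_add sg_plus add_ac)

lemma bracket_scale: "bracket V E f (fscale e g) = fscale e (bracket V E f g)"
  by (rule ext) (simp add: bracket_def Let_def fscale_def contract_linear unshuffle_mult unshuffle1_mult
      sg_mult distrib_left sg_plus)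

lemma bracket_vanish:
  assumes z: "z \<in> set zs" and f: "\<And>ws. z \<in> set ws \<Longrightarrow> f ws = 0" and g: "\<And>ws. z \<in> set ws \<Longrightarrow> g ws = 0"
  shows "bracket V E f g zs = 0"
proof (rule bracket_eq_0)
  fix A C A' C' assume m: "mset A + mset C + mset A' + mset C' = mset zs"
  have "set A \<union> set C \<union> set A' \<union> set C' = set zs"
    using arg_cong[OF m, of set_mset] by simp
  then have "f (A @ e # C) * g (A' @ e' # C') = 0" for e e'
    using z f[of "A @ e # C"] g[of "A' @ e' # C'"] by auto
  then show "contract V E f g A C A' C' = 0"
    by (simp only: contract_def case_prod_unfold sg_zero) simp
qed

text \<open>In the first two sums y and z stay together in one form, whose symmetry applies. In the
  last sum they are separated, and the exchange permutes its two summands.\<close>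

lemma bracket_swap:
  assumes f: "\<And>us x y. f (us @ [x, y]) = sg (deg V x * deg V y) (f (us @ [y, x]))"
    and g: "\<And>us x y. g (us @ [x, y]) = sg (deg V x * deg V y) (g (us @ [y, x]))"
  shows "bracket V E f g (xs @ [y, z]) = sg (deg V y * deg V z) (bracket V E f g (xs @ [z, y]))"
proof -
  have 1: "contract V E f g A C A' (J @ [y, z]) = sg (deg V y * deg V z) (contract V E f g A C A' (J @ [z, y]))"
    for A C A' J
    using g[of "A' @ _ # J" y z] by (intro contract_cong) (simp add: sg_mult sg_sg ac_simps)
  have 2: "contract V E f g A (J @ [y, z]) A' C' = sg (deg V y * deg V z) (contract V E f g A (J @ [z, y]) A' C')"
    for A C' A' J
    using f[of "A @ _ # J" y z] by (intro contract_cong) (simp add: sg_mult sg_sg ac_simps)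
  show ?thesis
    unfolding bracket_snoc2 sg_plus unshuffle_sg unshuffle1_sg 1 2
    by (simp add: sg_sg ac_simps) (intro unshuffle_cong, simp add: sg_def)
qed


section \<open>Closure of B-quadratic coderivations under commutators\<close>

context quadratic_bases
begin

lemma finitary_commutator:
  assumes D: "D \<in> coders s V m" and D': "D' \<in> coders s V n"
    and fin: "finitary (component s V D)" "finitary (component s V D')"
  shows "finitary (component s V (commutator m D n D'))"
proof -
  obtain M N where M: "\<And>zs. length zs > M \<Longrightarrow> component s V D zs = 0"
    and N: "\<And>zs. length zs > N \<Longrightarrow> component s V D' zs = 0"
    using fin unfolding finitary_def by blast
  have comp: "compose_form k (component s V F) (component s V G) xs y z = 0"
    if F: "F \<in> coders s V j" and K: "\<And>zs. length zs > K \<Longrightarrow> component s V F zs = 0"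
      and L: "\<And>zs. length zs > L \<Longrightarrow> component s V G zs = 0" and xs: "length xs \<ge> K + L"
    for F G j k K L xs y z
  proof -
    have F0: "component s V F zs = 0" if "0 \<in> set zs" for zs
      by (rule component_zero[OF F mon_zero_arg[OF that]])
    \<comment> \<open>Besides x there are at least K + L letters, and G contributes its value as one
      more argument of F. So either G receives more than L arguments or F more than K.\<close>
    have "component s V F (I @ component s V G (J @ [x]) # ws) = 0" if l: "length I + length J + length ws \<ge> K + L" for I J x ws
    proof (cases "length (J @ [x]) > L")
      case True
      then show ?thesis by (intro F0) (simp add: L)
    next
      case False
      then show ?thesis using l by (intro K) simp
    qed
    note F1 = this
    have "unshuffle V (\<lambda>I J. sg (k * ldeg V I) (b (component s V F (I @ [component s V G (J @ [y])])) z)) xs = 0"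
    proof (rule unshuffle_eq_0)
      fix I J assume m: "mset I + mset J = mset xs"
      show "sg (k * ldeg V I) (b (component s V F (I @ [component s V G (J @ [y])])) z) = 0"
        using arg_cong[OF m, of size] xs by (subst F1) (simp_all add: b_linear)
    qed
    moreover have "unshuffle1 V (\<lambda>I x J. sg (deg V x * ldeg V J + k * ldeg V I)
        (b (component s V F (I @ [component s V G (J @ [x]), y])) z)) xs = 0"
    proof (rule unshuffle1_eq_0)
      fix I x J assume m: "mset I + {#x#} + mset J = mset xs"
      show "sg (deg V x * ldeg V J + k * ldeg V I) (b (component s V F (I @ [component s V G (J @ [x]), y])) z) = 0"
        using arg_cong[OF m, of size] xs by (subst F1) (simp_all add: b_linear)
    qed
    ultimately show ?thesis by (simp add: compose_form_def)
  qed
  have "component s V (commutator m D n D') zs = 0" if l: "length zs > M + N" for zs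
  proof (rule b_nondegenerate)
    fix z
    obtain xs y where zs: "zs = xs @ [y]" using l by (cases zs rule: rev_cases) auto
    then show "b (component s V (commutator m D n D') zs) z = b 0 z"
      using l comp[of D m M N D' xs n y z] comp[of D' n N M D xs m y z] D D' M N
      by (simp add: component_commutator[OF D D'] b_linear)
  qed
  then show ?thesis unfolding finitary_def by blast
qed

text \<open>Up to a sign in z, four times the pairing of the commutator is the bracket of two forms
  symmetric in their last two variables, and the bracket inherits this symmetry from them.\<close>

lemma commutator_bcoders:
  assumes D: "D \<in> bcoders fin s V b m" and D': "D' \<in> bcoders fin s V b n"
  shows "commutator m D n D' \<in> bcoders fin s V b (m + n)"
proof -
  note d = bcodersD[OF D] and d' = bcodersD[OF D']
  have "sg (deg V z) (b (component s V (commutator m D n D') (xs @ [y])) z)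
      = sg (deg V y * deg V z + deg V y) (b (component s V (commutator m D n D') (xs @ [z])) y)"
    if h: "\<forall>x\<in>set (xs @ [y, z]). homog V x" for xs y z
  proof -
    have "bracket V E (Omega s V b D) (Omega s V b D') (xs @ [y, z])
        = sg (deg V y * deg V z) (bracket V E (Omega s V b D) (Omega s V b D') (xs @ [z, y]))"
      by (rule bracket_swap; rule bisym_swap[OF Omega_bisym[OF D]] bisym_swap[OF Omega_bisym[OF D']]; simp)
    then have "4 * sg (deg V z) (b (component s V (commutator m D n D') (xs @ [y])) z)
        = 4 * sg (deg V y * deg V z + deg V y) (b (component s V (commutator m D n D') (xs @ [z])) y)"
      using h by (simp add: bracket_Omega_snoc2[OF D D'] sg_mult(2)[symmetric] sg_sg)
    then show ?thesis by simp
  qed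
  then show ?thesis
    unfolding bcoders_iff using commutator_coders[OF d(1) d'(1)] finitary_commutator[OF d(1) d'(1)] d(2) d'(2)
    by blast
qed

lemma bracket_Omega:
  assumes D: "D \<in> bcoders fin s V b m" and D': "D' \<in> bcoders fin s V b n"
  shows "bracket V E (Omega s V b D) (Omega s V b D') = fscale 2 (Omega s V b (commutator m D n D'))"
proof
  fix zs
  show "bracket V E (Omega s V b D) (Omega s V b D') zs = fscale 2 (Omega s V b (commutator m D n D')) zs"
  proof (cases zs rule: snoc2_exhaust)
    case 1
    then show ?thesis by (simp add: bracket_short fscale_def Omega_short)
  next
    case (2 xs y z)
    show ?thesis
    proof (cases "homog V z")
      case True
      then show ?thesis
        unfolding 2 bracket_Omega_snoc2[OF D D' True] fscale_def Omega_snoc2[OF commutator_bcoders[OF D D']] by simp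
    next
      case False
      then have "bracket V E (Omega s V b D) (Omega s V b D') zs = 0"
        by (intro bracket_vanish[of z]) (auto simp: 2 Omega_def)
      then show ?thesis using False by (simp add: 2 fscale_def Omega_snoc2[OF commutator_bcoders[OF D D']])
    qed
  qed
qed

lemma Omega_zero:
  assumes "D \<in> bcoders fin s V b n"
  shows "Omega s V b (\<lambda>p. 0) = 0" "(\<lambda>p. 0) \<in> bcoders fin s V b n"
proof -
  have z: "(\<lambda>p. D p + fscale (- 1) (D p)) = (\<lambda>p. 0)" by (simp add: fscale_minus)
  have "Omega s V b D + fscale (- 1) (Omega s V b D) = 0" by (simp add: fscale_minus)
  then show "Omega s V b (\<lambda>p. 0) = 0"
    using Omega_lincomb[OF bcodersD(1)[OF assms] bcodersD(1)[OF assms], of "- 1"] unfolding z by simp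
  show "(\<lambda>p. 0) \<in> bcoders fin s V b n" using bcoders_lincomb[OF assms assms, of "- 1"] unfolding z .
qed

lemma Omega_linear:
  assumes D: "D \<in> bcoders fin s V b n" and D': "D' \<in> bcoders fin s V b n"
  shows "Omega s V b (D + D') = Omega s V b D + Omega s V b D'"
    "Omega s V b (\<lambda>p. fscale c (D p)) = fscale c (Omega s V b D)"
    "D + D' \<in> bcoders fin s V b n" "(\<lambda>p. fscale c (D p)) \<in> bcoders fin s V b n"
proof -
  have 1: "(\<lambda>p. D p + fscale 1 (D' p)) = D + D'" by (simp add: fscale_def plus_fun_def)
  have 2: "(\<lambda>p. 0 + fscale c (D p)) = (\<lambda>p. fscale c (D p))" by simp
  note z = Omega_zero[OF D]
  show "Omega s V b (D + D') = Omega s V b D + Omega s V b D'"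
    using Omega_lincomb[OF bcodersD(1)[OF D] bcodersD(1)[OF D'], of 1] unfolding 1 by (simp add: fscale_def)
  show "D + D' \<in> bcoders fin s V b n" using bcoders_lincomb[OF D D', of 1] unfolding 1 .
  show "Omega s V b (\<lambda>p. fscale c (D p)) = fscale c (Omega s V b D)"
    using Omega_lincomb[OF bcodersD(1)[OF z(2)] bcodersD(1)[OF D], of c] unfolding 2 z(1) by simp
  show "(\<lambda>p. fscale c (D p)) \<in> bcoders fin s V b n" using bcoders_lincomb[OF z(2) D, of c] unfolding 2 .
qed

end

section \<open>The differential\<close>

context quadratic_bases
begin

lemma dual_ldeg:
  assumes "(e, e') \<in> set E"
  shows "deg V e + deg V e' = - 2"
proof -
  obtain i where i: "i < length E" "E ! i = (e, e')" using assms by (metis in_set_conv_nth)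
  obtain k where "e' \<in> V k" using homog_bases(2)[OF i(1)] i(2) by (auto simp: homog_def)
  then show ?thesis using dual_degree(2,3)[OF i(1), of k] i(2) by simp
qed

text \<open>A nonzero value of f fixes the total degree of its arguments. The contracted pair
  contributes -2, so what remains for g has total degree \<open>ldeg V zs - 2 + n\<close>.\<close>

lemma bracket_local:
  assumes f: "has_degree V n f" and g: "\<And>ws. ldeg V ws = ldeg V zs - 2 + n \<Longrightarrow> g ws = g' ws"
  shows "bracket V E f g zs = bracket V E f g' zs"
proof (rule bracket_cong)
  fix A C A' C' assume m: "mset A + mset C + mset A' + mset C' = mset zs"
  have l: "ldeg V (A @ C @ A' @ C') = ldeg V zs"
    by (rule ldeg_mset) (simp add: m[symmetric] add_ac)
  have p: "f (A @ e # C) * g (A' @ e' # C') = f (A @ e # C) * g' (A' @ e' # C')" if "(e, e') \<in> set E" for e e'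
  proof (cases "f (A @ e # C) = 0")
    case False
    then have "ldeg V (A @ e # C) = - n" using f unfolding has_degree_def by blast
    then have "ldeg V (A' @ e' # C') = ldeg V zs - 2 + n" using l dual_ldeg[OF that] by simp
    then show ?thesis by (simp only: g)
  qed simp
  show "contract V E f g A C A' C' = contract V E f g' A C A' C'"
    unfolding contract_def
    by (intro arg_cong[where f = sum_list] map_cong refl) (clarify, simp only: prod.case p)
qed

text \<open>A formal sum may have parts in infinitely many degrees, so it is never reassembled from
  them; by \<open>bracket_local\<close> each value of the bracket requires one part.\<close>

definition degree_part :: "int \<Rightarrow> ('v list \<Rightarrow> 'k) \<Rightarrow> 'v list \<Rightarrow> 'k" where
  "degree_part k f zs = (if ldeg V zs = - k then f zs else 0)"

lemma bisymI:
  assumes "\<And>zs. \<exists>z\<in>set zs. \<not> homog V z \<Longrightarrow> f zs = 0" "\<And>us ws. slot_linear s V (\<lambda>x. f (us @ x # ws))"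
    "\<And>zs. length zs < 2 \<Longrightarrow> f zs = 0" "fin \<Longrightarrow> finitary f"
    "\<And>us x y ws. length ws \<noteq> 1 \<Longrightarrow> f (us @ x # y # ws) = sg (deg V x * deg V y) (f (us @ y # x # ws))"
  shows "f \<in> bisym fin s V"
  unfolding bisym_def mem_Collect_eq mforms_slot using assms by blast

lemma bisymD:
  assumes "f \<in> bisym fin s V"
  shows "\<exists>z\<in>set zs. \<not> homog V z \<Longrightarrow> f zs = 0" "slot_linear s V (\<lambda>x. f (us @ x # ws))"
    "length zs < 2 \<Longrightarrow> f zs = 0" "fin \<Longrightarrow> finitary f" "0 \<in> set zs \<Longrightarrow> f zs = 0"
    "length ws \<noteq> 1 \<Longrightarrow> f (us @ x # y # ws) = sg (deg V x * deg V y) (f (us @ y # x # ws))"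
  using assms mforms_zero_arg unfolding bisym_def mem_Collect_eq mforms_slot by blast+

lemma degree_part_bisym:
  assumes f: "f \<in> bisym fin s V"
  shows "degree_part k f \<in> bisym_deg fin s V k"
proof -
  note d = bisymD[OF f]
  have "degree_part k f \<in> bisym fin s V"
  proof (rule bisymI)
    fix us ws :: "'v list"
    have sl: "slot_linear s V (\<lambda>x. f (us @ x # ws))" by (rule d(2))
    \<comment> \<open>For x in \<open>V n\<close> the degree condition depends on n alone, so it
      cannot spoil linearity; at x = 0, where \<open>deg\<close> is arbitrary, f vanishes.\<close>
    have e: "degree_part k f (us @ x # ws) = (if ldeg V us + (n - 1) + ldeg V ws = - k then f (us @ x # ws) else 0)"
      if "x \<in> V n" for x n
      using deg_eq[OF V that] d(5)[of "us @ x # ws"] by (cases "x = 0") (auto simp: degree_part_def)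
    show "slot_linear s V (\<lambda>x. degree_part k f (us @ x # ws))"
      unfolding slot_linear_def
    proof (intro conjI allI ballI)
      fix n x y assume x: "x \<in> V n" and y: "y \<in> V n"
      have "f (us @ (x + y) # ws) = f (us @ x # ws) + f (us @ y # ws)"
        using sl x y unfolding slot_linear_def by blast
      then show "degree_part k f (us @ (x + y) # ws) = degree_part k f (us @ x # ws) + degree_part k f (us @ y # ws)"
        unfolding e[OF x] e[OF y] e[OF V_closed(2)[OF x y]] by simp
    next
      fix n x c assume x: "x \<in> V n"
      have "f (us @ s c x # ws) = c * f (us @ x # ws)" using sl x unfolding slot_linear_def by blast
      then show "degree_part k f (us @ s c x # ws) = c * degree_part k f (us @ x # ws)"
        unfolding e[OF x] e[OF V_closed(3)[OF x]] by simp
    qed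
  next
    assume fin
    then obtain N where "\<forall>zs. length zs > N \<longrightarrow> f zs = 0" using d(4) unfolding finitary_def by blast
    then have "\<forall>zs. length zs > N \<longrightarrow> degree_part k f zs = 0" by (simp add: degree_part_def)
    then show "finitary (degree_part k f)" unfolding finitary_def by blast
  next
    fix us x y ws assume "length (ws :: 'v list) \<noteq> 1"
    from d(6)[OF this, of us x y]
    show "degree_part k f (us @ x # y # ws) = sg (deg V x * deg V y) (degree_part k f (us @ y # x # ws))"
      by (simp add: degree_part_def add_ac)
  qed (simp_all add: degree_part_def d(1,3))
  then show ?thesis by (simp add: bisym_deg_def has_degree_def degree_part_def)
qed

lemma bracket_finitary:
  assumes "finitary f" "finitary g"
  shows "finitary (bracket V E f g)"
proof -
  obtain M N where M: "\<And>zs. length zs > M \<Longrightarrow> f zs = 0" and N: "\<And>zs. length zs > N \<Longrightarrow> g zs = 0"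
    using assms unfolding finitary_def by blast
  have "bracket V E f g zs = 0" if l: "length zs > M + N" for zs
  proof (rule bracket_eq_0)
    fix A C A' C' assume m: "mset A + mset C + mset A' + mset C' = mset zs"
    have "length A + length C + length A' + length C' = length zs"
      using arg_cong[OF m, of size] by simp
    then have "length (A @ e # C) > M \<or> length (A' @ e' # C') > N" for e e' using l by auto
    then have "f (A @ e # C) * g (A' @ e' # C') = 0" for e e' using M N by (metis mult_eq_0_iff)
    then show "contract V E f g A C A' C' = 0" by (simp only: contract_def case_prod_unfold sg_zero) simp
  qed
  then show ?thesis unfolding finitary_def by blast
qed

text \<open>For Q of odd degree the commutator with itself is 2 Q Q. The factor 2 is cancelled in
  the field, on the values of the functionals.\<close>

lemma commutator_square_zero:
  assumes Q: "Q \<in> coders s V 1" and QQ: "commutator 1 Q 1 Q = 0"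
  shows "Q (Q p) = 0"
proof -
  have "Q (Q p) + Q (Q p) = 0" using fun_cong[OF QQ, of p] by (simp add: commutator_def sg_def zero_fun_apply)
  then have "Q (Q p) h + Q (Q p) h = 0" for h by (metis plus_fun_apply zero_fun_apply)
  then have "2 * Q (Q p) h = 0" for h unfolding mult_2 .
  then have "Q (Q p) h = 0" for h by simp
  then show ?thesis by (simp add: fun_eq_iff zero_fun_apply)
qed

section \<open>The two differentials and the comparison of their cohomologies\<close>

context
  fixes fin Q
  assumes Q: "Q \<in> bcoders fin s V b 1" and QQ: "commutator 1 Q 1 Q = 0"
begin

lemma coboundary_bcoders:
  "coboundary (\<lambda>c C p. fscale c (C p)) (bcoders fin s V b) (\<lambda>n C. commutator 1 Q n C)"
  unfolding coboundary_def
proof (intro allI ballI conjI)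
  fix n x y c assume x: "x \<in> bcoders fin s V b n" and y: "y \<in> bcoders fin s V b n"
  note q = codersD[OF bcodersD(1)[OF Q]] and cx = codersD[OF bcodersD(1)[OF x]] and cy = codersD[OF bcodersD(1)[OF y]]
  have 0: "Q 0 = 0" "x 0 = 0" "y 0 = 0"
    using P_endD(5)[OF q(1) P_closed(1)] P_endD(5)[OF cx(1) P_closed(1)] P_endD(5)[OF cy(1) P_closed(1)] by auto
  have P: "Q p \<in> P_space s V" "x p \<in> P_space s V" "y p \<in> P_space s V" for p
    using P_endD(1)[OF q(1)] P_endD(1)[OF cx(1)] P_endD(1)[OF cy(1)] q(2)[of p] cx(2)[of p] cy(2)[of p] P_closed(1)
    by (metis)+
  show "commutator 1 Q n (x + y) = commutator 1 Q n x + commutator 1 Q n y"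
    unfolding commutator_def
    by (rule ext) (simp add: plus_fun_apply[of _ _ "_ :: ('v, 'k) pelem"] P_endD(2)[OF q(1) P(2,3)] sg_plus)
  show "commutator 1 Q n (\<lambda>p. fscale c (x p)) = (\<lambda>p. fscale c (commutator 1 Q n x p))"
  proof
    fix p
    have "fscale c (t - u) = fscale c t - fscale c u" for t u :: "('v, 'k) pelem"
      by (simp add: fscale_def fun_eq_iff right_diff_distrib)
    then show "commutator 1 Q n (\<lambda>p. fscale c (x p)) p = fscale c (commutator 1 Q n x p)"
      unfolding commutator_def by (simp add: P_endD(3)[OF q(1) P(2)] fscale_sg)
  qed
  show "commutator 1 Q n x \<in> bcoders fin s V b (n + 1)"
    using commutator_bcoders[OF Q x] by (simp add: add.commute)
  show "commutator 1 Q (n + 1) (commutator 1 Q n x) = 0"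
  proof
    fix p
    \<comment> \<open>Of the four terms of the double commutator, two contain Q Q and vanish; the
      two terms Q C Q cancel because n and n + 1 have opposite parity.\<close>
    note sq = commutator_square_zero[OF bcodersD(1)[OF Q] QQ]
    show "commutator 1 Q (n + 1) (commutator 1 Q n x) p = 0 p"
      unfolding commutator_def
      by (simp add: P_endD(6)[OF q(1) P(1) P_closed(6)[OF P(2)]] P_endD(4)[OF q(1) P(2)] sq 0
          zero_fun_apply) (simp add: sg_def)
  qed
qed

lemma bracket_Omega_Q:
  "C \<in> bcoders fin s V b n \<Longrightarrow> bracket V E (Omega s V b Q) (Omega s V b C) = fscale 2 (Omega s V b (commutator 1 Q n C))"
  by (rule bracket_Omega[OF Q])

text \<open>Every form of degree n is \<open>Omega\<close> of a coderivation C of degree n - 2, so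
  both claims are transported from the commutator with Q.\<close>

lemma bracket_bisym_deg:
  assumes f: "f \<in> bisym_deg fin s V n"
  shows "bracket V E (Omega s V b Q) f \<in> bisym_deg fin s V (n + 1)"
    "bracket V E (Omega s V b Q) (bracket V E (Omega s V b Q) f) = 0"
proof -
  obtain C where C: "C \<in> bcoders fin s V b (n - 2)" "Omega s V b C = f"
    using Omega_surj[of f fin "n - 2"] f by auto
  note c1 = commutator_bcoders[OF Q C(1)]
  note s1 = Omega_linear(2,4)[OF c1 c1, of 2]
  show "bracket V E (Omega s V b Q) f \<in> bisym_deg fin s V (n + 1)"
    using Omega_bisym[OF s1(2)] unfolding s1(1) bracket_Omega_Q[OF C(1), symmetric] C(2) by (simp add: add.commute)
  have "commutator 1 Q (1 + (n - 2)) (commutator 1 Q (n - 2) C) = 0"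
    using coboundary_bcoders C(1) unfolding coboundary_def add.commute[of 1 "n - 2"] by blast
  then show "bracket V E (Omega s V b Q) (bracket V E (Omega s V b Q) f) = 0"
    unfolding C(2)[symmetric] bracket_Omega_Q[OF C(1)] bracket_scale bracket_Omega_Q[OF c1]
    using Omega_zero(1)[OF C(1)] by (simp add: zero_fun_def fscale_def)
qed

lemma coboundary_bisym_deg:
  "coboundary fscale (bisym_deg fin s V) (\<lambda>_. bracket V E (Omega s V b Q))"
  unfolding coboundary_def by (auto simp: bracket_add bracket_scale bracket_bisym_deg)

text \<open>The bracket with a form of degree 3 raises degrees by 1. A value at \<open>zs\<close>
  belongs to degree \<open>- ldeg V zs\<close>, hence stems from the part of f one degree
  lower.\<close>

lemma bracket_degree_part:
  assumes "k = - ldeg V zs - 1"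
  shows "bracket V E (Omega s V b Q) f zs = bracket V E (Omega s V b Q) (degree_part k f) zs"
  using Omega_bisym[OF Q] assms
  by (intro bracket_local[where n = 3]) (auto simp: bisym_deg_def degree_part_def)

text \<open>f need not be homogeneous, but each condition on d f compares values at lists of equal
  total degree. These are computed from one and the same homogeneous part, for which the claim is
  known.\<close>

lemma bracket_bisym:
  assumes f: "f \<in> bisym fin s V"
  shows "bracket V E (Omega s V b Q) f \<in> bisym fin s V"
    "bracket V E (Omega s V b Q) (bracket V E (Omega s V b Q) f) = 0"
proof -
  let ?d = "bracket V E (Omega s V b Q)"
  have OQ: "Omega s V b Q \<in> bisym fin s V" using Omega_bisym[OF Q] by (simp add: bisym_deg_def)
  have part: "?d (degree_part k f) \<in> bisym fin s V" for k
    using bracket_bisym_deg(1)[OF degree_part_bisym[OF f]] by (simp add: bisym_deg_def)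
  have vanish: "?d h zs = 0" if "z \<in> set zs" "\<not> homog V z \<or> z = 0" "h \<in> bisym fin s V" for h z zs
    using that bisymD(1,5)[OF OQ] bisymD(1,5)[OF that(3)] by (intro bracket_vanish[OF that(1)]) auto
  show "?d f \<in> bisym fin s V"
  proof (rule bisymI)
    fix us ws :: "'v list"
    \<comment> \<open>The relevant part is chosen from n instead of \<open>deg V x\<close>, so that
      it is the same for all x in \<open>V n\<close>. At x = 0 both sides vanish.\<close>
    have "?d f (us @ x # ws) = ?d (degree_part (- (ldeg V us + (n - 1) + ldeg V ws) - 1) f) (us @ x # ws)"
      if x: "x \<in> V n" for x n
    proof (cases "x = 0")
      case True
      then have "0 \<in> set (us @ x # ws)" by simp
      then show ?thesis
        using vanish[of 0 "us @ x # ws" f] bisymD(5)[OF part] f by simp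
    next
      case False
      then show ?thesis using deg_eq[OF V x] by (intro bracket_degree_part) simp
    qed
    note e = this
    show "slot_linear s V (\<lambda>x. ?d f (us @ x # ws))"
      unfolding slot_linear_def
    proof (intro conjI allI ballI)
      fix n x y c assume x: "x \<in> V n" and y: "y \<in> V n"
      show "?d f (us @ (x + y) # ws) = ?d f (us @ x # ws) + ?d f (us @ y # ws)"
        unfolding e[OF x] e[OF y] e[OF V_closed(2)[OF x y]]
        using bisymD(2)[OF part] x y unfolding slot_linear_def by blast
    next
      fix n x c assume x: "x \<in> V n"
      show "?d f (us @ s c x # ws) = c * ?d f (us @ x # ws)"
        unfolding e[OF x] e[OF V_closed(3)[OF x]]
        using bisymD(2)[OF part] x unfolding slot_linear_def by blast
    qed
  next
    fix us x y ws assume l: "length (ws :: 'v list) \<noteq> 1"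
    show "?d f (us @ x # y # ws) = sg (deg V x * deg V y) (?d f (us @ y # x # ws))"
      using bisymD(6)[OF part l]
        bracket_degree_part[of _ "us @ x # y # ws" f] bracket_degree_part[of _ "us @ y # x # ws" f]
      by (metis (no_types, lifting) add.left_commute ldeg_simps(2,3))
  next
    assume fin
    then show "finitary (?d f)" using bracket_finitary bisymD(4)[OF OQ] bisymD(4)[OF f] by blast
  qed (use vanish f bracket_short in auto)
  show "?d (?d f) = 0"
  proof
    fix zs
    \<comment> \<open>Two applications of d raise the degree by 2, so the value at \<open>zs\<close>
      stems from the part of degree \<open>- ldeg V zs - 2\<close>.\<close>
    have "?d (?d f) zs = ?d (?d (degree_part (- ldeg V zs - 2) f)) zs"
    proof (rule bracket_local[where n = 3])
      show "has_degree V 3 (Omega s V b Q)" using Omega_bisym[OF Q] by (simp add: bisym_deg_def)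
      show "?d f ws = ?d (degree_part (- ldeg V zs - 2) f) ws" if "ldeg V ws = ldeg V zs - 2 + 3" for ws
        by (rule bracket_degree_part) (simp add: that)
    qed
    then show "?d (?d f) zs = 0 zs" using bracket_bisym_deg(2)[OF degree_part_bisym[OF f]] by simp
  qed
qed

lemma coboundary_bisym:
  "coboundary fscale (\<lambda>_. bisym fin s V) (\<lambda>_. bracket V E (Omega s V b Q))"
  unfolding coboundary_def by (auto simp: bracket_add bracket_scale bracket_bisym)

text \<open>\<open>Omega\<close> matches cocycles with cocycles, and it maps the coset of a cocycle
  onto a full coset because the factor 2 between the differentials can be absorbed into the
  primitive. Injectivity on classes follows from injectivity of \<open>Omega\<close> on
  coderivations.\<close>

lemma cohomology_bij:
  "bij_betw (\<lambda>H. Omega s V b ` H)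
     (cohomology (bcoders fin s V b) (\<lambda>n C. commutator 1 Q n C) n)
     (cohomology (bisym_deg fin s V) (\<lambda>_. bracket V E (Omega s V b Q)) (n + 2))"
proof -
  let ?\<Phi> = "Omega s V b" and ?X = "bcoders fin s V b" and ?Y = "bisym_deg fin s V"
    and ?d = "bracket V E (Omega s V b Q)" and ?\<delta> = "\<lambda>n C. commutator 1 Q n C"
  have \<delta>: "?\<delta> (n - 1) w \<in> ?X n" if "w \<in> ?X (n - 1)" for w
    using commutator_bcoders[OF Q that] by simp
  have sub: "H \<subseteq> ?X n" if "H \<in> cohomology ?X ?\<delta> n" for H
    using that \<delta> Omega_linear(3) unfolding cohomology_def by blast
  have inj: "inj_on ?\<Phi> (?X n)" using Omega_inj by (intro inj_onI) blast
  have half: "fscale (1 / 2) (fscale 2 h) = h" "fscale 2 (fscale (1 / 2) h) = h" for h :: "'v list \<Rightarrow> 'k"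
    by (simp_all add: fscale_def)
  have im: "?\<Phi> ` {z + ?\<delta> (n - 1) w | w. w \<in> ?X (n - 1)} = {?\<Phi> z + ?d u | u. u \<in> ?Y (n + 2 - 1)}"
    if z: "z \<in> ?X n" for z
  proof
    show "?\<Phi> ` {z + ?\<delta> (n - 1) w | w. w \<in> ?X (n - 1)} \<subseteq> {?\<Phi> z + ?d u | u. u \<in> ?Y (n + 2 - 1)}"
    proof clarify
      fix w assume w: "w \<in> ?X (n - 1)"
      \<comment> \<open>d of \<open>Omega\<close> of w is twice \<open>Omega\<close> of the
        coboundary of w, so the primitive on the side of forms is half of \<open>Omega\<close> of
        w.\<close>
      note l = Omega_linear(2,4)[OF w w, of "1 / 2"]
      have "?\<Phi> (z + ?\<delta> (n - 1) w) = ?\<Phi> z + ?d (fscale (1 / 2) (?\<Phi> w))"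
        unfolding Omega_linear(1)[OF z \<delta>[OF w]] bracket_scale bracket_Omega_Q[OF w] half ..
      moreover have "fscale (1 / 2) (?\<Phi> w) \<in> ?Y (n + 2 - 1)"
        using Omega_bisym[OF l(2)] unfolding l(1) by (simp add: add_ac diff_add_eq)
      ultimately show "\<exists>u. ?\<Phi> (z + ?\<delta> (n - 1) w) = ?\<Phi> z + ?d u \<and> u \<in> ?Y (n + 2 - 1)" by blast
    qed
    show "{?\<Phi> z + ?d u | u. u \<in> ?Y (n + 2 - 1)} \<subseteq> ?\<Phi> ` {z + ?\<delta> (n - 1) w | w. w \<in> ?X (n - 1)}"
    proof clarify
      fix u assume "u \<in> ?Y (n + 2 - 1)"
      then obtain w where w: "w \<in> ?X (n - 1)" "?\<Phi> w = u"
        using Omega_surj[of u fin "n - 1"] by (auto simp: diff_add_eq)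
      \<comment> \<open>In this direction the preimage w of u has to be doubled.\<close>
      note l = Omega_linear(2,4)[OF w(1) w(1), of 2]
      have "?\<Phi> (z + ?\<delta> (n - 1) (\<lambda>p. fscale 2 (w p))) = ?\<Phi> z + fscale (1 / 2) (?d (fscale 2 (?\<Phi> w)))"
        unfolding Omega_linear(1)[OF z \<delta>[OF l(2)]] l(1)[symmetric] bracket_Omega_Q[OF l(2)] half ..
      also have "\<dots> = ?\<Phi> z + ?d u" unfolding bracket_scale half w(2) ..
      finally show "?\<Phi> z + ?d u \<in> ?\<Phi> ` {z + ?\<delta> (n - 1) w | w. w \<in> ?X (n - 1)}"
        using l(2) by (metis (mono_tags, lifting) imageI mem_Collect_eq)
    qed
  qed
  have cocycle: "?d (?\<Phi> z) = 0 \<longleftrightarrow> ?\<delta> n z = 0" if z: "z \<in> ?X n" for z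
  proof
    assume "?d (?\<Phi> z) = 0"
    then have "fscale (1 / 2) (fscale 2 (?\<Phi> (?\<delta> n z))) = 0" unfolding bracket_Omega_Q[OF z] by simp
    then have "?\<Phi> (?\<delta> n z) = ?\<Phi> (\<lambda>p. 0)" unfolding half using Omega_zero(1)[OF z] by simp
    then have "?\<delta> n z = (\<lambda>p. 0)"
      by (rule Omega_inj[OF commutator_bcoders[OF Q z] Omega_zero(2)[OF commutator_bcoders[OF Q z]]])
    then show "?\<delta> n z = 0" by (simp add: zero_fun_def)
  next
    assume "?\<delta> n z = 0"
    then show "?d (?\<Phi> z) = 0"
      unfolding bracket_Omega_Q[OF z] using Omega_zero(1)[OF z] by (simp add: zero_fun_def fscale_def)
  qed
  have "(\<lambda>H. ?\<Phi> ` H) ` cohomology ?X ?\<delta> n = cohomology ?Y (\<lambda>_. ?d) (n + 2)"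
  proof
    show "(\<lambda>H. ?\<Phi> ` H) ` cohomology ?X ?\<delta> n \<subseteq> cohomology ?Y (\<lambda>_. ?d) (n + 2)"
    proof clarify
      fix H assume "H \<in> cohomology ?X ?\<delta> n"
      then obtain z where z: "z \<in> ?X n" "?\<delta> n z = 0" "H = {z + ?\<delta> (n - 1) w | w. w \<in> ?X (n - 1)}"
        unfolding cohomology_def by blast
      have "?\<Phi> z \<in> ?Y (n + 2)" "?d (?\<Phi> z) = 0" using Omega_bisym[OF z(1)] cocycle[OF z(1)] z(2) by auto
      then show "?\<Phi> ` H \<in> cohomology ?Y (\<lambda>_. ?d) (n + 2)"
        unfolding z(3) im[OF z(1)] cohomology_def by blast
    qed
    show "cohomology ?Y (\<lambda>_. ?d) (n + 2) \<subseteq> (\<lambda>H. ?\<Phi> ` H) ` cohomology ?X ?\<delta> n"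
    proof
      fix K assume "K \<in> cohomology ?Y (\<lambda>_. ?d) (n + 2)"
      then obtain u where u: "u \<in> ?Y (n + 2)" "?d u = 0" "K = {u + ?d v | v. v \<in> ?Y (n + 2 - 1)}"
        unfolding cohomology_def by blast
      obtain z where z: "z \<in> ?X n" "?\<Phi> z = u" using Omega_surj[OF u(1)] by blast
      have "?\<delta> n z = 0" using cocycle[OF z(1)] u(2) z(2) by simp
      then have "{z + ?\<delta> (n - 1) w | w. w \<in> ?X (n - 1)} \<in> cohomology ?X ?\<delta> n"
        unfolding cohomology_def using z(1) by blast
      moreover have "K = ?\<Phi> ` {z + ?\<delta> (n - 1) w | w. w \<in> ?X (n - 1)}" unfolding im[OF z(1)] u(3) z(2) ..
      ultimately show "K \<in> (\<lambda>H. ?\<Phi> ` H) ` cohomology ?X ?\<delta> n" by blast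
    qed
  qed
  moreover have "inj_on (\<lambda>H. ?\<Phi> ` H) (cohomology ?X ?\<delta> n)"
    by (rule inj_onI) (use inj_on_image_eq_iff[OF inj sub sub] in simp)
  ultimately show ?thesis by (simp add: bij_betw_def)
qed

end

section \<open>Quadratic pre-Lie algebras\<close>

lemma prelie_map_two: "homog V x \<Longrightarrow> homog V y \<Longrightarrow> prelie_map V q [x, y] = sg (deg V x) (q x y)"
  by (simp add: prelie_map_def)

lemma prelie_map_zero: "length zs \<noteq> 2 \<Longrightarrow> prelie_map V q zs = 0"
  by (simp add: prelie_map_def)

text \<open>Invariance of b under q carries a minus sign. After passing to B and to degrees in V[1],
  it becomes the symmetry that defines B-quadratic maps.\<close>

lemma prelie_bcoders:
  assumes q: "quadratic_prelie s V b q"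
  shows "coder_ext s V 1 (prelie_map V q) \<in> bcoders fin s V b 1"
proof -
  let ?c = "prelie_map V q"
  note Q = sym_map_prelie_map[OF V q]
  have comp: "component s V (coder_ext s V 1 ?c) = ?c"
    by (rule component_coder_ext[OF Q]) (simp add: prelie_map_zero)
  have qV: "q x y \<in> V (k + l)" if "x \<in> V k" "y \<in> V l" for x y k l
    using q that unfolding quadratic_prelie_def by blast
  have inv: "b (q x y) z + sg (k * l) (b y (q x z)) = 0" if "x \<in> V k" "y \<in> V l" "z \<in> V m" for x y z k l m
    using q that unfolding quadratic_prelie_def by blast
  have sym: "sg (deg V z) (b (?c (xs @ [y])) z) = sg (deg V y * deg V z + deg V y) (b (?c (xs @ [z])) y)"
    if h: "\<forall>x\<in>set (xs @ [y, z]). homog V x" for xs y z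
  proof (cases "length xs = 1")
    case False
    then show ?thesis by (simp add: prelie_map_zero b_linear)
  next
    case True
    then obtain x where xs: "xs = [x]" by (auto simp: length_Suc_conv)
    have hx: "homog V x" "homog V y" "homog V z" using h by (auto simp: xs)
    then obtain k l m where klm: "x \<in> V k" "y \<in> V l" "z \<in> V m" by (auto simp: homog_def)
    \<comment> \<open>Invariance moves q(x, .) to the other argument of b with sign (-1)^(k l). The
      symmetry of b then exchanges y, of degree l, with q(x, z), of degree k + m.\<close>
    have e: "b (q x y) z = - sg (k * l + l * (k + m)) (b (q x z) y)"
      using inv[OF klm] unfolding b_graded(1)[OF klm(2) qV[OF klm(1,3)]] by (simp add: sg_sg eq_neg_iff_add_eq_0)
    show ?thesis
    proof (cases "b (q x z) y = 0")
      case True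
      then show ?thesis using e hx by (simp add: xs prelie_map_two b_linear)
    next
      case nz: False
      have "x \<noteq> 0" "y \<noteq> 0" "z \<noteq> 0"
      proof -
        have l: "Vector_Spaces.linear s s (q x)" "Vector_Spaces.linear s s (\<lambda>x. q x z)" for x z
          using q unfolding quadratic_prelie_def bilin_def by auto
        show "x \<noteq> 0" "y \<noteq> 0" "z \<noteq> 0"
          using nz b_linear(3,7) module_hom.zero[OF Vector_Spaces.linear.axioms(3)[OF l(1)]]
            module_hom.zero[OF Vector_Spaces.linear.axioms(3)[OF l(2)]] by auto
      qed
      then have d: "deg V x = k - 1" "deg V y = l - 1" "deg V z = m - 1"
        using deg_eq[OF V] klm by auto
      \<comment> \<open>A nonzero value of b determines one degree from the other two; after
        eliminating k the two signs agree modulo 2.\<close>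
      have "k + m + l = 0" by (rule b_graded(2)[OF qV[OF klm(1,3)] klm(2) nz])
      then have k: "k = - m - l" by simp
      have N: "- t = sg 1 t" for t :: 'k by (simp add: sg_def)
      show ?thesis
        unfolding xs append_Cons append_Nil prelie_map_two[OF hx(1,2)] prelie_map_two[OF hx(1,3)] b_linear e N sg_sg d k
        by (intro sg_cong refl) (simp; argo)
    qed
  qed
  have "\<forall>zs. length zs > 2 \<longrightarrow> ?c zs = 0" by (simp add: prelie_map_zero)
  then have "finitary ?c" unfolding finitary_def by blast
  then show ?thesis
    unfolding bcoders_iff comp using sym coder_ext_coders[OF Q] by blast
qed

text \<open>The component of Q Q can be nonzero only on three arguments x1, x2, y. There it has four
  terms, the two associators that differ by exchanging x1 and x2, and the pre-Lie identity makes
  them cancel.\<close>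

lemma prelie_commutator:
  assumes q: "quadratic_prelie s V b q"
  defines "Q \<equiv> coder_ext s V 1 (prelie_map V q)"
  shows "commutator 1 Q 1 Q = 0"
proof -
  let ?c = "prelie_map V q"
  note Q = sym_map_prelie_map[OF V q]
  have comp: "component s V Q = ?c"
    unfolding Q_def by (rule component_coder_ext[OF Q]) (simp add: prelie_map_zero)
  have Qc: "Q \<in> coders s V 1" unfolding Q_def by (rule coder_ext_coders[OF Q])
  have l: "Vector_Spaces.linear s s (q x)" "Vector_Spaces.linear s s (\<lambda>x. q x y)" for x y
    using q unfolding quadratic_prelie_def bilin_def by auto
  note mh = Vector_Spaces.linear.axioms(3)[OF l(1)] Vector_Spaces.linear.axioms(3)[OF l(2)]
  have q0: "q 0 y = 0" "q x 0 = 0" for x y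
    by (rule module_hom.zero[OF mh(1)] module_hom.zero[OF mh(2)])+
  have qsg: "q x (sg k y) = sg k (q x y)" "q (sg k x) y = sg k (q x y)" for k x y
    using module_hom.neg[OF mh(1)] module_hom.neg[OF mh(2)] by (auto simp: sg_def)
  have qV: "q x y \<in> V (k + l)" if "x \<in> V k" "y \<in> V l" for x y k l
    using q that unfolding quadratic_prelie_def by blast
  have prelie: "q x (q y z) - q (q x y) z = sg (k * l) (q y (q x z) - q (q y x) z)"
    if "x \<in> V k" "y \<in> V l" "z \<in> V m" for x y z k l m
    using q that unfolding quadratic_prelie_def by blast
  have two: "compose_form 1 ?c ?c [x1, x2] y z = 0" for x1 x2 y z
  proof (cases "homog V x1 \<and> homog V x2 \<and> homog V y \<and> x1 \<noteq> 0 \<and> x2 \<noteq> 0")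
    case False
    have c0: "?c zs = 0" if "\<exists>z\<in>set zs. \<not> homog V z \<or> z = 0" for zs :: "'v list"
    proof (cases "\<exists>z\<in>set zs. \<not> homog V z")
      case True
      then show ?thesis by (rule sym_mapD(1)[OF Q])
    next
      case False
      then show ?thesis using that q0 by (auto simp: prelie_map_def length_Suc_conv numeral_2_eq_2)
    qed
    have "?c [x1, ?c [x2, y]] = 0 \<and> ?c [x2, ?c [x1, y]] = 0 \<and> ?c [?c [x1, x2], y] = 0 \<and> ?c [?c [x2, x1], y] = 0"
      using False c0[of "[x1, ?c [x2, y]]"] c0[of "[x2, ?c [x1, y]]"] c0[of "[?c [x1, x2], y]"] c0[of "[?c [x2, x1], y]"]
        c0[of "[x1, x2]"] c0[of "[x2, x1]"] c0[of "[x1, y]"] c0[of "[x2, y]"] by auto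
    then show ?thesis
      by (simp add: compose_form_def unshuffle1_def prelie_map_zero b_linear)
  next
    case True
    then obtain k l m where klm: "x1 \<in> V k" "x2 \<in> V l" "y \<in> V m" by (auto simp: homog_def)
    have hq: "homog V (sg i (q u v))" if "homog V u" "homog V v" for u v i
      using that qV V_closed(5) unfolding homog_def by blast
    have d: "deg V x1 = k - 1" "deg V x2 = l - 1" using deg_eq[OF V] klm True by auto
    \<comment> \<open>The inner sign has exponent i - 1 and the outer one i + j - 1, the degree of
      the inner value; together they leave j modulo 2.\<close>
    have dq: "?c [?c [u, v], y] = sg j (q (q u v) y)"
      if "u \<in> V i" "v \<in> V j" "deg V u = i - 1" for u v i j
    proof (cases "q u v = 0")
      case True
      then show ?thesis using that by (simp add: prelie_map_def q0)
    next
      case False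
      have h: "homog V u" "homog V v" using that by (auto simp: homog_def)
      have "sg (i - 1) (q u v) \<noteq> 0" using False by (simp add: sg_def)
      then have "deg V (sg (i - 1) (q u v)) = i + j - 1"
        by (rule deg_eq[OF V V_closed(5)[OF qV[OF that(1,2)]]])
      then show ?thesis
        using True that(3) by (simp add: prelie_map_two h hq qsg sg_sg) (rule sg_cong, auto)
    qed
    have c: "?c [x1, ?c [x2, y]] = sg (k + l) (q x1 (q x2 y))" "?c [x2, ?c [x1, y]] = sg (k + l) (q x2 (q x1 y))"
      using True by (simp_all add: prelie_map_two hq qsg sg_sg d) (rule sg_cong; auto)+
    have p: "b (q x1 (q x2 y)) z - b (q (q x1 x2) y) z = sg (k * l) (b (q x2 (q x1 y)) z - b (q (q x2 x1) y) z)"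
    proof -
      have bd: "b (u - v) z = b u z - b v z" for u v
        using b_linear(1)[of u "- v" z] b_minus(1) by simp
      show ?thesis using arg_cong[OF prelie[OF klm], of "\<lambda>t. b t z"] by (simp add: b_linear bd)
    qed
    show ?thesis
      using p
      by (simp add: compose_form_def unshuffle1_def prelie_map_zero b_linear c dq[OF klm(1,2) d(1)] dq[OF klm(2,1) d(2)] d sg_sg)
        (auto simp: sg_def algebra_simps split: if_splits)
  qed
  have zero: "compose_form 1 ?c ?c xs y z = 0" for xs y z
  proof (cases "length xs = 2")
    case True
    then show ?thesis using two by (auto simp: length_Suc_conv numeral_2_eq_2)
  next
    case False
    \<comment> \<open>Unless J has one letter the inner value is 0; if it has one, the outer map
      receives a number of arguments different from 2.\<close>
    have c0: "?c (I @ ?c (J @ [x]) # ws) = 0" if "length I + length J + length ws \<noteq> 2" for I J x ws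
    proof (cases "length J = 1")
      case True
      then show ?thesis using that by (intro prelie_map_zero) auto
    next
      case False
      then have "?c (J @ [x]) = 0" by (intro prelie_map_zero) auto
      moreover have "?c (I @ 0 # ws) = 0"
      proof (cases I)
        case Nil
        then show ?thesis using q0 by (simp add: prelie_map_def)
      next
        case (Cons u I')
        then show ?thesis using q0 by (cases I') (auto simp: prelie_map_def)
      qed
      ultimately show ?thesis by simp
    qed
    have "unshuffle V (\<lambda>I J. sg (1 * ldeg V I) (b (?c (I @ [?c (J @ [y])])) z)) xs = 0"
    proof (rule unshuffle_eq_0)
      fix I J assume m: "mset I + mset J = mset xs"
      show "sg (1 * ldeg V I) (b (?c (I @ [?c (J @ [y])])) z) = 0"
        using arg_cong[OF m, of size] False by (subst c0) (simp_all add: b_linear)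
    qed
    moreover have "unshuffle1 V (\<lambda>I x J. sg (deg V x * ldeg V J + 1 * ldeg V I) (b (?c (I @ [?c (J @ [x]), y])) z)) xs = 0"
    proof (rule unshuffle1_eq_0)
      fix I x J assume m: "mset I + {#x#} + mset J = mset xs"
      show "sg (deg V x * ldeg V J + 1 * ldeg V I) (b (?c (I @ [?c (J @ [x]), y])) z) = 0"
        using arg_cong[OF m, of size] False by (subst c0) (simp_all add: b_linear)
    qed
    ultimately show ?thesis by (simp add: compose_form_def)
  qed
  \<comment> \<open>All pairings of the component vanish, so by non-degeneracy the component does; a
    coderivation with zero component is 0.\<close>
  have "component s V (commutator 1 Q 1 Q) (xs @ [y]) = 0" for xs y
    by (rule b_nondegenerate) (simp add: component_commutator[OF Qc Qc] comp zero b_linear)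
  then show ?thesis
    by (intro coders_eq_0[OF commutator_coders[OF Qc Qc]])
      (simp add: component(3)[OF commutator_coders[OF Qc Qc]] mon_zero_arg)
qed

end

theorem corollary7p12:
  fixes s :: "'k::field_char_0 \<Rightarrow> 'v::ab_group_add \<Rightarrow> 'v"
    and V :: "int \<Rightarrow> 'v set"
    and b :: "'v \<Rightarrow> 'v \<Rightarrow> 'k"
    and E :: "('v \<times> 'v) list"
    and Q :: "('v, 'k) pelem \<Rightarrow> ('v, 'k) pelem"
    and \<Omega>\<^sub>Q :: "'v list \<Rightarrow> 'k"
    and fin :: bool
  defines "d \<equiv> \<lambda>\<Omega>. bracket V E \<Omega>\<^sub>Q \<Omega>"
    and "\<delta> \<equiv> \<lambda>n C. commutator 1 Q n C"
  assumes "graded_space s V"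
    and "quadratic_form s V b"
    and "dual_bases s V b E"
    and "\<Omega>\<^sub>Q = Omega s V b Q"
    and "(\<exists>q. quadratic_prelie s V b q \<and> Q = coder_ext s V 1 (prelie_map V q)) \<or>
         (pinczon_prelie fin s V E \<Omega>\<^sub>Q \<and> Q \<in> bcoders fin s V b 1)"
  shows "coboundary fscale (\<lambda>_. bisym fin s V) (\<lambda>_. d)
    \<and> coboundary fscale (bisym_deg fin s V) (\<lambda>_. d)
    \<and> pre_Linf s V Q
    \<and> coboundary (\<lambda>c C p. fscale c (C p)) (bcoders fin s V b) \<delta>
    \<and> (\<forall>n. \<forall>C\<in>bcoders fin s V b n. \<forall>C'\<in>bcoders fin s V b n. \<forall>c.
         Omega s V b (C + C') = Omega s V b C + Omega s V b C' \<and>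
         Omega s V b (\<lambda>p. fscale c (C p)) = fscale c (Omega s V b C))
    \<and> (\<forall>n. bij_betw (\<lambda>H. Omega s V b ` H)
         (cohomology (bcoders fin s V b) \<delta> n)
         (cohomology (bisym_deg fin s V) (\<lambda>_. d) (n + 2)))"
proof -
  interpret quadratic_bases s V b E
    by unfold_locales (fact assms)+
  \<comment> \<open>The alternatives differ in the origin of [Q, Q] = 0: the pre-Lie identity in the
    first, the vanishing of the bracket of the form with itself in the second, where 2 is inverted
    and \<open>Omega\<close> is injective.\<close>
  have "Q \<in> bcoders fin s V b 1 \<and> commutator 1 Q 1 Q = 0"
    using assms(7)
  proof
    assume "\<exists>q. quadratic_prelie s V b q \<and> Q = coder_ext s V 1 (prelie_map V q)"
    then show ?thesis using prelie_bcoders prelie_commutator by blast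
  next
    assume p: "pinczon_prelie fin s V E \<Omega>\<^sub>Q \<and> Q \<in> bcoders fin s V b 1"
    then have Q: "Q \<in> bcoders fin s V b 1" by simp
    note C = commutator_bcoders[OF Q Q]
    have "fscale 2 (Omega s V b (commutator 1 Q 1 Q)) = 0"
      using p unfolding assms(6) pinczon_prelie_def bracket_Omega[OF Q Q, symmetric] by simp
    then have "fscale (1 / 2) (fscale 2 (Omega s V b (commutator 1 Q 1 Q))) = 0" by simp
    then have "Omega s V b (commutator 1 Q 1 Q) = Omega s V b (\<lambda>p. 0)"
      unfolding Omega_zero(1)[OF Q] by (simp add: fscale_def)
    then have "commutator 1 Q 1 Q = (\<lambda>p. 0)" by (rule Omega_inj[OF C Omega_zero(2)[OF C]])
    then show ?thesis using Q by (simp add: zero_fun_def)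
  qed
  then have Q: "Q \<in> bcoders fin s V b 1" and QQ: "commutator 1 Q 1 Q = 0" by auto
  note results = coboundary_bisym[OF Q QQ] coboundary_bisym_deg[OF Q QQ] coboundary_bcoders[OF Q QQ]
    cohomology_bij[OF Q QQ]
  show ?thesis
    unfolding d_def \<delta>_def assms(6) pre_Linf_def
    using results QQ bcodersD(1)[OF Q] Omega_linear(1,2) by blast
qed

end
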